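(* Let $\mathcal{K}\subset\mathbb{P}^2$ be the Klein quartic curve over $\mathbb{C}$, $\mathcal{K}=\{[x:y:z] : x^3y+y^3z+z^3x=0\}$, let $K$ be its canonical divisor class (the class of the intersection of $\mathcal{K}$ with any line in $\mathbb{P}^2$), and let $a=[1:0:0]$, $b=[0:1:0]$, $c=[0:0:1]$, which are points of $\mathcal{K}$. Then the divisor class $\theta:=2a+2b+2c-K$ is the unique spin structure on $\mathcal{K}$ fixed by the entire automorphism group $Aut(\mathcal{K})=PSL(2,\mathbf{F}_7)$.
   Context: Here a spin structure (theta characteristic) on a closed Riemann surface $C$ is a divisor class $D$ in the divisor class group $Cl(C)$ (divisors modulo linear equivalence) with $2D=K$ in $Cl(C)$, where $K$ is the canonical class. An automorphism $f$ of $C$ acts on the set of spin structures by $\sum n_iP_i\mapsto\sum n_i f^{-1}(P_i)$. *)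

theory Defs
  imports
    "HOL-Complex_Analysis.Complex_Analysis"
    "HOL-Algebra.Algebra"
    "HOL-Algebra.Bij"
    "HOL-Library.Numeral_Type"
begin

section \<open>The complex projective plane\<close>

quotient_type cp2 = "complex ^ 3" /
  partial: "\<lambda>v w. v \<noteq> 0 \<and> w \<noteq> 0 \<and> (\<exists>c. c \<noteq> 0 \<and> w = c *s v)"
proof (rule part_equivpI)
  show "\<exists>v::complex^3. v \<noteq> 0 \<and> v \<noteq> 0 \<and> (\<exists>c. c \<noteq> 0 \<and> v = c *s v)"
    by (rule exI[of _ "axis 1 1"]) (auto intro!: exI[of _ 1] simp: axis_eq_0_iff)
  show "symp (\<lambda>v w. v \<noteq> 0 \<and> (w::complex^3) \<noteq> 0 \<and> (\<exists>c. c \<noteq> 0 \<and> w = c *s v))"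
  proof (rule sympI)
    fix v w :: "complex^3"
    assume "v \<noteq> 0 \<and> w \<noteq> 0 \<and> (\<exists>c. c \<noteq> 0 \<and> w = c *s v)"
    then obtain c where "v \<noteq> 0" "w \<noteq> 0" "c \<noteq> 0" "w = c *s v" by blast
    then show "w \<noteq> 0 \<and> v \<noteq> 0 \<and> (\<exists>c. c \<noteq> 0 \<and> v = c *s w)"
      by (auto intro!: exI[of _ "inverse c"])
  qed
  show "transp (\<lambda>v w. v \<noteq> 0 \<and> (w::complex^3) \<noteq> 0 \<and> (\<exists>c. c \<noteq> 0 \<and> w = c *s v))"
  proof (rule transpI)
    fix u v w :: "complex^3"
    assume "u \<noteq> 0 \<and> v \<noteq> 0 \<and> (\<exists>c. c \<noteq> 0 \<and> v = c *s u)"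
      and "v \<noteq> 0 \<and> w \<noteq> 0 \<and> (\<exists>c. c \<noteq> 0 \<and> w = c *s v)"
    then obtain c d where "u \<noteq> 0" "w \<noteq> 0" "c \<noteq> 0" "d \<noteq> 0" "v = c *s u" "w = d *s v" by blast
    then show "u \<noteq> 0 \<and> w \<noteq> 0 \<and> (\<exists>c. c \<noteq> 0 \<and> w = c *s u)"
      by (auto intro!: exI[of _ "d * c"])
  qed
qed

text \<open>The point with a given vector of homogeneous coordinates; the value at \<open>0\<close> is irrelevant.\<close>

definition proj :: "complex ^ 3 \<Rightarrow> cp2" where
  "proj = abs_cp2"

definition pt :: "complex \<Rightarrow> complex \<Rightarrow> complex \<Rightarrow> cp2" where
  "pt x y z = proj (vector [x, y, z])"

definition klein :: "cp2 set" where
  "klein = {pt x y z | x y z. (x, y, z) \<noteq> (0, 0, 0) \<and> x^3 * y + y^3 * z + z^3 * x = 0}"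


section \<open>Smooth curves in the plane as Riemann surfaces\<close>

text \<open>
  A smooth projective plane curve \<open>C\<close> carries the complex structure induced from the plane.
  It is described here by its local holomorphic parametrizations: immersions of a disc
  around \<open>0\<close> into \<open>C\<close>, given by a holomorphic lift to homogeneous coordinates. The map
  \<open>t \<mapsto> [\<gamma> t]\<close> is an immersion at \<open>0\<close> iff \<open>\<gamma>' 0\<close> is not a multiple of \<open>\<gamma> 0\<close>, since
  the tangent space of the plane at \<open>[v]\<close> is the quotient of the space of vectors by the
  line through \<open>v\<close>. Inverses of such germs are exactly the (centred) germs of holomorphic
  charts of \<open>C\<close>. The definitions below are meant for smooth \<open>C\<close> only.
\<close>

definition holo_arc :: "real \<Rightarrow> (complex \<Rightarrow> complex ^ 3) \<Rightarrow> bool" where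
  "holo_arc r \<gamma> \<longleftrightarrow> (\<forall>i. (\<lambda>t. \<gamma> t $ i) holomorphic_on ball 0 r) \<and> (\<forall>t\<in>ball 0 r. \<gamma> t \<noteq> 0)"

definition local_param :: "cp2 set \<Rightarrow> cp2 \<Rightarrow> (complex \<Rightarrow> complex ^ 3) \<Rightarrow> bool" where
  "local_param C P \<gamma> \<longleftrightarrow>
     proj (\<gamma> 0) = P \<and>
     (\<exists>r>0. holo_arc r \<gamma> \<and> (\<forall>t\<in>ball 0 r. proj (\<gamma> t) \<in> C)) \<and>
     (\<nexists>c. (\<chi> i. deriv (\<lambda>t. \<gamma> t $ i) 0) = c *s \<gamma> 0)"

definition holomorphic_map :: "cp2 set \<Rightarrow> (cp2 \<Rightarrow> cp2) \<Rightarrow> bool" where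
  "holomorphic_map C f \<longleftrightarrow> f ` C \<subseteq> C \<and>
     (\<forall>P\<in>C. \<forall>\<gamma>. local_param C P \<gamma> \<longrightarrow>
        (\<exists>r>0. \<exists>\<delta>. holo_arc r \<delta> \<and> (\<forall>t\<in>ball 0 r. f (proj (\<gamma> t)) = proj (\<delta> t))))"

text \<open>The automorphism group: biholomorphic self-maps (made extensional outside \<open>C\<close>).\<close>

definition aut_group :: "cp2 set \<Rightarrow> (cp2 \<Rightarrow> cp2) monoid" where
  "aut_group C = BijGroup C
     \<lparr>carrier := {f \<in> Bij C. holomorphic_map C f \<and> holomorphic_map C (inv_into C f)}\<rparr>"

text \<open>The values at poles are arbitrary, as in \<^const>\<open>meromorphic_on\<close>.\<close>

definition meromorphic_fun :: "cp2 set \<Rightarrow> (cp2 \<Rightarrow> complex) \<Rightarrow> bool" where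
  "meromorphic_fun C f \<longleftrightarrow>
     (\<forall>P\<in>C. \<forall>\<gamma>. local_param C P \<gamma> \<longrightarrow> (\<lambda>t. f (proj (\<gamma> t))) meromorphic_on {0})"


section \<open>Divisors and divisor classes\<close>

text \<open>
  Functions, differentials and homogeneous forms on \<open>C\<close> all give, for each local
  parametrization \<open>\<gamma>\<close>, a local expression \<open>\<Phi> \<gamma>\<close> in the coordinate \<open>t\<close>, and their order of
  vanishing at a point is that of the local expression at \<open>0\<close>. Both the nonvanishing
  condition and the order are independent of the choice of \<open>\<gamma>\<close> and of its lift. Nonvanishing
  is required near every point, which on a connected curve means not identically zero.
\<close>

definition has_divisor ::
  "cp2 set \<Rightarrow> ((complex \<Rightarrow> complex ^ 3) \<Rightarrow> complex \<Rightarrow> complex) \<Rightarrow> (cp2 \<Rightarrow>\<^sub>0 int) \<Rightarrow> bool" where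
  "has_divisor C \<Phi> D \<longleftrightarrow> D \<in> carrier (free_Abelian_group C) \<and>
     (\<forall>P\<in>C. \<forall>\<gamma>. local_param C P \<gamma> \<longrightarrow>
        \<Phi> \<gamma> meromorphic_on {0} \<and> (\<exists>\<^sub>F t in at 0. \<Phi> \<gamma> t \<noteq> 0) \<and>
        zorder (\<Phi> \<gamma>) 0 = Poly_Mapping.lookup D P)"

definition fun_expr ::
  "(cp2 \<Rightarrow> complex) \<Rightarrow> (complex \<Rightarrow> complex ^ 3) \<Rightarrow> complex \<Rightarrow> complex" where
  "fun_expr f \<gamma> t = f (proj (\<gamma> t))"

text \<open>The coefficient of \<open>dt\<close> in the pullback along \<open>\<gamma>\<close> of the differential \<open>f dg\<close>.\<close>

definition form_expr ::
  "(cp2 \<Rightarrow> complex) \<Rightarrow> (cp2 \<Rightarrow> complex) \<Rightarrow> (complex \<Rightarrow> complex ^ 3) \<Rightarrow> complex \<Rightarrow> complex" where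
  "form_expr f g \<gamma> t = f (proj (\<gamma> t)) * deriv (\<lambda>s. g (proj (\<gamma> s))) t"

text \<open>
  The equation \<open>u\<^sub>1 x + u\<^sub>2 y + u\<^sub>3 z\<close> of a line; its divisor on \<open>C\<close> is the intersection
  divisor of \<open>C\<close> with that line.
\<close>

definition line_expr ::
  "complex ^ 3 \<Rightarrow> (complex \<Rightarrow> complex ^ 3) \<Rightarrow> complex \<Rightarrow> complex" where
  "line_expr u \<gamma> t = (\<Sum>i\<in>UNIV. u $ i * \<gamma> t $ i)"

definition principal_divisors :: "cp2 set \<Rightarrow> (cp2 \<Rightarrow>\<^sub>0 int) set" where
  "principal_divisors C = {D. \<exists>f. has_divisor C (fun_expr f) D}"

definition class_group :: "cp2 set \<Rightarrow> (cp2 \<Rightarrow>\<^sub>0 int) set monoid" where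
  "class_group C = free_Abelian_group C Mod principal_divisors C"

definition divisor_class :: "cp2 set \<Rightarrow> (cp2 \<Rightarrow>\<^sub>0 int) \<Rightarrow> (cp2 \<Rightarrow>\<^sub>0 int) set" where
  "divisor_class C D = principal_divisors C #>\<^bsub>free_Abelian_group C\<^esub> D"

text \<open>
  The divisors of all nonzero meromorphic differentials; these form a single linear
  equivalence class, so this is an element of the class group. Every meromorphic differential
  on a closed Riemann surface has the form \<open>f dg\<close> with meromorphic functions \<open>f\<close> and \<open>g\<close>.
\<close>

definition canonical_class :: "cp2 set \<Rightarrow> (cp2 \<Rightarrow>\<^sub>0 int) set" where
  "canonical_class C = {D. \<exists>f g. meromorphic_fun C f \<and> meromorphic_fun C g \<and>
     has_divisor C (form_expr f g) D}"

definition spin_structures :: "cp2 set \<Rightarrow> (cp2 \<Rightarrow>\<^sub>0 int) set set" where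
  "spin_structures C =
     {S \<in> carrier (class_group C). S \<otimes>\<^bsub>class_group C\<^esub> S = canonical_class C}"

text \<open>
  The action on classes induced by \<open>\<Sum> n\<^sub>i P\<^sub>i \<mapsto> \<Sum> n\<^sub>i f\<inverse>(P\<^sub>i)\<close>; a class is a set of
  divisors, and is mapped to its image.
\<close>

definition class_act ::
  "cp2 set \<Rightarrow> (cp2 \<Rightarrow> cp2) \<Rightarrow> (cp2 \<Rightarrow>\<^sub>0 int) set \<Rightarrow> (cp2 \<Rightarrow>\<^sub>0 int) set" where
  "class_act C f S = frag_extend (\<lambda>P. frag_of (inv_into C f P)) ` S"


section \<open>The group PSL(2,7)\<close>

text \<open>The numeral type \<open>7\<close> is the ring of integers modulo \<open>7\<close>.\<close>

definition SL27 :: "(7 ^ 2 ^ 2) monoid" where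
  "SL27 = \<lparr>carrier = {A. det A = 1}, mult = (**), one = mat 1\<rparr>"

definition PSL27 :: "(7 ^ 2 ^ 2) set monoid" where
  "PSL27 = SL27 Mod {mat 1, - mat 1}"

end

theory Submission
  imports Defs
begin

text \<open>
  The diagonal symmetry \<open>g\<close> of order 7 has quotient map \<open>phi = x\<^sup>2 y / z\<^sup>3\<close> onto the
  sphere and fixes exactly the points \<open>a\<close>, \<open>b\<close>, \<open>c\<close>. Functions on the curve are therefore
  controlled by averaging over \<open>\<langle>g\<rangle>\<close>: an eigenfunction of \<open>g\<close> is a monomial in \<open>x\<close>, \<open>y\<close>, \<open>z\<close> times a
  rational function of \<open>phi\<close>. Applied to canonical sections this shows that they are the
  linear forms, so that every automorphism is linear.

  Uniqueness: if \<open>2 D \<sim> 0\<close> and \<open>g\<close> fixes the class of \<open>D\<close>, then \<open>7 D\<close> is equivalent to the trace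
  of \<open>D\<close>, a multiple of \<open>7 b\<close>; hence \<open>D\<close> is equivalent to a multiple of \<open>b\<close>, whose class has
  infinite order unless the multiple is zero. Invariance: up to a constant, \<open>xyz\<close> times its image
  under an involution \<open>s\<close> is on the curve the square of a cubic form, which yields a function
  with divisor \<open>s\<^sup>*\<theta> - \<theta>\<close>.

  The flexes correspond to the nonzero vectors modulo 7 up to sign, with \<open>g\<close> and \<open>s\<close>
  acting as generators of \<open>SL(2,7)\<close>. An automorphism fixing the flex \<open>a\<close> is diagonal and
  hence a power of \<open>g\<close>, so \<open>g\<close> and \<open>s\<close> generate the whole automorphism group.
\<close>

text \<open>Degrees of divisors and Riemann-Roch do not enter; the global analytic input is
  Liouville's theorem. It yields one principle, \<open>const\<close> in
  \<open>invariant_function\<close>: a function invariant under the order 7 symmetry, regular off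
  the three vertices and with poles of order at most 6 there, is constant. Because
  \<open>phi\<close> is ramified to order 7 at the vertices, such a pole has order less than one on
  the quotient sphere. The description of canonical sections and the infinite order of the class of
  \<open>ptB\<close> both reduce to this. The definitions of divisors quantify over all local
  parametrizations. Orders are therefore computed along explicit parameters through which every arc
  factors (\<open>upar\<close>) and then transferred to all others. Invariance of theta under a
  general automorphism is not approached directly. It is made part of the relation
  \<open>acts_as\<close> between automorphisms and matrices, which is closed under composition; so a
  check on generators, together with surjectivity onto the automorphism group, gives it
  everywhere.\<close>

no_notation fps_nth (infixl \<open>$\<close> 75)

section \<open>The curve in homogeneous coordinates\<close>

definition F4 :: "complex^3 \<Rightarrow> complex" where
  "F4 v = v$1^3 * v$2 + v$2^3 * v$3 + v$3^3 * v$1"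

lemma vec3_eqI: "v$1 = w$1 \<Longrightarrow> v$2 = w$2 \<Longrightarrow> v$3 = w$3 \<Longrightarrow> v = (w :: 'a^3)"
  by (simp add: vec_eq_iff forall_3)

lemma vec3_eq_iff: "v = w \<longleftrightarrow> v$1 = w$1 \<and> v$2 = w$2 \<and> v$3 = (w :: 'a^3)$3"
  by (auto intro: vec3_eqI)

lemma vector_3_collapse: "vector [v$1, v$2, v$3] = (v :: 'a::zero^3)"
  by (simp add: vec3_eq_iff)

lemma proj_eq_iff:
  assumes "v \<noteq> 0" "w \<noteq> 0"
  shows "proj v = proj w \<longleftrightarrow> (\<exists>c. c \<noteq> 0 \<and> w = c *s v)"
proof -
  have "u \<noteq> 0 \<and> u \<noteq> 0 \<and> (\<exists>c. c \<noteq> 0 \<and> u = c *s u)" if "u \<noteq> 0" for u :: "complex^3"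
    using that by (auto intro: exI[of _ 1])
  then show ?thesis
    using Quotient_rel[OF Quotient_cp2, of v w] assms unfolding proj_def by blast
qed

lemma proj_scale: "v \<noteq> 0 \<Longrightarrow> c \<noteq> 0 \<Longrightarrow> proj (c *s v) = proj v"
  by (subst proj_eq_iff) (auto intro!: exI[of _ "inverse c"])

lemma proj_cases: obtains v where "v \<noteq> 0" "P = proj v"
  using Quotient_rep_reflp[OF Quotient_cp2, of P] Quotient_abs_rep[OF Quotient_cp2, of P]
  by (metis proj_def)

definition rep :: "cp2 \<Rightarrow> complex^3" where "rep P = (SOME v. v \<noteq> 0 \<and> proj v = P)"

lemma rep: "rep P \<noteq> 0" "proj (rep P) = P"
proof -
  have "rep P \<noteq> 0 \<and> proj (rep P) = P"
    unfolding rep_def by (rule someI_ex) (metis proj_cases)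
  then show "rep P \<noteq> 0" "proj (rep P) = P" by auto
qed

lemma rep_proj: assumes "v \<noteq> 0" obtains c where "c \<noteq> 0" "rep (proj v) = c *s v"
  using proj_eq_iff[of v "rep (proj v)"] rep assms by metis

lemma F4_scale: "F4 (c *s v) = c^4 * F4 v"
  unfolding F4_def vector_smult_component by Groebner_Basis.algebra

lemma klein_iff_rep: "P \<in> klein \<longleftrightarrow> F4 (rep P) = 0"
proof
  assume "P \<in> klein"
  then obtain x y z where P: "P = proj (vector [x,y,z])" "(x,y,z) \<noteq> (0,0,0)"
    "x^3 * y + y^3 * z + z^3 * x = 0"
    unfolding klein_def pt_def by blast
  have nz: "vector [x,y,z] \<noteq> (0 :: complex^3)" using P by (auto simp: vec3_eq_iff)
  obtain c where "rep P = c *s vector [x,y,z]" using rep_proj[OF nz] P(1) by metis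
  then show "F4 (rep P) = 0" using P(3) by (simp only: F4_scale) (simp add: F4_def)
next
  assume "F4 (rep P) = 0"
  then show "P \<in> klein"
    unfolding klein_def pt_def F4_def using rep[of P]
    by (intro CollectI exI[of _ "rep P $ 1"] exI[of _ "rep P $ 2"] exI[of _ "rep P $ 3"])
      (auto simp: vector_3_collapse vec3_eq_iff)
qed

lemma proj_in_klein_iff: "v \<noteq> 0 \<Longrightarrow> proj v \<in> klein \<longleftrightarrow> F4 v = 0"
proof -
  assume "v \<noteq> 0"
  then obtain c where "c \<noteq> 0" "rep (proj v) = c *s v" using rep_proj by blast
  then show ?thesis by (simp only: klein_iff_rep F4_scale) simp
qed

lemma proj_coord_eq:
  assumes "v \<noteq> 0" "w \<noteq> 0"
  shows "proj v = proj w \<longleftrightarrow> v$1 * w$2 = v$2 * w$1 \<and> v$2 * w$3 = v$3 * w$2 \<and> v$3 * w$1 = v$1 * w$3"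
    (is "?L \<longleftrightarrow> ?R")
proof
  assume ?L then show ?R using proj_eq_iff[OF assms] by auto
next
  assume R: ?R
  have "\<exists>i. v$i \<noteq> 0" using assms(1) by (auto simp: vec_eq_iff)
  then consider "v$1 \<noteq> 0" | "v$2 \<noteq> 0" | "v$3 \<noteq> 0" using exhaust_3 by metis
  then obtain c where c: "w = c *s v"
  proof cases
    case 1
    show ?thesis by (rule that[of "w$1 / v$1"]) (use 1 R in \<open>auto simp: vec3_eq_iff field_simps\<close>)
  next
    case 2
    show ?thesis by (rule that[of "w$2 / v$2"]) (use 2 R in \<open>auto simp: vec3_eq_iff field_simps\<close>)
  next
    case 3
    show ?thesis by (rule that[of "w$3 / v$3"]) (use 3 R in \<open>auto simp: vec3_eq_iff field_simps\<close>)
  qed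
  then have "c \<noteq> 0" using assms(2) by auto
  then show ?L using c proj_eq_iff[OF assms] by auto
qed

text \<open>Meant for two forms of equal degree, for which the choice made by \<open>rep\<close>
  cancels.\<close>

definition ratf :: "(complex^3 \<Rightarrow> complex) \<Rightarrow> (complex^3 \<Rightarrow> complex) \<Rightarrow> cp2 \<Rightarrow> complex" where
  "ratf A B P = A (rep P) / B (rep P)"

lemma ratf_proj:
  assumes "\<And>c v. A (c *s v) = c^n * A v" "\<And>c v. B (c *s v) = c^n * B v" "v \<noteq> 0"
  shows "ratf A B (proj v) = A v / B v"
proof -
  obtain c where "c \<noteq> 0" "rep (proj v) = c *s v" using rep_proj[OF assms(3)] .
  then show ?thesis by (simp add: ratf_def assms(1,2))
qed

definition ptA :: cp2 where "ptA = pt 1 0 0"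
definition ptB :: cp2 where "ptB = pt 0 1 0"
definition ptC :: cp2 where "ptC = pt 0 0 1"

lemma vec100_nonzero: "vector [1,0,0] \<noteq> (0::complex^3)" "vector [0,1,0] \<noteq> (0::complex^3)"
  "vector [0,0,1] \<noteq> (0::complex^3)"
  by (auto simp: vec3_eq_iff)

lemma proj_eq_abc:
  assumes "v \<noteq> 0"
  shows "proj v = ptA \<longleftrightarrow> v$2 = 0 \<and> v$3 = 0" "proj v = ptB \<longleftrightarrow> v$1 = 0 \<and> v$3 = 0"
    "proj v = ptC \<longleftrightarrow> v$1 = 0 \<and> v$2 = 0"
  unfolding ptA_def ptB_def ptC_def pt_def
  using assms by (auto simp: proj_coord_eq vec100_nonzero vec3_eq_iff)

lemma abc_in_klein: "ptA \<in> klein" "ptB \<in> klein" "ptC \<in> klein"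
  unfolding ptA_def ptB_def ptC_def pt_def
  by (auto simp: proj_in_klein_iff vec100_nonzero F4_def)

lemma abc_distinct: "ptA \<noteq> ptB" "ptB \<noteq> ptA" "ptB \<noteq> ptC" "ptC \<noteq> ptB" "ptA \<noteq> ptC" "ptC \<noteq> ptA"
  unfolding ptA_def ptB_def ptC_def pt_def
  by (auto simp: proj_coord_eq vec100_nonzero)

text \<open>Setting one coordinate to zero leaves a single monomial of the equation, so a coordinate
  line meets the curve in two vertices only.\<close>

lemma klein_coord_zero:
  assumes "v \<noteq> 0" "F4 v = 0"
  shows "v$1 = 0 \<longleftrightarrow> proj v = ptB \<or> proj v = ptC" "v$2 = 0 \<longleftrightarrow> proj v = ptA \<or> proj v = ptC"
    "v$3 = 0 \<longleftrightarrow> proj v = ptA \<or> proj v = ptB"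
  using assms by (auto simp: proj_eq_abc F4_def)

text \<open>\<open>phi\<close> is the quotient map by the diagonal symmetry of order 7; on \<open>z = 1\<close> the curve becomes
  \<open>y\<^sup>7 = phi (1 + phi)\<^sup>2\<close>, \<open>x = -y\<^sup>3 / (1 + phi)\<close>.\<close>

definition phi :: "cp2 \<Rightarrow> complex" where
  "phi = ratf (\<lambda>v. v$1^2 * v$2) (\<lambda>v. v$3^3)"

lemma phi_proj: "v \<noteq> 0 \<Longrightarrow> phi (proj v) = v$1^2 * v$2 / v$3^3"
  unfolding phi_def by (rule ratf_proj[where n = 3]) (auto simp: power_mult_distrib power2_eq_square power3_eq_cube)

text \<open>With z = 1 one has x^3 y = l x, so the equation becomes x (1 + l) = - y^3. Squaring this
  and multiplying by y gives y^7 = l (1 + l)^2.\<close>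

lemma klein_phi:
  assumes F: "F4 v = 0" and z: "v$3 \<noteq> 0" "v$1 \<noteq> 0"
    and l: "l = v$1^2 * v$2 / v$3^3"
  shows "l \<noteq> 0" "1 + l \<noteq> 0" "v$2 / v$3 \<noteq> 0" "v$1 / v$3 = - ((v$2 / v$3)^3) / (1 + l)"
    "(v$2 / v$3)^7 = l * (1 + l)^2"
proof -
  define x where "x = v$1 / v$3"
  define y where "y = v$2 / v$3"
  have xy: "v$1 = x * v$3" "v$2 = y * v$3" using z by (auto simp: x_def y_def)
  have "v$3^4 * (x^3*y + y^3 + x) = 0"
    using F unfolding F4_def xy by Groebner_Basis.algebra
  then have E: "x^3*y + y^3 + x = 0" using z by simp
  have x0: "x \<noteq> 0" using z by (simp add: x_def)
  have y0: "y \<noteq> 0" using E x0 by auto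
  have lx: "l = x^2 * y" unfolding l xy using z by (simp add: eval_nat_numeral)
  have "x * (1 + l) + y^3 = x^3*y + y^3 + x" unfolding lx by Groebner_Basis.algebra
  then have E2: "x * (1 + l) = - (y^3)" using E by (simp add: eq_neg_iff_add_eq_0)
  show l0: "l \<noteq> 0" using lx x0 y0 by simp
  show l1: "1 + l \<noteq> 0" using E2 y0 by auto
  show "v$2 / v$3 \<noteq> 0" using y0 y_def by simp
  show "v$1 / v$3 = - ((v$2 / v$3)^3) / (1 + l)" 
    unfolding x_def[symmetric] y_def[symmetric] using E2 l1 by (metis nonzero_mult_div_cancel_right)
  have "y^6 = (x * (1+l))^2" unfolding E2 by simp
  then have "y^7 = y * (x * (1+l))^2" by Groebner_Basis.algebra
  also have "\<dots> = l * (1+l)^2" unfolding lx by Groebner_Basis.algebra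
  finally show "(v$2 / v$3)^7 = l * (1 + l)^2" unfolding y_def .
qed

text \<open>Converse of \<open>klein_phi\<close>. Multiplying by a power of \<open>m = 1 + l\<close>
  clears the denominator of x; the equation and the value of phi then both follow from y^7 = (m - 1)
  m^2.\<close>

lemma klein_of_phi:
  assumes "y^7 = l * (1 + l)^2" "1 + l \<noteq> 0"
  defines "v \<equiv> vector [- (y^3) / (1 + l), y, 1] :: complex^3"
  shows "F4 v = 0" "v \<noteq> 0" "v$1^2 * v$2 / v$3^3 = l"
proof -
  define m where "m = 1 + l"
  have m: "m \<noteq> 0" "l = m - 1" using assms by (auto simp: m_def)
  have y7: "y^7 = (m - 1) * m^2" using assms(1) m by simp
  define u where "u = - (y^3) / m"
  have um: "u * m = - (y^3)" using m by (simp add: u_def)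
  have v: "v$1 = u" "v$2 = y" "v$3 = 1" by (auto simp: v_def u_def m_def)
  have "m^3 * (u^3*y + y^3 + u) = (u*m)^3 * y + y^3 * m^3 + (u*m) * m^2" by Groebner_Basis.algebra
  also have "\<dots> = y^3 * (m^3 - m^2 - y^7)" unfolding um by Groebner_Basis.algebra
  also have "\<dots> = 0" unfolding y7 by Groebner_Basis.algebra
  finally show "F4 v = 0" using m by (simp add: F4_def v)
  show "v \<noteq> 0" by (simp add: v_def vec3_eq_iff)
  have "m^2 * (u^2 * y) = (u*m)^2 * y" by Groebner_Basis.algebra
  also have "\<dots> = m^2 * l" unfolding um using y7 m(2) by Groebner_Basis.algebra
  finally have "v$1^2 * v$2 / v$3^3 = l" using m by (simp add: v)
  then show "v$1^2 * v$2 / v$3^3 = l" .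
qed

section \<open>Orders of vanishing\<close>

text \<open>A lower bound for the order at 0 that, unlike \<open>zorder\<close>, also makes sense
  for functions vanishing near 0. The value at 0 itself is ignored, since values at poles are
  arbitrary.\<close>

definition ordge :: "(complex \<Rightarrow> complex) \<Rightarrow> int \<Rightarrow> bool" where
  "ordge w n \<longleftrightarrow> (\<exists>u. u analytic_on {0} \<and> (\<forall>\<^sub>F t in at 0. w t = u t * t powi n))"

definition ordeq :: "(complex \<Rightarrow> complex) \<Rightarrow> int \<Rightarrow> bool" where
  "ordeq w n \<longleftrightarrow> (\<exists>u. u analytic_on {0} \<and> u 0 \<noteq> 0 \<and> (\<forall>\<^sub>F t in at 0. w t = u t * t powi n))"

lemma eventually_at_nonzero: "\<forall>\<^sub>F t in at 0. t \<noteq> (0::complex)"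
  by (simp add: eventually_at_filter)

lemma eventually_at_of_nhds: "\<forall>\<^sub>F t in nhds (0::complex). P t \<Longrightarrow> \<forall>\<^sub>F t in at 0. P t"
  by (auto simp: eventually_at_filter elim: eventually_mono)

lemma analytic_eventually:
  assumes "u analytic_on {0::complex}"
  shows "\<forall>\<^sub>F t in nhds 0. u analytic_on {t}"
proof -
  obtain S where S: "open S" "0 \<in> S" "u holomorphic_on S" using assms by (auto simp: analytic_at)
  then have "\<forall>\<^sub>F t in nhds 0. t \<in> S" by (simp add: eventually_nhds_in_open)
  then show ?thesis by eventually_elim (use S in \<open>auto simp: analytic_at\<close>)
qed

lemma analytic_eventually_nonzero:
  assumes "u analytic_on {0::complex}" "u 0 \<noteq> 0"
  shows "\<forall>\<^sub>F t in nhds 0. u t \<noteq> 0"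
  using tendsto_imp_eventually_ne[OF analytic_at_imp_isCont[OF assms(1), unfolded isCont_def] assms(2)] assms(2)
  by (simp add: eventually_nhds_conv_at)

lemma ordeq_ordge: "ordeq w n \<Longrightarrow> ordge w n"
  by (auto simp: ordeq_def ordge_def)

lemma ordge_cong: "\<forall>\<^sub>F t in at 0. w t = w' t \<Longrightarrow> ordge w' n \<Longrightarrow> ordge w n"
proof -
  assume ev: "\<forall>\<^sub>F t in at 0. w t = w' t" and "ordge w' n"
  then obtain u where u: "u analytic_on {0}" "\<forall>\<^sub>F t in at 0. w' t = u t * t powi n"
    by (auto simp: ordge_def)
  have "\<forall>\<^sub>F t in at 0. w t = u t * t powi n" using ev u(2) by eventually_elim simp
  then show ?thesis using u unfolding ordge_def by blast
qed

lemma ordeq_cong: "\<forall>\<^sub>F t in at 0. w t = w' t \<Longrightarrow> ordeq w' n \<Longrightarrow> ordeq w n"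
proof -
  assume ev: "\<forall>\<^sub>F t in at 0. w t = w' t" and "ordeq w' n"
  then obtain u where u: "u analytic_on {0}" "u 0 \<noteq> 0" "\<forall>\<^sub>F t in at 0. w' t = u t * t powi n"
    by (auto simp: ordeq_def)
  have "\<forall>\<^sub>F t in at 0. w t = u t * t powi n" using ev u(3) by eventually_elim simp
  then show ?thesis using u unfolding ordeq_def by blast
qed

lemma ordge_analytic: "u analytic_on {0} \<Longrightarrow> ordge u 0"
  by (auto simp: ordge_def)

lemma ordeq_analytic: "u analytic_on {0} \<Longrightarrow> u 0 \<noteq> 0 \<Longrightarrow> ordeq u 0"
  by (auto simp: ordeq_def)

lemma ordge_zero: "ordge (\<lambda>_. 0) n"
  unfolding ordge_def by (rule exI[of _ "\<lambda>_. 0"]) auto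

lemma ordeq_const: "c \<noteq> 0 \<Longrightarrow> ordeq (\<lambda>_. c) 0"
  by (rule ordeq_analytic) auto

lemma ordeq_powi: "ordeq (\<lambda>t. t powi n) n"
  unfolding ordeq_def by (rule exI[of _ "\<lambda>_. 1"]) auto

lemma ordeq_ident: "ordeq (\<lambda>t. t) 1"
  using ordeq_powi[of 1] by simp

lemma ordge_mult: assumes "ordge v m" "ordge w n" shows "ordge (\<lambda>t. v t * w t) (m + n)"
proof -
  obtain a b where ab: "a analytic_on {0}" "b analytic_on {0}"
    "\<forall>\<^sub>F t in at 0. v t = a t * t powi m" "\<forall>\<^sub>F t in at 0. w t = b t * t powi n"
    using assms by (auto simp: ordge_def)
  have "\<forall>\<^sub>F t in at 0. v t * w t = (a t * b t) * t powi (m + n)"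
    using ab(3,4) eventually_at_nonzero by eventually_elim (simp add: power_int_add)
  then show ?thesis unfolding ordge_def using ab by (intro exI[of _ "\<lambda>t. a t * b t"]) (auto intro: analytic_intros)
qed

lemma ordeq_mult: assumes "ordeq v m" "ordeq w n" shows "ordeq (\<lambda>t. v t * w t) (m + n)"
proof -
  obtain a b where ab: "a analytic_on {0}" "b analytic_on {0}" "a 0 \<noteq> 0" "b 0 \<noteq> 0"
    "\<forall>\<^sub>F t in at 0. v t = a t * t powi m" "\<forall>\<^sub>F t in at 0. w t = b t * t powi n"
    using assms by (auto simp: ordeq_def)
  have "\<forall>\<^sub>F t in at 0. v t * w t = (a t * b t) * t powi (m + n)"
    using ab(5,6) eventually_at_nonzero by eventually_elim (simp add: power_int_add)
  then show ?thesis unfolding ordeq_def using ab by (intro exI[of _ "\<lambda>t. a t * b t"]) (auto intro: analytic_intros)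
qed

lemma ordeq_inverse: assumes "ordeq v m" shows "ordeq (\<lambda>t. inverse (v t)) (- m)"
proof -
  obtain a where ab: "a analytic_on {0}" "a 0 \<noteq> 0"
    "\<forall>\<^sub>F t in at 0. v t = a t * t powi m"
    using assms by (auto simp: ordeq_def)
  have "\<forall>\<^sub>F t in at 0. inverse (v t) = inverse (a t) * t powi (- m)"
    using ab(3) eventually_at_nonzero by eventually_elim (simp add: power_int_minus)
  then show ?thesis unfolding ordeq_def using ab
    by (intro exI[of _ "\<lambda>t. inverse (a t)"]) (auto intro: analytic_intros)
qed

lemma ordeq_divide: assumes "ordeq v m" "ordeq w n" shows "ordeq (\<lambda>t. v t / w t) (m - n)"
  using ordeq_mult[OF assms(1) ordeq_inverse[OF assms(2)]] by (simp add: divide_inverse)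

lemma ordge_divide: assumes "ordge v m" "ordeq w n" shows "ordge (\<lambda>t. v t / w t) (m - n)"
  using ordge_mult[OF assms(1) ordeq_ordge[OF ordeq_inverse[OF assms(2)]]] by (simp add: divide_inverse)

lemma ordeq_power: assumes "ordeq v m" shows "ordeq (\<lambda>t. v t ^ k) (int k * m)"
proof (induction k)
  case (Suc k)
  show ?case using ordeq_mult[OF assms Suc] by (simp add: algebra_simps)
qed (simp add: ordeq_const)

lemma ordeq_power_int: assumes "ordeq v m" shows "ordeq (\<lambda>t. v t powi k) (k * m)"
proof (cases "k \<ge> 0")
  case True
  then show ?thesis using ordeq_power[OF assms, of "nat k"] by (simp add: power_int_def)
next
  case False
  then show ?thesis using ordeq_inverse[OF ordeq_power[OF assms, of "nat (- k)"]]
    by (simp add: power_int_def power_inverse)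
qed

lemma ordge_add: assumes "ordge v m" "ordge w m" shows "ordge (\<lambda>t. v t + w t) m"
proof -
  obtain a b where ab: "a analytic_on {0}" "b analytic_on {0}"
    "\<forall>\<^sub>F t in at 0. v t = a t * t powi m" "\<forall>\<^sub>F t in at 0. w t = b t * t powi m"
    using assms by (auto simp: ordge_def)
  have "\<forall>\<^sub>F t in at 0. v t + w t = (a t + b t) * t powi m"
    using ab(3,4) by eventually_elim (simp add: algebra_simps)
  then show ?thesis unfolding ordge_def using ab by (intro exI[of _ "\<lambda>t. a t + b t"]) (auto intro: analytic_intros)
qed

lemma ordge_cmult: assumes "ordge w m" shows "ordge (\<lambda>t. c * w t) m"
  using ordge_mult[OF ordge_analytic[of "\<lambda>_. c"] assms] by simp

lemma ordge_sum: "(\<And>i. i \<in> I \<Longrightarrow> ordge (w i) m) \<Longrightarrow> ordge (\<lambda>t. \<Sum>i\<in>I. w i t) m"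
  by (induction I rule: infinite_finite_induct) (auto intro: ordge_zero ordge_add)

lemma ordge_mono: assumes "ordge w m" "n \<le> m" shows "ordge w n"
proof -
  obtain a where a: "a analytic_on {0}" "\<forall>\<^sub>F t in at 0. w t = a t * t powi m"
    using assms by (auto simp: ordge_def)
  have "\<forall>\<^sub>F t in at 0. w t = (a t * t ^ nat (m - n)) * t powi n"
    using a(2) eventually_at_nonzero
  proof eventually_elim
    case (elim t)
    have "t powi m = t powi (int (nat (m - n))) * t powi n"
      using elim(2) assms(2) by (simp add: power_int_add[symmetric])
    also have "\<dots> = t ^ nat (m - n) * t powi n" by (simp only: power_int_of_nat)
    finally show ?case using elim by simp
  qed
  then show ?thesis unfolding ordge_def using a
    by (intro exI[of _ "\<lambda>t. a t * t ^ nat (m - n)"]) (auto intro!: analytic_intros)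
qed

lemma ordeq_eventually_nonzero: assumes "ordeq w n" shows "\<forall>\<^sub>F t in at 0. w t \<noteq> 0"
proof -
  obtain a where a: "a analytic_on {0}" "a 0 \<noteq> 0" "\<forall>\<^sub>F t in at 0. w t = a t * t powi n"
    using assms by (auto simp: ordeq_def)
  show ?thesis
    using a(3) eventually_at_nonzero eventually_at_of_nhds[OF analytic_eventually_nonzero[OF a(1,2)]]
    by eventually_elim auto
qed

lemma ordge_tendsto_0: assumes "ordge w n" "n > 0" shows "(w \<longlongrightarrow> 0) (at 0)"
proof -
  obtain a where a: "a analytic_on {0}" "\<forall>\<^sub>F t in at 0. w t = a t * t powi n"
    using assms by (auto simp: ordge_def)
  have c: "isCont (\<lambda>t. a t * t ^ nat n) 0"
    using analytic_at_imp_isCont[OF a(1)] by (intro continuous_intros)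
  have z: "(0::complex) ^ nat n = 0" using assms(2) by simp
  have "((\<lambda>t. a t * t ^ nat n) \<longlongrightarrow> 0) (at 0)" using c unfolding isCont_def z mult_zero_right .
  moreover have "\<forall>\<^sub>F t in at 0. a t * t ^ nat n = w t"
    using a(2) by eventually_elim (use assms(2) in \<open>simp add: power_int_def\<close>)
  ultimately show ?thesis using tendsto_cong by fast
qed

lemma ordge_tendsto: assumes "ordge w 0" shows "\<exists>l. (w \<longlongrightarrow> l) (at 0)"
proof -
  obtain a where a: "a analytic_on {0}" "\<forall>\<^sub>F t in at 0. w t = a t"
    using assms by (auto simp: ordge_def)
  have "(a \<longlongrightarrow> a 0) (at 0)" using analytic_at_imp_isCont[OF a(1)] by (simp add: isCont_def)
  then show ?thesis using a(2) tendsto_cong by fast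
qed

text \<open>Otherwise w times its inverse, which is 1 near 0, would have positive order and tend to
  0.\<close>

lemma ordeq_ordge_le: assumes "ordeq w n" "ordge w m" shows "m \<le> n"
proof (rule ccontr)
  assume "\<not> m \<le> n"
  have "ordge (\<lambda>t. w t * inverse (w t)) (m - n)"
    using ordge_mult[OF assms(2) ordeq_ordge[OF ordeq_inverse[OF assms(1)]]] by simp
  then have "((\<lambda>t. w t * inverse (w t)) \<longlongrightarrow> 0) (at 0)"
    using \<open>\<not> m \<le> n\<close> by (intro ordge_tendsto_0) auto
  moreover have "\<forall>\<^sub>F t in at 0. w t * inverse (w t) = 1"
    using ordeq_eventually_nonzero[OF assms(1)] by eventually_elim auto
  ultimately have "((\<lambda>_::complex. 1::complex) \<longlongrightarrow> 0) (at 0)" using tendsto_cong by fast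
  then show False using tendsto_unique[OF _ tendsto_const] trivial_limit_at by (metis one_neq_zero)
qed

lemma ordeq_unique: "ordeq w n \<Longrightarrow> ordeq w m \<Longrightarrow> n = m"
  using ordeq_ordge_le ordeq_ordge by (metis antisym)

lemma ordeq_mero: assumes "ordeq w n" shows "w meromorphic_on {0}" "\<exists>\<^sub>F t in at 0. w t \<noteq> 0" "zorder w 0 = n"
proof -
  obtain a where a: "a analytic_on {0}" "a 0 \<noteq> 0" "\<forall>\<^sub>F t in at 0. w t = a t * t powi n"
    using assms by (auto simp: ordeq_def)
  have "(\<lambda>t. a t * t powi n) meromorphic_on {0}"
    by (intro meromorphic_intros analytic_on_imp_meromorphic_on a)
  then show "w meromorphic_on {0}" using a(3) meromorphic_on_cong[of "{0}" w "\<lambda>t. a t * t powi n"] by auto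
  show "\<exists>\<^sub>F t in at 0. w t \<noteq> 0" using ordeq_eventually_nonzero[OF assms]
    by (simp add: eventually_frequently)
  obtain S where S: "open S" "0 \<in> S" "a holomorphic_on S" using a(1) by (auto simp: analytic_at)
  have "zorder w 0 = zorder (\<lambda>t. a t * t powi n) 0" using a(3) by (rule zorder_cong) simp
  also have "\<dots> = n" by (rule zorder_eqI[OF S a(2)]) simp
  finally show "zorder w 0 = n" .
qed

lemma mero_ordeq:
  assumes "w meromorphic_on {0}" "\<exists>\<^sub>F t in at 0. w t \<noteq> 0" shows "ordeq w (zorder w 0)"
proof -
  have "isolated_singularity_at w 0" "not_essential w 0" using assms(1) by (auto simp: meromorphic_at_iff)
  from zorder_exist[OF this assms(2)] obtain r where r: "zor_poly w 0 0 \<noteq> 0" "r > 0"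
    "zor_poly w 0 holomorphic_on cball 0 r"
    "\<And>t. t \<in> cball 0 r - {0} \<Longrightarrow> w t = zor_poly w 0 t * t powi (zorder w 0)" by force
  have "zor_poly w 0 analytic_on {0}" unfolding analytic_at_ball
    using r(2,3) by (meson ball_subset_cball holomorphic_on_subset)
  moreover have "\<forall>\<^sub>F t in at 0. w t = zor_poly w 0 t * t powi (zorder w 0)"
    unfolding eventually_at using r(2,4) by (intro exI[of _ r]) (auto simp: dist_norm)
  ultimately show ?thesis unfolding ordeq_def using r(1) by blast
qed

lemma ordeq_iff:
  "ordeq w n \<longleftrightarrow> w meromorphic_on {0} \<and> (\<exists>\<^sub>F t in at 0. w t \<noteq> 0) \<and> zorder w 0 = n"
  using ordeq_mero mero_ordeq by blast

lemma ordge_mero: assumes "ordge w n" shows "w meromorphic_on {0}"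
proof -
  obtain a where a: "a analytic_on {0}" "\<forall>\<^sub>F t in at 0. w t = a t * t powi n"
    using assms by (auto simp: ordge_def)
  have "(\<lambda>t. a t * t powi n) meromorphic_on {0}"
    by (intro meromorphic_intros analytic_on_imp_meromorphic_on a)
  then show "w meromorphic_on {0}" using a(2) meromorphic_on_cong[of "{0}" w "\<lambda>t. a t * t powi n"] by auto
qed

lemma mero_cases:
  assumes "w meromorphic_on {0}"
  obtains "\<forall>\<^sub>F t in at 0. w t = 0" | n where "ordeq w n"
  using mero_ordeq[OF assms] by (auto simp: frequently_def)

lemma mero_analytic_near:
  assumes "w meromorphic_on {0}" shows "\<forall>\<^sub>F t in at 0. w analytic_on {t}"
proof -
  have "isolated_singularity_at w 0" using assms by (auto simp: meromorphic_at_iff)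
  then obtain r where r: "r > 0" "w analytic_on ball 0 r - {0}" unfolding isolated_singularity_at_def by auto
  then show ?thesis unfolding eventually_at
    by (intro exI[of _ r]) (auto simp: dist_norm intro: analytic_on_subset)
qed

text \<open>Serves to read off the divisor of a function whose square is a quotient of known
  products, see \<open>Dabc_sA\<close>.\<close>

lemma ordeq_of_square: assumes "w meromorphic_on {0}" "ordeq (\<lambda>t. w t ^ 2) (2 * n)" shows "ordeq w n"
  using assms(1)
proof (rule mero_cases)
  assume "\<forall>\<^sub>F t in at 0. w t = 0"
  then have "\<forall>\<^sub>F t in at (0::complex). False" using ordeq_eventually_nonzero[OF assms(2)] by eventually_elim simp
  then show ?thesis by simp
next
  fix m assume "ordeq w m"
  then show ?thesis using ordeq_unique[OF ordeq_power[of w m 2] assms(2)] by simp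
qed

section \<open>Composition of local expressions with a change of parameter\<close>

lemma analytic_factor:
  assumes "s analytic_on {0}" "s 0 = (0::complex)"
  obtains q where "q analytic_on {0}" "q 0 = deriv s 0" "\<And>t. s t = t * q t"
proof -
  obtain S where S: "open S" "0 \<in> S" "s holomorphic_on S" using assms(1) by (auto simp: analytic_at)
  show ?thesis
  proof (rule that)
    show "(\<lambda>z. if z = 0 then deriv s 0 else (s z - s 0) / (z - 0)) analytic_on {0}"
      using pole_lemma_open[OF S(3,1), of 0] S by (auto simp: analytic_at)
  qed (use assms in auto)
qed

lemma ordeq_deriv_zero:
  assumes "s analytic_on {0}" "s 0 = (0::complex)" "deriv s 0 \<noteq> 0" shows "ordeq s 1"
proof -
  obtain q where "q analytic_on {0}" "q 0 = deriv s 0" "\<And>t. s t = t * q t"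
    using analytic_factor[OF assms(1,2)] by blast
  then have "ordeq q 0" "s = (\<lambda>t. t * q t)" using assms(3) by (auto intro: ordeq_analytic)
  then show ?thesis using ordeq_mult[OF ordeq_ident, of q 0] by simp
qed

lemma ordeq_filterlim:
  assumes "ordeq s 1" shows "filterlim s (at 0) (at 0)"
  using ordge_tendsto_0[OF ordeq_ordge[OF assms]] ordeq_eventually_nonzero[OF assms]
  by (simp add: filterlim_at)

lemma analytic_compose_0:
  assumes "u analytic_on {0::complex}" "s analytic_on {0}" "s 0 = (0::complex)" shows "(\<lambda>t. u (s t)) analytic_on {0}"
  using analytic_on_compose_gen[OF assms(2,1)] assms(3) by (simp add: o_def)

text \<open>The inner function has a simple zero at 0, so the power t powi n keeps its order n, and
  analytic factors or units stay such.\<close>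

lemma ord_compose:
  assumes "s analytic_on {0}" "s 0 = 0" "deriv s 0 \<noteq> 0"
  shows "ordeq w n \<Longrightarrow> ordeq (\<lambda>t. w (s t)) n" "ordge w n \<Longrightarrow> ordge (\<lambda>t. w (s t)) n"
proof -
  have s1: "ordeq s 1" using ordeq_deriv_zero[OF assms] .
  have ev: "\<forall>\<^sub>F t in at 0. w (s t) = u (s t) * s t powi n" if "\<forall>\<^sub>F t in at 0. w t = u t * t powi n" for u
    using filterlim_iff[THEN iffD1, OF ordeq_filterlim[OF s1]] that by blast
  have sn: "ordeq (\<lambda>t. s t powi n) n" using ordeq_power_int[OF s1, of n] by simp
  show "ordeq (\<lambda>t. w (s t)) n" if w: "ordeq w n"
  proof -
    obtain a where a: "a analytic_on {0}" "a 0 \<noteq> 0" "\<forall>\<^sub>F t in at 0. w t = a t * t powi n"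
      using w by (auto simp: ordeq_def)
    have "ordeq (\<lambda>t. a (s t)) 0" using analytic_compose_0[OF a(1) assms(1,2)] a(2) assms(2)
      by (intro ordeq_analytic) auto
    then show ?thesis using ordeq_cong[OF ev[OF a(3)]] ordeq_mult[OF _ sn] by fastforce
  qed
  show "ordge (\<lambda>t. w (s t)) n" if w: "ordge w n"
  proof -
    obtain a where a: "a analytic_on {0}" "\<forall>\<^sub>F t in at 0. w t = a t * t powi n"
      using w by (auto simp: ordge_def)
    have "ordge (\<lambda>t. a (s t)) 0" using analytic_compose_0[OF a(1) assms(1,2)]
      by (intro ordge_analytic) auto
    then show ?thesis using ordge_cong[OF ev[OF a(2)]] ordge_mult[OF _ ordeq_ordge[OF sn]] by fastforce
  qed
qed

section \<open>Arcs and local parameters\<close>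

text \<open>Immersivity is left out on purpose: the image of a local parameter under a holomorphic
  map is at first only known to be an arc of this kind.\<close>

definition karc :: "(complex \<Rightarrow> complex^3) \<Rightarrow> bool" where
  "karc \<gamma> \<longleftrightarrow> \<gamma> 0 \<noteq> 0 \<and> (\<forall>i. (\<lambda>t. \<gamma> t $ i) analytic_on {0}) \<and> (\<forall>\<^sub>F t in nhds 0. F4 (\<gamma> t) = 0)"

lemma karc_nonzero: assumes "\<gamma> 0 \<noteq> 0" "\<forall>i. (\<lambda>t. \<gamma> t $ i) analytic_on {0}"
  shows "\<forall>\<^sub>F t in nhds (0::complex). \<gamma> t \<noteq> (0::complex^3)"
proof -
  obtain i where i: "\<gamma> 0 $ i \<noteq> 0" using assms(1) by (auto simp: vec_eq_iff)
  have "\<forall>\<^sub>F t in nhds 0. \<gamma> t $ i \<noteq> 0"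
    using analytic_eventually_nonzero[of "\<lambda>t. \<gamma> t $ i"] assms(2) i by auto
  then show ?thesis by eventually_elim auto
qed

lemma karc_iff_holo_arc:
  "karc \<gamma> \<longleftrightarrow> (\<exists>r>0. holo_arc r \<gamma> \<and> (\<forall>t\<in>ball 0 r. proj (\<gamma> t) \<in> klein))"
proof
  assume k: "karc \<gamma>"
  then have "\<forall>i. \<exists>e>0. (\<lambda>t. \<gamma> t $ i) holomorphic_on ball 0 e"
    by (auto simp: karc_def analytic_at_ball)
  then obtain e where e: "\<And>i. e i > 0" "\<And>i. (\<lambda>t. \<gamma> t $ i) holomorphic_on ball 0 (e i)" by metis
  have "\<forall>\<^sub>F t in nhds 0. F4 (\<gamma> t) = 0 \<and> \<gamma> t \<noteq> 0"
    using k karc_nonzero[of \<gamma>] by (auto simp: karc_def intro: eventually_conj)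
  then obtain d where d: "d > 0" "\<And>t. dist t 0 < d \<Longrightarrow> F4 (\<gamma> t) = 0 \<and> \<gamma> t \<noteq> 0"
    unfolding eventually_nhds_metric by blast
  define r where "r = Min {d, e 1, e 2, e 3}"
  have "r \<le> e i" for i using exhaust_3[of i] by (auto simp: r_def)
  then have r: "r > 0" "r \<le> d" "\<And>i. r \<le> e i" using d(1) e(1) by (auto simp: r_def)
  have "(\<lambda>t. \<gamma> t $ i) holomorphic_on ball 0 r" for i
    using e(2)[of i] r(3)[of i] by (meson holomorphic_on_subset subset_ball)
  moreover have "F4 (\<gamma> t) = 0 \<and> \<gamma> t \<noteq> 0" if "t \<in> ball 0 r" for t
    using d(2)[of t] r that by (auto simp: dist_commute)
  ultimately show "\<exists>r>0. holo_arc r \<gamma> \<and> (\<forall>t\<in>ball 0 r. proj (\<gamma> t) \<in> klein)"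
    using r(1) by (intro exI[of _ r]) (auto simp: holo_arc_def proj_in_klein_iff)
next
  assume "\<exists>r>0. holo_arc r \<gamma> \<and> (\<forall>t\<in>ball 0 r. proj (\<gamma> t) \<in> klein)"
  then obtain r where r: "r > 0" "holo_arc r \<gamma>" "\<forall>t\<in>ball 0 r. proj (\<gamma> t) \<in> klein" by blast
  have "\<forall>\<^sub>F t in nhds 0. t \<in> ball (0::complex) r" using r(1) by (intro eventually_nhds_in_open) auto
  then have "\<forall>\<^sub>F t in nhds 0. F4 (\<gamma> t) = 0"
    by eventually_elim (use r in \<open>auto simp: holo_arc_def proj_in_klein_iff\<close>)
  then show "karc \<gamma>" using r unfolding karc_def holo_arc_def by (auto simp: analytic_at_ball)
qed

definition vderiv :: "(complex \<Rightarrow> complex^3) \<Rightarrow> complex^3" where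
  "vderiv \<gamma> = (\<chi> i. deriv (\<lambda>t. \<gamma> t $ i) 0)"

lemma local_param_iff:
  "local_param klein P \<gamma> \<longleftrightarrow> proj (\<gamma> 0) = P \<and> karc \<gamma> \<and> (\<nexists>c. vderiv \<gamma> = c *s \<gamma> 0)"
  by (simp add: local_param_def karc_iff_holo_arc vderiv_def)

lemma karc_eventually_klein:
  assumes "karc \<gamma>"
  shows "\<forall>\<^sub>F t in nhds 0. \<gamma> t \<noteq> 0 \<and> F4 (\<gamma> t) = 0 \<and> proj (\<gamma> t) \<in> klein"
proof -
  have "\<forall>\<^sub>F t in nhds 0. \<gamma> t \<noteq> 0" "\<forall>\<^sub>F t in nhds 0. F4 (\<gamma> t) = 0"
    using assms karc_nonzero[of \<gamma>] by (auto simp: karc_def)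
  then show ?thesis by eventually_elim (auto simp: proj_in_klein_iff)
qed

lemma karc_at_0: "karc \<gamma> \<Longrightarrow> \<gamma> 0 \<noteq> 0 \<and> F4 (\<gamma> 0) = 0 \<and> proj (\<gamma> 0) \<in> klein"
  using karc_eventually_klein eventually_nhds_x_imp_x by blast

lemma karc_DERIV: assumes "\<forall>i. (\<lambda>t. \<gamma> t $ i) analytic_on {0}"
  shows "((\<lambda>t. \<gamma> t $ i) has_field_derivative vderiv \<gamma> $ i) (at 0)"
proof -
  have "(\<lambda>t. \<gamma> t $ i) field_differentiable at 0" using assms by (intro analytic_on_imp_differentiable_at) auto
  then show ?thesis by (simp add: vderiv_def DERIV_deriv_iff_field_differentiable)
qed

lemma vderiv_eqI: assumes "\<And>i. ((\<lambda>t. \<gamma> t $ i) has_field_derivative d $ i) (at 0)" shows "vderiv \<gamma> = d"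
  using assms by (auto simp: vderiv_def vec_eq_iff intro!: DERIV_imp_deriv)

lemma DERIV_cong_nhds:
  assumes "\<forall>\<^sub>F t in nhds x. f t = g t" "(g has_field_derivative d) (at x)"
  shows "(f has_field_derivative d) (at x)"
  using assms DERIV_cong_ev[of x x f g d d] by simp

text \<open>Modulo multiples of the value at 0, passing to the new lift multiplies the derivative by
  \<open>\<mu> 0 * deriv s 0\<close>. Immersivity is thus governed by
  \<open>deriv s 0\<close>.\<close>

lemma vderiv_product:
  assumes l: "\<mu> analytic_on {0}" and s: "s analytic_on {0}" "s 0 = 0"
    and e: "\<forall>i. (\<lambda>t. \<eta> t $ i) analytic_on {0}"
    and eq: "\<forall>\<^sub>F t in nhds 0. \<delta> t = \<mu> t *s \<eta> (s t)"
  shows "vderiv \<delta> = deriv \<mu> 0 *s \<eta> 0 + (\<mu> 0 * deriv s 0) *s vderiv \<eta>"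
proof (rule vderiv_eqI)
  fix i
  have "(\<mu> has_field_derivative deriv \<mu> 0) (at 0)" "(s has_field_derivative deriv s 0) (at 0)"
    using l s by (auto simp: DERIV_deriv_iff_field_differentiable intro: analytic_on_imp_differentiable_at)
  moreover have "((\<lambda>t. \<eta> t $ i) has_field_derivative vderiv \<eta> $ i) (at (s 0))"
    using karc_DERIV[OF e] s by simp
  ultimately have "((\<lambda>t. \<mu> t * \<eta> (s t) $ i) has_field_derivative
      deriv \<mu> 0 * \<eta> (s 0) $ i + vderiv \<eta> $ i * deriv s 0 * \<mu> 0) (at 0)"
    by (intro DERIV_mult DERIV_chain2[of "\<lambda>t. \<eta> t $ i" _ s 0])
  moreover have "\<forall>\<^sub>F t in nhds 0. \<delta> t $ i = \<mu> t * \<eta> (s t) $ i" using eq by eventually_elim simp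
  ultimately have "((\<lambda>t. \<delta> t $ i) has_field_derivative
      deriv \<mu> 0 * \<eta> (s 0) $ i + vderiv \<eta> $ i * deriv s 0 * \<mu> 0) (at 0)" 
    by (intro DERIV_cong_nhds[of "\<lambda>t. \<delta> t $ i" "\<lambda>t. \<mu> t * \<eta> (s t) $ i"])
  then show "((\<lambda>t. \<delta> t $ i) has_field_derivative
      (deriv \<mu> 0 *s \<eta> 0 + (\<mu> 0 * deriv s 0) *s vderiv \<eta>) $ i) (at 0)"
    using s(2) by (simp add: mult_ac)
qed

text \<open>A parameter through which every arc at Q factors, up to rescaling of the lift: in effect
  the inverse of a chart. Giving one explicitly at each point takes the place of the implicit
  function theorem, and orders computed along it hold for all local parameters.\<close>

definition upar :: "cp2 \<Rightarrow> (complex \<Rightarrow> complex^3) \<Rightarrow> bool" where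
  "upar Q \<eta> \<longleftrightarrow> local_param klein Q \<eta> \<and>
     (\<forall>\<delta>. karc \<delta> \<and> proj (\<delta> 0) = Q \<longrightarrow>
        (\<exists>\<mu> s. \<mu> analytic_on {0} \<and> \<mu> 0 \<noteq> 0 \<and> s analytic_on {0} \<and> s 0 = 0 \<and>
           (\<forall>\<^sub>F t in nhds 0. \<delta> t = \<mu> t *s \<eta> (s t))))"

subsection \<open>Symmetries of the quartic form\<close>

text \<open>The factor k admits unnormalized matrices such as \<open>sM\<close>, which multiplies
  the form by 49.\<close>

definition F4sym :: "complex^3^3 \<Rightarrow> bool" where
  "F4sym M \<longleftrightarrow> invertible M \<and> (\<exists>k. k \<noteq> 0 \<and> (\<forall>v. F4 (M *v v) = k * F4 v))"

definition lin :: "complex^3^3 \<Rightarrow> cp2 \<Rightarrow> cp2" where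
  "lin M P = proj (M *v rep P)"

lemma invertible_nonzero: "invertible (M :: complex^3^3) \<Longrightarrow> M *v v = 0 \<longleftrightarrow> v = 0"
proof
  assume "invertible M" "M *v v = 0"
  then obtain N where "N ** M = mat 1" by (auto simp: invertible_def)
  then have "v = N *v (M *v v)" by (simp add: matrix_vector_mul_assoc)
  then show "v = 0" using \<open>M *v v = 0\<close> by simp
qed simp

lemma matrix_vector_mult_smult: "M *v (c *s v) = c *s (M *v (v :: complex^3))"
  by (simp add: vec_eq_iff matrix_vector_mult_def sum_distrib_left algebra_simps)

lemma lin_proj: "invertible M \<Longrightarrow> v \<noteq> 0 \<Longrightarrow> lin M (proj v) = proj (M *v v)"
proof -
  assume M: "invertible M" and v: "v \<noteq> 0"
  obtain c where c: "c \<noteq> 0" "rep (proj v) = c *s v" using rep_proj[OF v] .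
  then show ?thesis unfolding lin_def c(2) matrix_vector_mult_smult
    using M v by (intro proj_scale) (auto simp: invertible_nonzero)
qed

lemma lin_mult: "invertible M \<Longrightarrow> invertible N \<Longrightarrow> lin (M ** N) P = lin M (lin N P)"
  using rep(1)[of P] by (simp add: lin_def[of N] lin_def[of "M ** N"] lin_proj invertible_nonzero
      matrix_vector_mul_assoc)

lemma lin_id: "lin (mat 1) P = P"
  by (simp add: lin_def rep)

lemma F4sym_invertible: "F4sym M \<Longrightarrow> invertible M" by (simp add: F4sym_def)

lemma F4sym_inverse:
  assumes "F4sym M" obtains N where "F4sym N" "M ** N = mat 1" "N ** M = mat 1"
proof -
  obtain k where k: "k \<noteq> 0" "\<And>v. F4 (M *v v) = k * F4 v" using assms by (auto simp: F4sym_def)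
  obtain N where N: "M ** N = mat 1" "N ** M = mat 1" using assms by (auto simp: F4sym_def invertible_def)
  have "F4 (N *v v) = inverse k * F4 v" for v
    using k(1) k(2)[of "N *v v"] by (simp add: matrix_vector_mul_assoc N field_simps)
  then have "F4sym N" unfolding F4sym_def using N k(1)
    by (auto simp: invertible_def intro!: exI[of _ "inverse k"])
  then show ?thesis using N that by blast
qed

lemma lin_klein: "F4sym M \<Longrightarrow> P \<in> klein \<Longrightarrow> lin M P \<in> klein"
proof -
  assume M: "F4sym M" and "P \<in> klein"
  then have "F4 (rep P) = 0" by (simp add: klein_iff_rep)
  then have "F4 (M *v rep P) = 0" using M by (auto simp: F4sym_def)
  then show ?thesis using M rep[of P] unfolding lin_def by (simp add: proj_in_klein_iff F4sym_def invertible_nonzero)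
qed

lemma analytic_lin:
  assumes "\<forall>i. (\<lambda>t. \<gamma> t $ i) analytic_on {0}" shows "(\<lambda>t. (M *v \<gamma> t) $ i) analytic_on {0}"
  unfolding matrix_vector_mult_def using assms by (auto intro!: analytic_intros)

lemma karc_lin: assumes "F4sym M" "karc \<gamma>" shows "karc (\<lambda>t. M *v \<gamma> t)"
proof -
  obtain k where k: "\<And>v. F4 (M *v v) = k * F4 v" using assms(1) by (auto simp: F4sym_def)
  have "\<forall>\<^sub>F t in nhds 0. F4 (\<gamma> t) = 0" using assms(2) by (simp add: karc_def)
  then have "\<forall>\<^sub>F t in nhds 0. F4 (M *v \<gamma> t) = 0" by eventually_elim (simp add: k)
  then show ?thesis using assms unfolding karc_def F4sym_def
    by (simp add: invertible_nonzero analytic_lin)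
qed

lemma vderiv_lin:
  assumes "\<forall>i. (\<lambda>t. \<gamma> t $ i) analytic_on {0}" shows "vderiv (\<lambda>t. M *v \<gamma> t) = M *v vderiv \<gamma>"
  by (rule vderiv_eqI)
    (auto simp: matrix_vector_mult_def intro!: DERIV_sum DERIV_cmult karc_DERIV assms)

lemma local_param_lin:
  assumes "F4sym M" "local_param klein P \<gamma>" shows "local_param klein (lin M P) (\<lambda>t. M *v \<gamma> t)"
proof -
  have M: "invertible M" using assms(1) by (simp add: F4sym_def)
  have g: "karc \<gamma>" "proj (\<gamma> 0) = P" "\<nexists>c. vderiv \<gamma> = c *s \<gamma> 0" using assms(2) by (auto simp: local_param_iff)
  have a: "\<forall>i. (\<lambda>t. \<gamma> t $ i) analytic_on {0}" using g(1) by (simp add: karc_def)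
  have "vderiv \<gamma> = c *s \<gamma> 0" if "vderiv (\<lambda>t. M *v \<gamma> t) = c *s (M *v \<gamma> 0)" for c
  proof -
    have "M *v (vderiv \<gamma> - c *s \<gamma> 0) = 0"
      using that by (simp add: vderiv_lin[OF a] matrix_vector_mult_diff_distrib matrix_vector_mult_smult)
    then show ?thesis using invertible_nonzero[OF M] by simp
  qed
  then show ?thesis using g karc_lin[OF assms(1) g(1)] lin_proj[OF M, of "\<gamma> 0"] karc_at_0[OF g(1)]
    by (auto simp: local_param_iff)
qed

text \<open>An arc at the image point is moved back by the inverse matrix, factored there, and moved
  forward again.\<close>

lemma upar_lin: assumes "F4sym M" "upar Q \<eta>" shows "upar (lin M Q) (\<lambda>t. M *v \<eta> t)"
  unfolding upar_def
proof (intro conjI allI impI)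
  show "local_param klein (lin M Q) (\<lambda>t. M *v \<eta> t)"
    using assms local_param_lin by (auto simp: upar_def)
  fix \<delta> assume d: "karc \<delta> \<and> proj (\<delta> 0) = lin M Q"
  obtain N where N: "F4sym N" "M ** N = mat 1" "N ** M = mat 1" using F4sym_inverse[OF assms(1)] .
  have "proj (N *v \<delta> 0) = lin N (lin M Q)" using d karc_at_0[of \<delta>] lin_proj[OF F4sym_invertible[OF N(1)], of "\<delta> 0"] by simp
  also have "\<dots> = Q" using N assms(1) by (simp add: lin_mult[symmetric] F4sym_invertible lin_id)
  finally obtain \<mu> s where ms: "\<mu> analytic_on {0}" "\<mu> 0 \<noteq> 0" "s analytic_on {0}" "s 0 = 0"
    "\<forall>\<^sub>F t in nhds 0. N *v \<delta> t = \<mu> t *s \<eta> (s t)"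
    using assms(2) karc_lin[OF N(1), of \<delta>] d unfolding upar_def by blast
  have "\<forall>\<^sub>F t in nhds 0. \<delta> t = \<mu> t *s (M *v \<eta> (s t))"
    using ms(5)
  proof eventually_elim
    case (elim t)
    have "\<delta> t = M *v (N *v \<delta> t)" by (simp add: matrix_vector_mul_assoc N)
    then show ?case unfolding elim by (simp add: matrix_vector_mult_smult)
  qed
  then show "\<exists>\<mu> s. \<mu> analytic_on {0} \<and> \<mu> 0 \<noteq> 0 \<and> s analytic_on {0} \<and> s 0 = 0 \<and>
    (\<forall>\<^sub>F t in nhds 0. \<delta> t = \<mu> t *s (M *v \<eta> (s t)))" using ms by blast
qed

subsection \<open>Explicit local parameters\<close>

text \<open>As an analytic function it is composed only with functions of value 1 at the base point.
  Being an exponential it never vanishes, not even at 0.\<close>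

definition root7 :: "complex \<Rightarrow> complex" where "root7 w = exp (Ln w / 7)"

lemma root7_pow: "w \<noteq> 0 \<Longrightarrow> root7 w ^ 7 = w"
  unfolding root7_def by (simp add: exp_of_nat_mult[symmetric])

lemma root7_1 [simp]: "root7 1 = 1" by (simp add: root7_def)

lemma root7_analytic: "f analytic_on {0} \<Longrightarrow> f 0 = 1 \<Longrightarrow> (\<lambda>t. root7 (f t)) analytic_on {0}"
  unfolding root7_def by (auto intro!: analytic_intros)

text \<open>For w near 1 the imaginary part of 7 Ln w stays below pi in absolute value, and in that
  strip Ln inverts the exponential.\<close>

lemma root7_of_pow: "\<forall>\<^sub>F w in nhds 1. root7 (w ^ 7) = w"
proof -
  define g where "g = (\<lambda>w. 7 * Ln w)"
  have "g analytic_on {1}" unfolding g_def by (auto intro!: analytic_intros)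
  then have "(g \<longlongrightarrow> g 1) (nhds 1)"
    using analytic_at_imp_isCont by (simp add: isCont_def tendsto_at_iff_tendsto_nhds)
  then have "\<forall>\<^sub>F w in nhds 1. dist (g w) (g 1) < pi" by (rule tendstoD) simp
  then have "\<forall>\<^sub>F w in nhds 1. \<bar>Im (7 * Ln w)\<bar> < pi"
  proof eventually_elim
    case (elim w)
    then show ?case using abs_Im_le_cmod[of "7 * Ln w"] by (simp add: g_def dist_norm)
  qed
  moreover have "\<forall>\<^sub>F w in nhds 1. w \<in> - {0::complex}" by (intro eventually_nhds_in_open) auto
  ultimately show ?thesis
  proof eventually_elim
    case (elim w)
    have "w ^ 7 = exp (7 * Ln w)" using elim(2) exp_of_nat_mult[of 7 "Ln w"] by simp
    moreover have "Ln (exp (7 * Ln w)) = 7 * Ln w" using elim(1) by (intro Ln_exp) (auto simp: abs_less_iff)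
    ultimately show ?case using elim(2) by (simp add: root7_def)
  qed
qed

text \<open>At a point with \<open>phi = l \<noteq> 0, -1\<close> and \<open>y\<close>-coordinate \<open>y0\<close> the function \<open>phi - l\<close>
  is a local coordinate; at \<open>ptC\<close> one can take \<open>phi = t\<^sup>7\<close>.\<close>

definition par :: "complex \<Rightarrow> complex \<Rightarrow> complex \<Rightarrow> complex^3" where
  "par l y0 t = (let y = y0 * root7 ((l + t) * (1 + (l + t))^2 / (l * (1 + l)^2))
     in vector [- (y^3) / (1 + (l + t)), y, 1])"

definition parC :: "complex \<Rightarrow> complex^3" where
  "parC t = (let y = t * root7 ((1 + t^7)^2) in vector [- (y^3) / (1 + t^7), y, 1])"

lemma root7_ratio_eventually:
  assumes "f analytic_on {0}" "f 0 = 1" shows "\<forall>\<^sub>F t in nhds 0. f t \<noteq> 0 \<and> root7 (f t) ^ 7 = f t"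
  using analytic_eventually_nonzero[OF assms(1)] assms(2) by (auto elim!: eventually_mono simp: root7_pow)

text \<open>Since \<open>\<eta>\<close> has third coordinate 1, the scaling factor is forced to be
  the third coordinate of \<open>\<delta>\<close>, and only affine coordinates remain to be
  matched.\<close>

lemma upar_affineI:
  assumes p: "local_param klein Q \<eta>" and e3: "\<And>t. \<eta> t $ 3 = 1"
    and ex: "\<And>\<delta>. karc \<delta> \<Longrightarrow> proj (\<delta> 0) = Q \<Longrightarrow>
      \<exists>s. s analytic_on {0} \<and> s 0 = 0 \<and>
        (\<forall>\<^sub>F t in nhds 0. \<delta> t $ 1 / \<delta> t $ 3 = \<eta> (s t) $ 1 \<and> \<delta> t $ 2 / \<delta> t $ 3 = \<eta> (s t) $ 2)"
  shows "upar Q \<eta>"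
  unfolding upar_def
proof (intro conjI allI impI p)
  fix \<delta> assume d: "karc \<delta> \<and> proj (\<delta> 0) = Q"
  have "proj (\<delta> 0) = proj (\<eta> 0)" using d p by (simp add: local_param_iff)
  then have d3: "\<delta> 0 $ 3 \<noteq> 0" using d p e3[of 0]
    by (subst (asm) proj_eq_iff) (auto simp: local_param_iff karc_def)
  have a3: "(\<lambda>t. \<delta> t $ 3) analytic_on {0}" using d by (simp add: karc_def)
  obtain s where s: "s analytic_on {0}" "s 0 = 0"
    "\<forall>\<^sub>F t in nhds 0. \<delta> t $ 1 / \<delta> t $ 3 = \<eta> (s t) $ 1 \<and> \<delta> t $ 2 / \<delta> t $ 3 = \<eta> (s t) $ 2"
    using ex d by blast
  have "\<forall>\<^sub>F t in nhds 0. \<delta> t = \<delta> t $ 3 *s \<eta> (s t)"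
    using s(3) analytic_eventually_nonzero[OF a3 d3]
    by eventually_elim (auto simp: vec3_eq_iff e3 field_simps)
  then show "\<exists>\<mu> s. \<mu> analytic_on {0} \<and> \<mu> 0 \<noteq> 0 \<and> s analytic_on {0} \<and> s 0 = 0 \<and>
    (\<forall>\<^sub>F t in nhds 0. \<delta> t = \<mu> t *s \<eta> (s t))" using s a3 d3 by blast
qed

text \<open>The third coordinate is constantly 1, so a derivative proportional to the value could
  only be zero.\<close>

lemma immersive_affineI:
  assumes "\<forall>i. (\<lambda>t. \<eta> t $ i) analytic_on {0}" "\<And>t. \<eta> t $ 3 = 1" "vderiv \<eta> $ i \<noteq> 0"
  shows "\<nexists>c. vderiv \<eta> = c *s \<eta> 0"
proof
  assume "\<exists>c. vderiv \<eta> = c *s \<eta> 0"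
  then obtain c where c: "vderiv \<eta> = c *s \<eta> 0" by blast
  have "vderiv \<eta> $ 3 = 0" using assms(2) by (simp add: vderiv_def)
  then have "c = 0" using assms(2)[of 0] by (simp add: c)
  then show False using assms(3) c by simp
qed

context
  fixes l y0 :: complex
  assumes l: "l \<noteq> 0" "1 + l \<noteq> 0" and y0: "y0^7 = l * (1 + l)^2"
begin

private definition "R t = (l + t) * (1 + (l + t))^2 / (l * (1 + l)^2)"

private lemma R: "R analytic_on {0}" "R 0 = 1"
  unfolding R_def using l by (auto intro!: analytic_intros)

private lemma y0_nonzero: "y0 \<noteq> 0" using l y0 by auto

private lemma par_nth: "par l y0 t $ 1 = - ((y0 * root7 (R t))^3) / (1 + (l + t))"
  "par l y0 t $ 2 = y0 * root7 (R t)" "par l y0 t $ 3 = 1"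
  by (auto simp: par_def Let_def R_def)

private lemma near: "\<forall>\<^sub>F t in nhds 0. 1 + (l + t) \<noteq> 0 \<and> (y0 * root7 (R t))^7 = (l + t) * (1 + (l + t))^2"
proof -
  have "\<forall>\<^sub>F t in nhds 0. 1 + (l + t) \<noteq> 0"
    using l by (intro analytic_eventually_nonzero analytic_intros) auto
  then show ?thesis using root7_ratio_eventually[OF R]
    by eventually_elim (use l in \<open>auto simp: power_mult_distrib y0 R_def\<close>)
qed

lemma par_analytic: "\<forall>i. (\<lambda>t. par l y0 t $ i) analytic_on {0}"
  unfolding forall_3 par_nth using l R by (auto intro!: analytic_intros root7_analytic)

lemma par_near: "\<forall>\<^sub>F t in nhds 0. F4 (par l y0 t) = 0 \<and> par l y0 t \<noteq> 0 \<and>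
    par l y0 t $ 1 ^ 2 * par l y0 t $ 2 = l + t \<and> phi (proj (par l y0 t)) = l + t"
  using near
proof eventually_elim
  case (elim t)
  have "par l y0 t = vector [- ((y0 * root7 (R t))^3) / (1 + (l + t)), y0 * root7 (R t), 1]"
    by (simp add: vec3_eq_iff par_nth)
  then show ?case
    using klein_of_phi[of "y0 * root7 (R t)" "l + t"] elim by (auto simp: phi_proj)
qed

lemma par_0: "par l y0 0 = vector [- (y0^3) / (1 + l), y0, 1]"
  by (simp add: vec3_eq_iff par_nth R)

text \<open>Immersed because x^2 y = l + t has derivative 1, while the product rule writes this
  derivative as a combination of x' and y'.\<close>

lemma par_local_param: "local_param klein (proj (vector [- (y0^3) / (1 + l), y0, 1])) (par l y0)"
proof -
  have k: "karc (par l y0)" unfolding karc_def using par_analytic eventually_nhds_x_imp_x[OF par_near] par_near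
    by (auto elim: eventually_mono)
  have "((\<lambda>t. par l y0 t $ 1 ^ 2 * par l y0 t $ 2) has_field_derivative
      2 * par l y0 0 $ 1 * vderiv (par l y0) $ 1 * par l y0 0 $ 2 + par l y0 0 $ 1 ^ 2 * vderiv (par l y0) $ 2) (at 0)"
    by (rule derivative_eq_intros karc_DERIV par_analytic refl)+ (simp add: algebra_simps)
  moreover have "\<forall>\<^sub>F t in nhds 0. par l y0 t $ 1 ^ 2 * par l y0 t $ 2 = l + t"
    using par_near by eventually_elim simp
  then have "((\<lambda>t. par l y0 t $ 1 ^ 2 * par l y0 t $ 2) has_field_derivative 1) (at 0)"
    by (rule DERIV_cong_nhds) (auto intro!: derivative_eq_intros)
  ultimately have "2 * par l y0 0 $ 1 * vderiv (par l y0) $ 1 * par l y0 0 $ 2 + par l y0 0 $ 1 ^ 2 * vderiv (par l y0) $ 2 = 1"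
    by (rule DERIV_unique)
  then obtain i where "vderiv (par l y0) $ i \<noteq> 0" by fastforce
  then show ?thesis using k immersive_affineI[OF par_analytic par_nth(3)]
    by (simp add: local_param_iff par_0)
qed

text \<open>The change of parameter is phi - l along the arc. As y / y0 tends to 1, the branch
  \<open>root7\<close> recovers y / y0 from its seventh power.\<close>

lemma par_upar: "upar (proj (vector [- (y0^3) / (1 + l), y0, 1])) (par l y0)"
proof (rule upar_affineI[OF par_local_param par_nth(3)])
  fix \<delta> assume d: "karc \<delta>" "proj (\<delta> 0) = proj (vector [- (y0^3) / (1 + l), y0, 1])"
  have "\<delta> 0 \<noteq> 0" using d(1) by (simp add: karc_def)
  moreover have "vector [- (y0^3) / (1 + l), y0, 1] \<noteq> (0 :: complex^3)" by (simp add: vec3_eq_iff)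
  ultimately obtain c where c: "c \<noteq> 0" "\<delta> 0 = c *s vector [- (y0^3) / (1 + l), y0, 1]"
    using proj_eq_iff d(2) by metis
  have nz: "\<delta> 0 $ 1 \<noteq> 0" "\<delta> 0 $ 3 \<noteq> 0" using c y0_nonzero l by auto
  have da: "(\<lambda>t. \<delta> t $ i) analytic_on {0}" for i using d(1) by (simp add: karc_def)
  define p where "p t = \<delta> t $ 1 ^ 2 * \<delta> t $ 2 / \<delta> t $ 3 ^ 3" for t
  define y where "y t = \<delta> t $ 2 / \<delta> t $ 3" for t
  have an: "p analytic_on {0}" "y analytic_on {0}"
    unfolding p_def y_def using nz by (auto intro!: analytic_intros da)
  have y00: "y 0 = y0" using c by (simp add: y_def)
  have p0: "p 0 = l"
    using klein_of_phi(2,3)[OF y0 l(2)] phi_proj[of "vector [- (y0^3) / (1 + l), y0, 1]"]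
      phi_proj[of "\<delta> 0"] \<open>\<delta> 0 \<noteq> 0\<close> d(2) by (simp add: p_def)
  have "\<forall>\<^sub>F t in nhds 0. \<delta> t $ 1 \<noteq> 0" "\<forall>\<^sub>F t in nhds 0. \<delta> t $ 3 \<noteq> 0"
    using analytic_eventually_nonzero[OF da] nz by auto
  then have E: "\<forall>\<^sub>F t in nhds 0. \<delta> t $ 1 / \<delta> t $ 3 = - (y t ^ 3) / (1 + p t) \<and> y t ^ 7 = p t * (1 + p t)^2"
    using karc_eventually_klein[OF d(1)]
    by eventually_elim (use klein_phi in \<open>auto simp: p_def y_def\<close>)
  have "((\<lambda>t. y t / y0) \<longlongrightarrow> y 0 / y0) (nhds 0)"
  proof -
    have "(\<lambda>t. y t / y0) analytic_on {0}" using an y0_nonzero by (auto intro!: analytic_intros)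
    then show ?thesis using analytic_at_imp_isCont by (simp add: isCont_def tendsto_at_iff_tendsto_nhds)
  qed
  then have "filterlim (\<lambda>t. y t / y0) (nhds 1) (nhds 0)" using y00 y0_nonzero by simp
  then have r: "\<forall>\<^sub>F t in nhds 0. root7 ((y t / y0) ^ 7) = y t / y0"
    using root7_of_pow unfolding filterlim_iff by (elim allE[where x = "\<lambda>w. root7 (w ^ 7) = w"]) blast
  show "\<exists>s. s analytic_on {0} \<and> s 0 = 0 \<and>
        (\<forall>\<^sub>F t in nhds 0. \<delta> t $ 1 / \<delta> t $ 3 = par l y0 (s t) $ 1 \<and> \<delta> t $ 2 / \<delta> t $ 3 = par l y0 (s t) $ 2)"
  proof (intro exI[of _ "\<lambda>t. p t - l"] conjI)
    show "\<forall>\<^sub>F t in nhds 0. \<delta> t $ 1 / \<delta> t $ 3 = par l y0 (p t - l) $ 1 \<and> \<delta> t $ 2 / \<delta> t $ 3 = par l y0 (p t - l) $ 2"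
      using E r
    proof eventually_elim
      case (elim t)
      have "R (p t - l) = (y t / y0) ^ 7" using elim(1) by (simp add: R_def power_divide y0)
      then have "y0 * root7 (R (p t - l)) = y t" using elim(2) y0_nonzero by simp
      then show ?case using elim(1) by (simp add: par_nth y_def)
    qed
  qed (use an p0 in \<open>auto intro!: analytic_intros\<close>)
qed

end

context begin

private definition "S t = (1 + t^7 :: complex)^2"

private lemma S: "S analytic_on {0}" "S 0 = 1"
  unfolding S_def by (auto intro!: analytic_intros)

lemma parC_nth: "parC t $ 1 = t^3 * (- (root7 ((1 + t^7)^2)^3) / (1 + t^7))"
  "parC t $ 2 = t * root7 ((1 + t^7)^2)" "parC t $ 3 = 1"
  by (auto simp: parC_def Let_def power_mult_distrib)

lemma parC_units: "(\<lambda>t. root7 ((1 + t^7)^2)) analytic_on {0}"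
  "(\<lambda>t. - (root7 ((1 + t^7)^2)^3) / (1 + t^7)) analytic_on {0}"
  using S by (auto intro!: analytic_intros root7_analytic simp: S_def[abs_def])

lemma parC_analytic: "\<forall>i. (\<lambda>t. parC t $ i) analytic_on {0}"
  unfolding forall_3 parC_nth using parC_units by (auto intro!: analytic_intros)

lemma parC_near: "\<forall>\<^sub>F t in nhds 0. 1 + t^7 \<noteq> 0 \<and> (t * root7 ((1 + t^7)^2))^7 = t^7 * (1 + t^7)^2 \<and>
   F4 (parC t) = 0 \<and> parC t $ 1 ^ 2 * parC t $ 2 = t^7"
proof -
  have "\<forall>\<^sub>F t in nhds 0. 1 + t^7 \<noteq> (0 :: complex)"
    by (intro analytic_eventually_nonzero analytic_intros) auto
  then show ?thesis using root7_ratio_eventually[OF S]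
  proof eventually_elim
    case (elim t)
    have y: "(t * root7 ((1 + t^7)^2))^7 = t^7 * (1 + t^7)^2"
      using elim(2) by (simp add: S_def power_mult_distrib)
    have "parC t = vector [- ((t * root7 ((1 + t^7)^2))^3) / (1 + t^7), t * root7 ((1 + t^7)^2), 1]"
      by (simp add: parC_def Let_def)
    then show ?case using klein_of_phi[OF y elim(1)] elim(1) y by simp
  qed
qed

lemma parC_0: "parC 0 = vector [0, 0, 1]"
  by (simp add: vec3_eq_iff parC_nth)

lemma parC_local_param: "local_param klein ptC parC"
proof -
  have k: "karc parC" unfolding karc_def using parC_analytic parC_near
    by (auto elim: eventually_mono simp: parC_0 vec100_nonzero)
  have "((\<lambda>t. parC t $ 2) has_field_derivative 1) (at 0)"
  proof -
    have "(\<lambda>t. root7 ((1 + t^7)^2)) field_differentiable at 0"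
      using parC_units by (intro analytic_on_imp_differentiable_at) auto
    then obtain d where "((\<lambda>t. root7 ((1 + t^7)^2)) has_field_derivative d) (at 0)"
      by (auto simp: field_differentiable_def)
    from DERIV_mult[OF DERIV_ident this] show ?thesis by (simp add: parC_nth)
  qed
  then have "vderiv parC $ 2 \<noteq> 0" using karc_DERIV[OF parC_analytic, of 2] DERIV_unique by fastforce
  then show ?thesis using k immersive_affineI[OF parC_analytic parC_nth(3)]
    by (simp add: local_param_iff parC_0 ptC_def pt_def)
qed

lemma parC_upar: "upar ptC parC"
proof (rule upar_affineI[OF parC_local_param parC_nth(3)])
  fix \<delta> assume d: "karc \<delta>" "proj (\<delta> 0) = ptC"
  have d0: "\<delta> 0 $ 1 = 0" "\<delta> 0 $ 2 = 0" using d proj_eq_abc(3)[of "\<delta> 0"] karc_at_0 by auto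
  then have d3: "\<delta> 0 $ 3 \<noteq> 0" using karc_at_0[OF d(1)] by (auto simp: vec3_eq_iff)
  have da: "(\<lambda>t. \<delta> t $ i) analytic_on {0}" for i using d(1) by (simp add: karc_def)
  define p where "p t = \<delta> t $ 1 ^ 2 * \<delta> t $ 2 / \<delta> t $ 3 ^ 3" for t
  define y where "y t = \<delta> t $ 2 / \<delta> t $ 3" for t
  have an: "p analytic_on {0}" "y analytic_on {0}"
    unfolding p_def y_def using d3 by (auto intro!: analytic_intros da)
  have p0: "p 0 = 0" "y 0 = 0" using d0 by (auto simp: p_def y_def)
  have S0: "(\<lambda>t. (1 + p t)^2) analytic_on {0}" "(1 + p 0)^2 = 1" using an p0 by (auto intro!: analytic_intros)
  have E: "\<forall>\<^sub>F t in nhds 0. \<delta> t $ 1 / \<delta> t $ 3 = - (y t ^ 3) / (1 + p t) \<and> y t ^ 7 = p t * (1 + p t)^2"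
    using karc_eventually_klein[OF d(1)] analytic_eventually_nonzero[OF da d3]
  proof eventually_elim
    case (elim t)
    show ?case
    proof (cases "\<delta> t $ 1 = 0")
      \<comment> \<open>The arc passes through \<open>ptC\<close> here, a point not covered by
        \<open>klein_phi\<close>; x, y and p are all 0.\<close>
      case True
      then have "\<delta> t $ 2 = 0" using elim by (auto simp: F4_def)
      then show ?thesis using True by (simp add: p_def y_def)
    next
      case False
      then show ?thesis using klein_phi[of "\<delta> t"] elim by (auto simp: p_def y_def)
    qed
  qed
  \<comment> \<open>At \<open>ptC\<close> phi has order 7, so a seventh root of p must be found that
    is analytic. As y^7 = p (1 + p)^2, this quotient has s^7 = p.\<close>
  define s where "s t = y t / root7 ((1 + p t)^2)" for t
  have s: "s analytic_on {0}" "s 0 = 0"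
    unfolding s_def using an p0 root7_analytic[OF S0] by (auto intro!: analytic_intros)
  show "\<exists>s. s analytic_on {0} \<and> s 0 = 0 \<and>
        (\<forall>\<^sub>F t in nhds 0. \<delta> t $ 1 / \<delta> t $ 3 = parC (s t) $ 1 \<and> \<delta> t $ 2 / \<delta> t $ 3 = parC (s t) $ 2)"
  proof (intro exI[of _ s] conjI s)
    show "\<forall>\<^sub>F t in nhds 0. \<delta> t $ 1 / \<delta> t $ 3 = parC (s t) $ 1 \<and> \<delta> t $ 2 / \<delta> t $ 3 = parC (s t) $ 2"
      using E root7_ratio_eventually[OF S0]
    proof eventually_elim
      case (elim t)
      have "root7 ((1 + p t)^2) \<noteq> 0" by (simp add: root7_def)
      then have "s t ^ 7 = p t" "s t * root7 ((1 + p t)^2) = y t"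
        using elim by (auto simp: s_def power_divide)
      then show ?case using elim(1) by (simp add: parC_def Let_def y_def)
    qed
  qed
qed

end

text \<open>The symmetry of order three. It carries the parameter at \<open>ptC\<close> to the other
  two vertices and later serves to conjugate stabilizers.\<close>

definition cycM :: "complex^3^3" where
  "cycM = vector [vector [0,1,0], vector [0,0,1], vector [1,0,0]]"

lemma mat3_mult_vec:
  fixes v :: "complex^3"
  shows "((vector [vector [a,b,c], vector [d,e,f], vector [g,h,k]] :: complex^3^3) *v v) $ 1 = a * v$1 + b * v$2 + c * v$3"
  "((vector [vector [a,b,c], vector [d,e,f], vector [g,h,k]] :: complex^3^3) *v v) $ 2 = d * v$1 + e * v$2 + f * v$3"
  "((vector [vector [a,b,c], vector [d,e,f], vector [g,h,k]] :: complex^3^3) *v v) $ 3 = g * v$1 + h * v$2 + k * (v$3 :: complex)"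
  by (simp_all add: matrix_vector_mult_def sum_3)

lemma cycM_nth: "(cycM *v v) $ 1 = v$2" "(cycM *v v) $ 2 = v$3" "(cycM *v v) $ 3 = v$1"
  unfolding cycM_def mat3_mult_vec by auto

lemma matrix_eq_3I: "(\<And>v. A *v v = B *v v) \<Longrightarrow> A = (B :: complex^3^3)"
  using matrix_eq by blast

lemma F4sym_cycM: "F4sym cycM"
proof -
  have "cycM ** (cycM ** cycM) = mat 1"
    by (rule matrix_eq_3I) (simp add: matrix_vector_mul_assoc[symmetric] vec3_eq_iff cycM_nth)
  moreover have "(cycM ** cycM) ** cycM = mat 1" using calculation by (simp add: matrix_mul_assoc)
  ultimately have "invertible cycM" unfolding invertible_def by blast
  moreover have "F4 (cycM *v v) = 1 * F4 v" for v by (simp add: F4_def cycM_nth algebra_simps)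
  ultimately show ?thesis unfolding F4sym_def by (intro conjI exI[of _ 1]) auto
qed

lemma lin_cycM: "lin cycM ptA = ptC" "lin cycM ptB = ptA" "lin cycM ptC = ptB"
  unfolding ptA_def ptB_def ptC_def pt_def
  by (subst lin_proj; (intro F4sym_invertible F4sym_cycM vec100_nonzero)?;
      (intro arg_cong[of _ _ proj])?; simp add: vec3_eq_iff cycM_nth)+

definition "parB t = cycM *v parC t"
definition "parA t = cycM *v parB t"

lemma parB_upar: "upar ptB parB"
  using upar_lin[OF F4sym_cycM parC_upar] by (simp add: lin_cycM parB_def[abs_def])

lemma parA_upar: "upar ptA parA"
  using upar_lin[OF F4sym_cycM parB_upar] by (simp add: lin_cycM parA_def[abs_def])

lemma parAB_nth: "parB t $ 1 = parC t $ 2" "parB t $ 2 = parC t $ 3" "parB t $ 3 = parC t $ 1"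
  "parA t $ 1 = parC t $ 3" "parA t $ 2 = parC t $ 1" "parA t $ 3 = parC t $ 2"
  by (simp_all add: parA_def parB_def cycM_nth)

section \<open>Points off the coordinate triangle and comparison of parameters\<close>

lemma klein_generic:
  assumes "P \<in> klein" "P \<noteq> ptA" "P \<noteq> ptB" "P \<noteq> ptC"
  obtains y where "phi P \<noteq> 0" "1 + phi P \<noteq> 0" "y^7 = phi P * (1 + phi P)^2"
    "P = proj (vector [- (y^3) / (1 + phi P), y, 1])" "y = rep P $ 2 / rep P $ 3"
proof -
  define v where "v = rep P"
  have v: "v \<noteq> 0" "proj v = P" "F4 v = 0" using assms(1) rep[of P] by (auto simp: v_def klein_iff_rep)
  have nz: "v$1 \<noteq> 0" "v$3 \<noteq> 0" using klein_coord_zero[OF v(1,3)] v(2) assms by auto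
  have l: "phi P = v$1^2 * v$2 / v$3^3" using phi_proj[OF v(1)] v(2) by simp
  note k = klein_phi[OF v(3) nz(2,1) l]
  have "v = v$3 *s vector [- ((v$2/v$3)^3) / (1 + phi P), v$2/v$3, 1]"
  proof (rule vec3_eqI)
    have "v$1 = v$3 * (v$1 / v$3)" using nz by simp
    then show "v $ 1 = (v$3 *s vector [- ((v$2/v$3)^3) / (1 + phi P), v$2/v$3, 1] :: complex^3) $ 1"
      unfolding k(4) by simp
  qed (use nz in auto)
  then have "P = proj (vector [- ((v$2/v$3)^3) / (1 + phi P), v$2/v$3, 1])"
    using v(1,2) nz proj_scale by (metis mult_zero_left vec3_eq_iff vector_3(3) zero_index zero_neq_one)
  then show ?thesis using that k v_def by blast
qed

lemma upar_generic:
  assumes "P \<in> klein" "P \<noteq> ptA" "P \<noteq> ptB" "P \<noteq> ptC"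
  obtains y where "phi P \<noteq> 0" "1 + phi P \<noteq> 0" "y^7 = phi P * (1 + phi P)^2"
    "P = proj (vector [- (y^3) / (1 + phi P), y, 1])" "upar P (par (phi P) y)"
  using klein_generic[OF assms] par_upar by metis

lemma upar_exists: assumes "P \<in> klein" obtains \<eta> where "upar P \<eta>"
  using upar_generic[OF assms] parA_upar parB_upar parC_upar by blast

lemma upar_local_param: "upar P \<eta> \<Longrightarrow> local_param klein P \<eta>"
  by (simp add: upar_def)

text \<open>If \<open>deriv s 0\<close> were 0, then by \<open>vderiv_product\<close> the derivative
  of \<open>\<gamma>\<close> would be a multiple of \<open>\<gamma> 0\<close>, against
  immersivity.\<close>

lemma upar_reparam:
  assumes "upar P \<eta>" "local_param klein P \<gamma>"
  obtains \<mu> s where "\<mu> analytic_on {0}" "\<mu> 0 \<noteq> 0" "s analytic_on {0}" "s 0 = 0" "deriv s 0 \<noteq> 0"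
    "\<forall>\<^sub>F t in nhds 0. \<gamma> t = \<mu> t *s \<eta> (s t) \<and> \<mu> t \<noteq> 0 \<and> \<eta> (s t) \<noteq> 0 \<and> proj (\<gamma> t) = proj (\<eta> (s t))"
proof -
  have g: "karc \<gamma>" "proj (\<gamma> 0) = P" "\<nexists>c. vderiv \<gamma> = c *s \<gamma> 0" using assms(2) by (auto simp: local_param_iff)
  have e: "karc \<eta>" using assms(1) by (auto simp: upar_def local_param_iff)
  obtain \<mu> s where m: "\<mu> analytic_on {0}" "\<mu> 0 \<noteq> 0" "s analytic_on {0}" "s 0 = 0"
    "\<forall>\<^sub>F t in nhds 0. \<gamma> t = \<mu> t *s \<eta> (s t)"
    using assms(1) g unfolding upar_def by blast
  have d: "vderiv \<gamma> = deriv \<mu> 0 *s \<eta> 0 + (\<mu> 0 * deriv s 0) *s vderiv \<eta>"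
    using e m by (intro vderiv_product) (auto simp: karc_def)
  have "deriv s 0 \<noteq> 0"
  proof
    assume "deriv s 0 = 0"
    moreover have "\<gamma> 0 = \<mu> 0 *s \<eta> 0" using eventually_nhds_x_imp_x[OF m(5)] m(4) by simp
    ultimately have "vderiv \<gamma> = (deriv \<mu> 0 / \<mu> 0) *s \<gamma> 0" using d m(2) by simp
    then show False using g(3) by blast
  qed
  moreover have "\<forall>\<^sub>F t in nhds 0. \<gamma> t = \<mu> t *s \<eta> (s t) \<and> \<mu> t \<noteq> 0 \<and> \<eta> (s t) \<noteq> 0 \<and> proj (\<gamma> t) = proj (\<eta> (s t))"
    using m(5) karc_eventually_klein[OF g(1)] by eventually_elim (auto simp: proj_scale)
  ultimately show ?thesis using m that by blast
qed

text \<open>Orders of the three coordinates along the curve. Each coordinate line is an inflectional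
  tangent: it meets the curve three times at one vertex and once at another.\<close>

definition ox :: "cp2 \<Rightarrow> int" where "ox P = (if P = ptC then 3 else if P = ptB then 1 else 0)"
definition oy :: "cp2 \<Rightarrow> int" where "oy P = (if P = ptA then 3 else if P = ptC then 1 else 0)"
definition oz :: "cp2 \<Rightarrow> int" where "oz P = (if P = ptB then 3 else if P = ptA then 1 else 0)"

lemma parC_ord: "ordeq (\<lambda>t. parC t $ 1) 3" "ordeq (\<lambda>t. parC t $ 2) 1" "ordeq (\<lambda>t. parC t $ 3) 0"
proof -
  have "ordeq (\<lambda>t. t^3 * (- (root7 ((1 + t^7)^2)^3) / (1 + t^7))) (3 + 0)"
    using ordeq_powi[of 3] by (intro ordeq_mult ordeq_analytic parC_units) auto
  then show "ordeq (\<lambda>t. parC t $ 1) 3" by (simp add: parC_nth)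
  have "ordeq (\<lambda>t. t * root7 ((1 + t^7)^2)) (1 + 0)"
    by (intro ordeq_mult ordeq_analytic parC_units ordeq_ident) auto
  then show "ordeq (\<lambda>t. parC t $ 2) 1" by (simp add: parC_nth)
qed (simp add: parC_nth ordeq_const)

lemma coord_ord_upar: assumes "P \<in> klein"
  obtains \<eta> where "upar P \<eta>" "ordeq (\<lambda>t. \<eta> t $ 1) (ox P)" "ordeq (\<lambda>t. \<eta> t $ 2) (oy P)" "ordeq (\<lambda>t. \<eta> t $ 3) (oz P)"
proof -
  consider "P = ptA" | "P = ptB" | "P = ptC" | "P \<noteq> ptA" "P \<noteq> ptB" "P \<noteq> ptC" by blast
  then show ?thesis
  proof cases
    case 1 then show ?thesis using that[of parA] parC_ord parA_upar
      by (simp add: parAB_nth ox_def oy_def oz_def abc_distinct)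
  next
    case 2 then show ?thesis using that[of parB] parC_ord parB_upar
      by (simp add: parAB_nth ox_def oy_def oz_def abc_distinct)
  next
    case 3 then show ?thesis using that[of parC] parC_ord parC_upar
      by (simp add: parAB_nth ox_def oy_def oz_def abc_distinct)
  next
    case 4
    obtain \<eta> where e: "upar P \<eta>" using upar_exists[OF assms] .
    then have k: "karc \<eta>" "proj (\<eta> 0) = P" by (auto simp: upar_def local_param_iff)
    have "\<eta> 0 $ 1 \<noteq> 0" "\<eta> 0 $ 2 \<noteq> 0" "\<eta> 0 $ 3 \<noteq> 0"
      using klein_coord_zero[of "\<eta> 0"] karc_at_0[OF k(1)] k(2) 4 by auto
    then show ?thesis using that[OF e] k(1) 4
      by (simp add: karc_def ordeq_analytic ox_def oy_def oz_def)
  qed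
qed

lemma coord_ord: assumes "P \<in> klein" "local_param klein P \<gamma>"
  shows "ordeq (\<lambda>t. \<gamma> t $ 1) (ox P)" "ordeq (\<lambda>t. \<gamma> t $ 2) (oy P)" "ordeq (\<lambda>t. \<gamma> t $ 3) (oz P)"
proof -
  obtain \<eta> where e: "upar P \<eta>" "ordeq (\<lambda>t. \<eta> t $ 1) (ox P)" "ordeq (\<lambda>t. \<eta> t $ 2) (oy P)" "ordeq (\<lambda>t. \<eta> t $ 3) (oz P)"
    using coord_ord_upar[OF assms(1)] .
  obtain \<mu> s where m: "\<mu> analytic_on {0}" "\<mu> 0 \<noteq> 0" "s analytic_on {0}" "s 0 = 0" "deriv s 0 \<noteq> 0"
    "\<forall>\<^sub>F t in nhds 0. \<gamma> t = \<mu> t *s \<eta> (s t) \<and> \<mu> t \<noteq> 0 \<and> \<eta> (s t) \<noteq> 0 \<and> proj (\<gamma> t) = proj (\<eta> (s t))"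
    using upar_reparam[OF e(1) assms(2)] .
  have "ordeq (\<lambda>t. \<gamma> t $ i) n" if "ordeq (\<lambda>t. \<eta> t $ i) n" for i n
  proof (rule ordeq_cong)
    show "\<forall>\<^sub>F t in at 0. \<gamma> t $ i = \<mu> t * \<eta> (s t) $ i"
      using eventually_at_of_nhds[OF m(6)] by eventually_elim (metis vector_smult_component)
    show "ordeq (\<lambda>t. \<mu> t * \<eta> (s t) $ i) n"
      using ordeq_mult[OF ordeq_analytic[OF m(1,2)] ord_compose(1)[OF m(3,4,5) that]] by simp
  qed
  then show "ordeq (\<lambda>t. \<gamma> t $ 1) (ox P)" "ordeq (\<lambda>t. \<gamma> t $ 2) (oy P)" "ordeq (\<lambda>t. \<gamma> t $ 3) (oz P)"
    using e by auto
qed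

lemma local_param_klein: "local_param klein P \<gamma> \<Longrightarrow> P \<in> klein"
  using karc_at_0 by (auto simp: local_param_iff)

lemma local_param_eventually:
  assumes "local_param klein P \<gamma>"
  shows "\<forall>\<^sub>F t in at 0. \<gamma> t \<noteq> 0 \<and> F4 (\<gamma> t) = 0 \<and> proj (\<gamma> t) \<in> klein \<and>
    \<gamma> t $ 1 \<noteq> 0 \<and> \<gamma> t $ 2 \<noteq> 0 \<and> \<gamma> t $ 3 \<noteq> 0 \<and> proj (\<gamma> t) \<noteq> ptA \<and> proj (\<gamma> t) \<noteq> ptB \<and> proj (\<gamma> t) \<noteq> ptC"
proof -
  have k: "karc \<gamma>" using assms by (simp add: local_param_iff)
  show ?thesis
    using eventually_at_of_nhds[OF karc_eventually_klein[OF k]]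
      coord_ord[OF local_param_klein[OF assms] assms, THEN ordeq_eventually_nonzero]
    by eventually_elim (auto simp: proj_eq_abc)
qed

text \<open>A Laurent monomial; degree zero, \<open>i + j + k = 0\<close>, makes it independent of
  the choice in \<open>rep\<close>.\<close>

definition cmono :: "int \<Rightarrow> int \<Rightarrow> int \<Rightarrow> cp2 \<Rightarrow> complex" where
  "cmono i j k P = rep P $ 1 powi i * rep P $ 2 powi j * rep P $ 3 powi k"

lemma cmono_proj:
  assumes "v \<noteq> 0" "i + j + k = 0" shows "cmono i j k (proj v) = v$1 powi i * v$2 powi j * v$3 powi k"
proof -
  obtain c where c: "c \<noteq> 0" "rep (proj v) = c *s v" using rep_proj[OF assms(1)] .
  have "c powi i * c powi j * c powi k = 1" using c(1) assms(2) by (simp add: power_int_add[symmetric])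
  then show ?thesis unfolding cmono_def c(2) by (simp add: power_int_mult_distrib mult_ac)
qed

lemma cmono_ord:
  assumes "local_param klein P \<gamma>" "i + j + k = 0"
  shows "ordeq (fun_expr (cmono i j k) \<gamma>) (i * ox P + j * oy P + k * oz P)"
proof (rule ordeq_cong)
  show "\<forall>\<^sub>F t in at 0. fun_expr (cmono i j k) \<gamma> t = \<gamma> t $ 1 powi i * \<gamma> t $ 2 powi j * \<gamma> t $ 3 powi k"
    using local_param_eventually[OF assms(1)]
    by eventually_elim (auto simp: fun_expr_def cmono_proj[OF _ assms(2)])
  show "ordeq (\<lambda>t. \<gamma> t $ 1 powi i * \<gamma> t $ 2 powi j * \<gamma> t $ 3 powi k) (i * ox P + j * oy P + k * oz P)"
    using coord_ord[OF local_param_klein[OF assms(1)] assms(1)] by (intro ordeq_mult ordeq_power_int)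
qed

lemma phi_eq_cmono: "phi = cmono 2 1 (-3)"
  by (auto simp: phi_def ratf_def cmono_def fun_eq_iff power_int_minus divide_inverse)

section \<open>Divisors and reparametrization\<close>

lemma has_divisor_iff:
  "has_divisor klein \<Phi> D \<longleftrightarrow> Poly_Mapping.keys D \<subseteq> klein \<and>
     (\<forall>P\<in>klein. \<forall>\<gamma>. local_param klein P \<gamma> \<longrightarrow> ordeq (\<Phi> \<gamma>) (Poly_Mapping.lookup D P))"
  unfolding has_divisor_def ordeq_iff by simp

lemma has_divisorD: "has_divisor klein \<Phi> D \<Longrightarrow> local_param klein P \<gamma> \<Longrightarrow> ordeq (\<Phi> \<gamma>) (Poly_Mapping.lookup D P)"
  using local_param_klein by (auto simp: has_divisor_iff)

text \<open>A punctured neighbourhood is open, so what holds near l also holds near every nearby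
  point. This allows equations valid near a point to be differentiated.\<close>

lemma eventually_at_nhds:
  assumes "\<forall>\<^sub>F t in at (l::complex). Q t" shows "\<forall>\<^sub>F t in at l. \<forall>\<^sub>F s in nhds t. Q s"
proof -
  obtain S where S: "open S" "l \<in> S" "\<And>x. x \<in> S \<Longrightarrow> x \<noteq> l \<Longrightarrow> Q x"
    using assms by (auto simp: eventually_at_topological)
  have "\<forall>\<^sub>F t in at l. t \<in> S - {l}" using S by (intro eventually_at_in_open) auto
  then show ?thesis
  proof eventually_elim
    case (elim t)
    have "\<forall>\<^sub>F s in nhds t. s \<in> S - {l}" using S(1) elim by (intro eventually_nhds_in_open) auto
    then show ?case by eventually_elim (use S in auto)
  qed
qed

lemma fun_expr_reparam:
  assumes "\<forall>\<^sub>F t in nhds 0. proj (\<gamma> t) = proj (\<eta> (s t))"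
    "s analytic_on {0}" "s 0 = 0" "deriv s 0 \<noteq> 0"
  shows "ordeq (fun_expr h \<eta>) n \<Longrightarrow> ordeq (fun_expr h \<gamma>) n"
    "ordge (fun_expr h \<eta>) n \<Longrightarrow> ordge (fun_expr h \<gamma>) n"
proof -
  have e: "\<forall>\<^sub>F t in at 0. fun_expr h \<gamma> t = fun_expr h \<eta> (s t)"
    using eventually_at_of_nhds[OF assms(1)] by eventually_elim (simp add: fun_expr_def)
  show "ordeq (fun_expr h \<eta>) n \<Longrightarrow> ordeq (fun_expr h \<gamma>) n"
    using ordeq_cong[OF e] ord_compose(1)[OF assms(2-4)] by blast
  show "ordge (fun_expr h \<eta>) n \<Longrightarrow> ordge (fun_expr h \<gamma>) n"
    using ordge_cong[OF e] ord_compose(2)[OF assms(2-4)] by blast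
qed

lemma fun_expr_upar:
  assumes "upar P \<eta>" "local_param klein P \<gamma>"
  shows "ordeq (fun_expr h \<eta>) n \<Longrightarrow> ordeq (fun_expr h \<gamma>) n"
    "ordge (fun_expr h \<eta>) n \<Longrightarrow> ordge (fun_expr h \<gamma>) n"
proof -
  obtain \<mu> s where m': "\<mu> analytic_on {0}" "\<mu> 0 \<noteq> 0" and m: "s analytic_on {0}" "s 0 = 0" "deriv s 0 \<noteq> 0"
    "\<forall>\<^sub>F t in nhds 0. \<gamma> t = \<mu> t *s \<eta> (s t) \<and> \<mu> t \<noteq> 0 \<and> \<eta> (s t) \<noteq> 0 \<and> proj (\<gamma> t) = proj (\<eta> (s t))"
    by (rule upar_reparam[OF assms])
  have p: "\<forall>\<^sub>F t in nhds 0. proj (\<gamma> t) = proj (\<eta> (s t))" using m(4) by eventually_elim blast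
  show "ordeq (fun_expr h \<eta>) n \<Longrightarrow> ordeq (fun_expr h \<gamma>) n"
    "ordge (fun_expr h \<eta>) n \<Longrightarrow> ordge (fun_expr h \<gamma>) n"
    using fun_expr_reparam[OF p m(1-3)] by auto
qed

lemma deriv_reparam:
  assumes e: "\<forall>\<^sub>F t in nhds 0. proj (\<gamma> t) = proj (\<eta> (s t))"
    "s analytic_on {0}" "s 0 = 0" "deriv s 0 \<noteq> 0" and g: "(\<lambda>t. g (proj (\<eta> t))) meromorphic_on {0}"
  shows "\<forall>\<^sub>F t in at 0. deriv (\<lambda>t. g (proj (\<gamma> t))) t = deriv (\<lambda>t. g (proj (\<eta> t))) (s t) * deriv s t"
proof -
  have fl: "filterlim s (at 0) (at 0)" using ordeq_filterlim[OF ordeq_deriv_zero[OF e(2-4)]] .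
  have "\<forall>\<^sub>F t in at 0. (\<lambda>t. g (proj (\<eta> t))) analytic_on {s t}"
    using mero_analytic_near[OF g] fl by (auto simp: filterlim_iff)
  moreover have "\<forall>\<^sub>F t in at 0. s analytic_on {t}" using analytic_eventually[OF e(2)] by (rule eventually_at_of_nhds)
  moreover have "\<forall>\<^sub>F t in at 0. \<forall>\<^sub>F t' in nhds t. proj (\<gamma> t') = proj (\<eta> (s t'))"
    using e(1) by (intro eventually_at_nhds eventually_at_of_nhds)
  ultimately show ?thesis
  proof eventually_elim
    case (elim t)
    have "\<forall>\<^sub>F x in nhds t. g (proj (\<gamma> x)) = ((\<lambda>t. g (proj (\<eta> t))) \<circ> s) x"
      using elim(3) by eventually_elim simp
    from deriv_cong_ev[OF this refl]
    have "deriv (\<lambda>t. g (proj (\<gamma> t))) t = deriv ((\<lambda>t. g (proj (\<eta> t))) \<circ> s) t" .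
    also have "\<dots> = deriv (\<lambda>t. g (proj (\<eta> t))) (s t) * deriv s t"
      using elim(1,2) by (intro deriv_chain analytic_on_imp_differentiable_at) auto
    finally show ?case .
  qed
qed

text \<open>By the chain rule the local expression acquires the factor \<open>deriv s\<close>, which
  is a unit at 0.\<close>

lemma form_expr_upar:
  assumes "upar P \<eta>" "local_param klein P \<gamma>" and g: "(\<lambda>t. g (proj (\<eta> t))) meromorphic_on {0}"
    and o: "ordeq (form_expr f g \<eta>) n"
  shows "ordeq (form_expr f g \<gamma>) n"
proof -
  obtain \<mu> s where m': "\<mu> analytic_on {0}" "\<mu> 0 \<noteq> 0" and m: "s analytic_on {0}" "s 0 = 0" "deriv s 0 \<noteq> 0"
    "\<forall>\<^sub>F t in nhds 0. \<gamma> t = \<mu> t *s \<eta> (s t) \<and> \<mu> t \<noteq> 0 \<and> \<eta> (s t) \<noteq> 0 \<and> proj (\<gamma> t) = proj (\<eta> (s t))"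
    by (rule upar_reparam[OF assms(1,2)])
  have p: "\<forall>\<^sub>F t in nhds 0. proj (\<gamma> t) = proj (\<eta> (s t))" using m(4) by eventually_elim blast
  have e: "\<forall>\<^sub>F t in at 0. form_expr f g \<gamma> t = form_expr f g \<eta> (s t) * deriv s t"
    using deriv_reparam[OF p m(1-3) g] eventually_at_of_nhds[OF p]
    by eventually_elim (simp add: form_expr_def)
  have "ordeq (\<lambda>t. form_expr f g \<eta> (s t) * deriv s t) (n + 0)"
    by (rule ordeq_mult[OF ord_compose(1)[OF m(1-3) o] ordeq_analytic[OF analytic_deriv[OF m(1)] m(3)]])
  from ordeq_cong[OF e this] show ?thesis by simp
qed

lemma line_expr_upar:
  assumes "upar P \<eta>" "local_param klein P \<gamma>" "ordeq (line_expr u \<eta>) n"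
  shows "ordeq (line_expr u \<gamma>) n"
proof -
  obtain \<mu> s where m: "\<mu> analytic_on {0}" "\<mu> 0 \<noteq> 0" "s analytic_on {0}" "s 0 = 0" "deriv s 0 \<noteq> 0"
    "\<forall>\<^sub>F t in nhds 0. \<gamma> t = \<mu> t *s \<eta> (s t) \<and> \<mu> t \<noteq> 0 \<and> \<eta> (s t) \<noteq> 0 \<and> proj (\<gamma> t) = proj (\<eta> (s t))"
    by (rule upar_reparam[OF assms(1,2)])
  have e: "\<forall>\<^sub>F t in at 0. line_expr u \<gamma> t = \<mu> t * line_expr u \<eta> (s t)"
    using eventually_at_of_nhds[OF m(6)]
    by eventually_elim (auto simp: line_expr_def sum_distrib_left mult_ac)
  have "ordeq (\<lambda>t. \<mu> t * line_expr u \<eta> (s t)) (0 + n)"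
    by (rule ordeq_mult[OF ordeq_analytic[OF m(1,2)] ord_compose(1)[OF m(3-5) assms(3)]])
  from ordeq_cong[OF e this] show ?thesis by simp
qed

subsection \<open>The differential of phi\<close>

text \<open>The divisor of d phi: ramification index 7 leaves zeros of order 7 - 1 over the values 0
  and -1, and a pole of order 7 + 1 over infinity.\<close>

definition ophi :: "cp2 \<Rightarrow> int" where
  "ophi P = (if P = ptA \<or> P = ptC then 6 else if P = ptB then -8 else 0)"

lemma ordeq_deriv_cong:
  assumes "\<forall>\<^sub>F t in at 0. f t = h t" "\<forall>\<^sub>F t in at 0. (h has_field_derivative h' t) (at t)" "ordeq h' n"
  shows "ordeq (deriv f) n"
proof -
  have "\<forall>\<^sub>F t in at 0. deriv f t = h' t"
    using eventually_at_nhds[OF assms(1)] assms(2)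
  proof eventually_elim
    case (elim t)
    have "deriv f t = deriv h t" by (rule deriv_cong_ev[OF elim(1)]) simp
    then show ?case using DERIV_imp_deriv[OF elim(2)] by simp
  qed
  then show ?thesis using assms(3) by (rule ordeq_cong)
qed

lemma parC_near': "\<forall>\<^sub>F t in at 0. t \<noteq> 0 \<and> 1 + t^7 \<noteq> 0 \<and> parC t $ 1 \<noteq> 0 \<and> parC t $ 2 \<noteq> 0 \<and>
  parC t $ 2 ^ 7 = t^7 * (1 + t^7)^2 \<and> parC t $ 1 = - (parC t $ 2 ^ 3) / (1 + t^7)"
  using eventually_at_of_nhds[OF parC_near] eventually_at_nonzero
proof eventually_elim
  case (elim t)
  have "root7 ((1 + t^7)^2) \<noteq> 0" by (simp add: root7_def)
  then show ?case using elim by (auto simp: parC_nth power_mult_distrib)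
qed

text \<open>On values l of phi the symmetry \<open>cycM\<close> acts as l -> - (1 + l) / l,
  permuting the branch values 0, infinity, -1 cyclically. The expansions at the other two vertices
  arise from t^7 at \<open>ptC\<close> in this way.\<close>

lemma phi_parA: "\<forall>\<^sub>F t in at 0. phi (proj (parA t)) = - inverse (1 + t^7)"
  using parC_near'
proof eventually_elim
  case (elim t)
  have nz: "parA t \<noteq> 0" using elim by (auto simp: vec3_eq_iff parAB_nth parC_nth)
  have "phi (proj (parA t)) = parC t $ 1 / parC t $ 2 ^ 3"
    using nz by (simp add: phi_proj parAB_nth parC_nth(3))
  also have "\<dots> = - inverse (1 + t^7)" using elim by (simp add: divide_inverse)
  finally show ?case .
qed

lemma phi_parC: "\<forall>\<^sub>F t in at 0. phi (proj (parC t)) = t^7"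
  using parC_near' eventually_at_of_nhds[OF parC_near]
proof eventually_elim
  case (elim t)
  have nz: "parC t \<noteq> 0" using elim by (auto simp: vec3_eq_iff parC_nth)
  then show ?case using elim by (simp add: phi_proj parC_nth(3))
qed

lemma phi_parB: "\<forall>\<^sub>F t in at 0. phi (proj (parB t)) = - 1 - inverse (t^7)"
  using parC_near'
proof eventually_elim
  case (elim t)
  have nz: "parB t \<noteq> 0" using elim by (auto simp: vec3_eq_iff parAB_nth parC_nth)
  define y where "y = parC t $ 2"
  define m where "m = 1 + t^7"
  have m: "m \<noteq> 0" "y \<noteq> 0" "y^7 = t^7 * m^2" "t \<noteq> 0" using elim by (auto simp: y_def m_def)
  define a where "a = - (y^3) / m"
  have a: "a * m = - (y^3)" "a \<noteq> 0" using m by (auto simp: a_def)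
  have "m^3 * (y^2 * t^7) = y^2 * (t^7 * m^2) * m" by Groebner_Basis.algebra
  also have "\<dots> = - ((- (y^3))^3 * m)" unfolding m(3)[symmetric] by Groebner_Basis.algebra
  also have "\<dots> = m^3 * (- (m * a^3))" unfolding a(1)[symmetric] by Groebner_Basis.algebra
  finally have "y^2 * t^7 = - (m * a^3)"
    by (rule mult_left_cancel[THEN iffD1, rotated]) (use m in simp)
  then have "y^2 / a^3 = - (m / t^7)" using a(2) m(4) by (simp add: field_simps)
  moreover have "phi (proj (parB t)) = y^2 / a^3"
    using nz elim by (simp add: phi_proj parAB_nth parC_nth(3) y_def m_def a_def)
  moreover have "m / t^7 = 1 + inverse (t^7)" using m(4) by (simp add: m_def field_simps)
  ultimately show ?case by simp
qed

lemma dphi_ord_upar: assumes "P \<in> klein"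
  obtains \<eta> where "upar P \<eta>" "ordeq (deriv (\<lambda>t. phi (proj (\<eta> t)))) (ophi P)"
proof -
  consider "P = ptA" | "P = ptB" | "P = ptC" | "P \<noteq> ptA" "P \<noteq> ptB" "P \<noteq> ptC" by blast
  then show ?thesis
  proof cases
    case 1
    have "ordeq (deriv (\<lambda>t. phi (proj (parA t)))) 6"
    proof (rule ordeq_deriv_cong[OF phi_parA])
      have "\<forall>\<^sub>F t in at 0. 1 + t^7 \<noteq> (0::complex)" using parC_near' by eventually_elim simp
      then show "\<forall>\<^sub>F t in at 0. ((\<lambda>t. - inverse (1 + t^7)) has_field_derivative t^6 * (7 * inverse (1 + t^7)^2)) (at (t::complex))"
        by eventually_elim (auto intro!: derivative_eq_intros simp: power2_eq_square)
      show "ordeq (\<lambda>t. t^6 * (7 * inverse (1 + t^7)^2)) 6"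
      proof -
        have "(\<lambda>t. 7 * inverse (1 + t^7)^2) analytic_on {0::complex}" by (auto intro!: analytic_intros)
        from ordeq_mult[OF ordeq_power[OF ordeq_ident, of 6] ordeq_analytic[OF this]] show ?thesis by simp
      qed
    qed
    then show ?thesis using that[OF parA_upar[folded 1]] 1 by (simp add: ophi_def)
  next
    case 2
    have "ordeq (deriv (\<lambda>t. phi (proj (parB t)))) (-8)"
    proof (rule ordeq_deriv_cong[OF phi_parB])
      show "\<forall>\<^sub>F t in at 0. ((\<lambda>t. - 1 - inverse (t^7)) has_field_derivative 7 * t^6 * inverse (t^7)^2) (at (t::complex))"
        using eventually_at_nonzero
        by eventually_elim (auto intro!: derivative_eq_intros simp: power2_eq_square)
      show "ordeq (\<lambda>t. 7 * t^6 * inverse (t^7)^2) (-8)"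
        using ordeq_mult[OF ordeq_mult[OF ordeq_const[of 7] ordeq_power[OF ordeq_ident, of 6]]
            ordeq_power[OF ordeq_inverse[OF ordeq_power[OF ordeq_ident, of 7]], of 2]] by simp
    qed
    then show ?thesis using that[OF parB_upar[folded 2]] 2 by (simp add: ophi_def abc_distinct)
  next
    case 3
    have "ordeq (deriv (\<lambda>t. phi (proj (parC t)))) 6"
    proof (rule ordeq_deriv_cong[OF phi_parC])
      show "\<forall>\<^sub>F t in at 0. ((\<lambda>t. t^7) has_field_derivative 7 * t^6) (at (t::complex))"
        by (intro always_eventually allI) (auto intro!: derivative_eq_intros)
      show "ordeq (\<lambda>t. 7 * t^6) 6"
        using ordeq_mult[OF ordeq_const[of 7] ordeq_power[OF ordeq_ident, of 6]] by simp
    qed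
    then show ?thesis using that[OF parC_upar[folded 3]] 3 by (simp add: ophi_def)
  next
    case 4
    obtain y where y: "phi P \<noteq> 0" "1 + phi P \<noteq> 0" "y^7 = phi P * (1 + phi P)^2" "upar P (par (phi P) y)"
      by (rule upar_generic[OF assms 4])
    have "ordeq (deriv (\<lambda>t. phi (proj (par (phi P) y t)))) 0"
    proof (rule ordeq_deriv_cong)
      show "\<forall>\<^sub>F t in at 0. phi (proj (par (phi P) y t)) = phi P + t"
        using eventually_at_of_nhds[OF par_near[OF y(1-3)]] by eventually_elim simp
      show "\<forall>\<^sub>F t in at 0. ((\<lambda>t. phi P + t) has_field_derivative 1) (at (t::complex))"
        by (intro always_eventually allI) (auto intro!: derivative_eq_intros)
    qed (simp add: ordeq_const)
    then show ?thesis using that[OF y(4)] 4 by (simp add: ophi_def)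
  qed
qed

lemma phi_mero: "local_param klein P \<gamma> \<Longrightarrow> (\<lambda>t. phi (proj (\<gamma> t))) meromorphic_on {0}"
  using ordeq_mero(1)[OF cmono_ord[of P \<gamma> 2 1 "-3"]] by (simp add: phi_eq_cmono fun_expr_def[abs_def])

lemma dphi_ord: assumes "local_param klein P \<gamma>"
  shows "ordeq (deriv (\<lambda>t. phi (proj (\<gamma> t)))) (ophi P)"
proof -
  obtain \<eta> where e: "upar P \<eta>" "ordeq (deriv (\<lambda>t. phi (proj (\<eta> t)))) (ophi P)"
    using dphi_ord_upar[OF local_param_klein[OF assms]] .
  have "ordeq (form_expr (\<lambda>_. 1) phi \<gamma>) (ophi P)"
    by (rule form_expr_upar[OF e(1) assms phi_mero[OF upar_local_param[OF e(1)]]])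
      (use e(2) in \<open>simp add: form_expr_def[abs_def]\<close>)
  then show ?thesis by (simp add: form_expr_def[abs_def])
qed

text \<open>A locally constant phi would have derivative 0, against \<open>dphi_ord\<close>. It
  follows that a parameter leaves every given point at once.\<close>

lemma phi_not_eventually_const:
  assumes "local_param klein P \<gamma>" shows "\<forall>\<^sub>F t in at 0. phi (proj (\<gamma> t)) \<noteq> l"
proof -
  have "(\<lambda>t. phi (proj (\<gamma> t)) - l) meromorphic_on {0}" using phi_mero[OF assms] by (intro meromorphic_intros)
  then show ?thesis
  proof (rule mero_cases)
    assume "\<forall>\<^sub>F t in at 0. phi (proj (\<gamma> t)) - l = 0"
    from eventually_at_nhds[OF this]
    have "\<forall>\<^sub>F t in at 0. deriv (\<lambda>t. phi (proj (\<gamma> t))) t = 0"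
    proof eventually_elim
      case (elim t)
      then have "\<forall>\<^sub>F x in nhds t. phi (proj (\<gamma> x)) = l" by eventually_elim simp
      from deriv_cong_ev[OF this refl] have "deriv (\<lambda>t. phi (proj (\<gamma> t))) t = deriv (\<lambda>_. l) t" .
      then show ?case by simp
    qed
    then have "\<forall>\<^sub>F t in at (0::complex). False"
      using ordeq_eventually_nonzero[OF dphi_ord[OF assms]] by eventually_elim simp
    then show ?thesis by simp
  next
    fix n assume "ordeq (\<lambda>t. phi (proj (\<gamma> t)) - l) n"
    from ordeq_eventually_nonzero[OF this] show ?thesis by eventually_elim simp
  qed
qed

lemma local_param_avoids:
  assumes "local_param klein P \<gamma>" shows "\<forall>\<^sub>F t in at 0. proj (\<gamma> t) \<noteq> Q"
  using phi_not_eventually_const[OF assms, of "phi Q"] by eventually_elim auto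

section \<open>Linear equivalence and the canonical class\<close>

abbreviation "FA \<equiv> free_Abelian_group klein"
abbreviation "PD \<equiv> principal_divisors klein"
abbreviation "fdiv h D \<equiv> has_divisor klein (fun_expr h) D"

lemma PD_iff: "D \<in> PD \<longleftrightarrow> (\<exists>h. fdiv h D)"
  by (simp add: principal_divisors_def)

lemma fdivI:
  assumes "Poly_Mapping.keys D \<subseteq> klein"
    "\<And>P \<gamma>. local_param klein P \<gamma> \<Longrightarrow> ordeq (\<lambda>t. h (proj (\<gamma> t))) (Poly_Mapping.lookup D P)"
  shows "fdiv h D"
  using assms by (auto simp: has_divisor_iff fun_expr_def[abs_def])

lemma fdivD: "fdiv h D \<Longrightarrow> local_param klein P \<gamma> \<Longrightarrow> ordeq (\<lambda>t. h (proj (\<gamma> t))) (Poly_Mapping.lookup D P)"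
  using has_divisorD[of "fun_expr h"] by (simp add: fun_expr_def[abs_def])

lemma has_divisor_keys: "has_divisor klein \<Phi> D \<Longrightarrow> Poly_Mapping.keys D \<subseteq> klein"
  by (simp add: has_divisor_iff)

lemma keys_add_subset: "Poly_Mapping.keys D \<subseteq> S \<Longrightarrow> Poly_Mapping.keys E \<subseteq> S \<Longrightarrow> Poly_Mapping.keys (D + E) \<subseteq> S"
  by (rule order_trans[OF keys_add Un_least])

lemma keys_diff_subset:
  "Poly_Mapping.keys D \<subseteq> S \<Longrightarrow> Poly_Mapping.keys E \<subseteq> S \<Longrightarrow> Poly_Mapping.keys (D - E :: _ \<Rightarrow>\<^sub>0 int) \<subseteq> S"
  by (rule order_trans[OF keys_diff Un_least])

lemma fdiv_const: "c \<noteq> 0 \<Longrightarrow> fdiv (\<lambda>_. c) 0"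
  by (rule fdivI) (auto simp: ordeq_const)

lemma fdiv_mult: "fdiv f D \<Longrightarrow> fdiv h E \<Longrightarrow> fdiv (\<lambda>P. f P * h P) (D + E)"
  by (rule fdivI) (simp_all add: lookup_add keys_add_subset ordeq_mult fdivD has_divisor_keys)

lemma fdiv_inverse: "fdiv f D \<Longrightarrow> fdiv (\<lambda>P. inverse (f P)) (- D)"
  by (rule fdivI) (simp_all add: ordeq_inverse fdivD has_divisor_keys)

lemma PD_zero: "0 \<in> PD" using fdiv_const[of 1] PD_iff by auto
lemma PD_add: "D \<in> PD \<Longrightarrow> E \<in> PD \<Longrightarrow> D + E \<in> PD" using fdiv_mult PD_iff by blast
lemma PD_minus: "D \<in> PD \<Longrightarrow> - D \<in> PD" using fdiv_inverse PD_iff by blast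
lemma PD_diff: "D \<in> PD \<Longrightarrow> E \<in> PD \<Longrightarrow> D - E \<in> PD" using PD_add PD_minus by fastforce
lemma PD_keys: "D \<in> PD \<Longrightarrow> Poly_Mapping.keys D \<subseteq> klein" using PD_iff has_divisor_keys by blast

lemma PD_cmul: "D \<in> PD \<Longrightarrow> frag_cmul k D \<in> PD"
proof -
  assume D: "D \<in> PD"
  have n: "frag_cmul (int n) D \<in> PD" for n
    by (induction n) (auto simp: PD_zero frag_cmul_distrib intro: PD_add D)
  show ?thesis
  proof (cases "k \<ge> 0")
    case True then show ?thesis using n[of "nat k"] by simp
  next
    case False then show ?thesis using PD_minus[OF n[of "nat (- k)"]] by simp
  qed
qed

lemma PD_sum: "(\<And>i. i \<in> I \<Longrightarrow> D i \<in> PD) \<Longrightarrow> sum D I \<in> PD"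
  by (induction I rule: infinite_finite_induct) (auto intro: PD_zero PD_add)

lemma subgroup_PD: "subgroup PD FA"
  by (rule group.subgroupI[OF group_free_Abelian_group])
    (use PD_keys PD_zero PD_add PD_minus in auto)

lemma normal_PD: "PD \<lhd> FA"
  using comm_group.subgroup_imp_normal[OF abelian_free_Abelian_group subgroup_PD] .

lemma mem_divisor_class: "E \<in> divisor_class klein D \<longleftrightarrow> E - D \<in> PD"
  unfolding divisor_class_def r_coset_def by (auto simp: algebra_simps) (metis diff_add_cancel)

lemma divisor_class_eq_iff: "divisor_class klein D = divisor_class klein E \<longleftrightarrow> D - E \<in> PD"
proof
  assume "divisor_class klein D = divisor_class klein E"
  moreover have "D \<in> divisor_class klein D" by (simp add: mem_divisor_class PD_zero)
  ultimately show "D - E \<in> PD" by (simp add: mem_divisor_class)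
next
  assume DE: "D - E \<in> PD"
  have "H - D \<in> PD \<longleftrightarrow> H - E \<in> PD" for H
    using PD_add[OF _ DE, of "H - D"] PD_diff[OF _ DE, of "H - E"] by auto
  then show "divisor_class klein D = divisor_class klein E" by (auto simp: mem_divisor_class)
qed

lemma carrier_class_group:
  "carrier (class_group klein) = {divisor_class klein D |D. Poly_Mapping.keys D \<subseteq> klein}"
  by (auto simp: class_group_def FactGroup_def RCOSETS_def divisor_class_def)

lemma class_group_mult:
  assumes "Poly_Mapping.keys D \<subseteq> klein" "Poly_Mapping.keys E \<subseteq> klein"
  shows "divisor_class klein D \<otimes>\<^bsub>class_group klein\<^esub> divisor_class klein E = divisor_class klein (D + E)"
  using normal.rcos_sum[OF normal_PD, of D E] assms
  by (simp add: class_group_def FactGroup_def divisor_class_def)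

lemma group_class_group: "group (class_group klein)"
  unfolding class_group_def by (rule normal.factorgroup_is_group[OF normal_PD])

lemma class_group_inv:
  assumes "Poly_Mapping.keys D \<subseteq> klein"
  shows "inv\<^bsub>class_group klein\<^esub> divisor_class klein D = divisor_class klein (- D)"
proof (rule group.inv_equality[OF group_class_group])
  have "divisor_class klein 0 = \<one>\<^bsub>class_group klein\<^esub>"
    by (auto simp: mem_divisor_class class_group_def FactGroup_def)
  then show "divisor_class klein (- D) \<otimes>\<^bsub>class_group klein\<^esub> divisor_class klein D = \<one>\<^bsub>class_group klein\<^esub>"
    using assms by (subst class_group_mult) auto
  show "divisor_class klein D \<in> carrier (class_group klein)"
    unfolding carrier_class_group using assms by blast
  show "divisor_class klein (- D) \<in> carrier (class_group klein)"
    unfolding carrier_class_group using assms by (intro CollectI exI[of _ "- D"]) simp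
qed

subsection \<open>Quotients of differentials\<close>

lemma eventually_nhds_shift: "\<forall>\<^sub>F t in nhds (a::complex). Q t \<Longrightarrow> \<forall>\<^sub>F t in nhds 0. Q (a + t)"
  unfolding nhds_to_0[of a] eventually_filtermap by (simp add: add.commute)

lemma analytic_shift: "f analytic_on {a::complex} \<Longrightarrow> (\<lambda>t. f (a + t)) analytic_on {0}"
proof -
  assume f: "f analytic_on {a}"
  have "(\<lambda>t. a + t) analytic_on {0}" by (intro analytic_intros)
  from analytic_on_compose_gen[OF this f] show ?thesis by (simp add: o_def)
qed

lemma deriv_shift: "deriv (\<lambda>t. f (a + t)) 0 = deriv f (a::complex)"
  using deriv_shift_0[of f a] by (simp add: o_def)

text \<open>Immersivity at nearby points: were the derivative of the lift a multiple of its value,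
  the degree zero quotient phi would have derivative 0 there, but d phi does not vanish for small
  nonzero t.\<close>

lemma local_param_shift:
  assumes "local_param klein P \<gamma>"
  shows "\<forall>\<^sub>F t0 in at 0. local_param klein (proj (\<gamma> t0)) (\<lambda>t. \<gamma> (t0 + t))"
proof -
  have k: "karc \<gamma>" using assms by (simp add: local_param_iff)
  have an: "\<forall>\<^sub>F t in at 0. (\<lambda>t. \<gamma> t $ i) analytic_on {t}" for i
    using k by (intro eventually_at_of_nhds analytic_eventually) (simp add: karc_def)
  have F: "\<forall>\<^sub>F t in at 0. \<forall>\<^sub>F s in nhds t. F4 (\<gamma> s) = 0"
    using k by (intro eventually_at_nhds eventually_at_of_nhds) (simp add: karc_def)
  have z: "\<forall>\<^sub>F t in at 0. \<forall>\<^sub>F s in nhds t. \<gamma> s \<noteq> 0"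
  proof (intro eventually_at_nhds eventually_at_of_nhds)
    show "\<forall>\<^sub>F s in nhds 0. \<gamma> s \<noteq> 0" using karc_eventually_klein[OF k] by eventually_elim blast
  qed
  show ?thesis
    using an[of 1] an[of 2] an[of 3] F z local_param_eventually[OF assms] ordeq_eventually_nonzero[OF dphi_ord[OF assms]]
  proof eventually_elim
    case (elim t0)
    define \<delta> where "\<delta> t = \<gamma> (t0 + t)" for t
    have da: "\<forall>i. (\<lambda>t. \<delta> t $ i) analytic_on {0}"
      unfolding forall_3 \<delta>_def using elim(1-3) analytic_shift[of "\<lambda>t. \<gamma> t $ _"] by auto
    have kd: "karc \<delta>" using da elim(6) eventually_nhds_shift[OF elim(4)] by (simp add: karc_def \<delta>_def)
    have "vderiv \<delta> \<noteq> c *s \<delta> 0" for c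
    proof
      assume c: "vderiv \<delta> = c *s \<delta> 0"
      have D: "((\<lambda>t. \<delta> t $ i) has_field_derivative c * \<delta> 0 $ i) (at 0)" for i
        using karc_DERIV[OF da, of i] by (simp add: c)
      have "\<forall>\<^sub>F t in nhds 0. phi (proj (\<delta> t)) = \<delta> t $ 1 ^ 2 * \<delta> t $ 2 / \<delta> t $ 3 ^ 3"
        using eventually_nhds_shift[OF elim(5)] by eventually_elim (simp add: phi_proj \<delta>_def)
      moreover have "((\<lambda>t. \<delta> t $ 1 ^ 2 * \<delta> t $ 2 / \<delta> t $ 3 ^ 3) has_field_derivative 0) (at 0)"
      proof -
        have "((\<lambda>t. \<delta> t $ 1 ^ 2 * \<delta> t $ 2) has_field_derivative
            (of_nat 2 * (\<delta> 0 $ 1 ^ (2 - Suc 0) * (c * \<delta> 0 $ 1))) * \<delta> 0 $ 2 + (c * \<delta> 0 $ 2) * \<delta> 0 $ 1 ^ 2) (at 0)"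
          using DERIV_mult[OF DERIV_power[OF D, of 1 2] D[of 2]] by (simp add: mult_ac)
        moreover have "((\<lambda>t. \<delta> t $ 3 ^ 3) has_field_derivative of_nat 3 * (c * \<delta> 0 $ 3 * \<delta> 0 $ 3 ^ (3 - Suc 0))) (at 0)"
          by (rule DERIV_power[OF D])
        moreover have "\<delta> 0 $ 3 ^ 3 \<noteq> 0" using elim(6) by (simp add: \<delta>_def)
        ultimately show ?thesis
          by (rule DERIV_cong[OF DERIV_divide]) (simp add: power2_eq_square power3_eq_cube mult_ac)
      qed
      ultimately have "((\<lambda>t. phi (proj (\<delta> t))) has_field_derivative 0) (at 0)" by (rule DERIV_cong_nhds)
      from DERIV_imp_deriv[OF this] have "deriv (\<lambda>t. phi (proj (\<gamma> t))) t0 = 0"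
        using deriv_shift[of "\<lambda>t. phi (proj (\<gamma> t))" t0] by (simp add: \<delta>_def)
      then show False using elim(7) by simp
    qed
    then show ?case using kd unfolding local_param_iff \<delta>_def by auto
  qed
qed

text \<open>The value of the meromorphic w at 0 could be arbitrary. Since v equals w(s(t)) at 0 as
  well, and v is continuous, that value is the limit of w.\<close>

lemma analytic_of_reparam:
  assumes s: "s analytic_on {0}" "s 0 = 0" "deriv s 0 \<noteq> 0" and w: "w meromorphic_on {0}"
    and v: "v analytic_on {0}" "\<forall>\<^sub>F t in nhds 0. v t = w (s t)"
  shows "w analytic_on {0}"
proof -
  have "ordge w 0" using w
  proof (rule mero_cases)
    assume "\<forall>\<^sub>F t in at 0. w t = 0" from ordge_cong[OF this ordge_zero] show ?thesis .
  next
    fix n assume n: "ordeq w n"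
    have "ordeq v n" using ordeq_cong[OF eventually_at_of_nhds[OF v(2)] ord_compose(1)[OF s n]] .
    then have "0 \<le> n" using ordeq_ordge_le ordge_analytic[OF v(1)] by blast
    then show ?thesis using ordge_mono[OF ordeq_ordge[OF n]] by simp
  qed
  then obtain l where l: "(w \<longlongrightarrow> l) (at 0)" using ordge_tendsto by blast
  have "((\<lambda>t. w (s t)) \<longlongrightarrow> l) (at 0)"
    using l ordeq_filterlim[OF ordeq_deriv_zero[OF s]] by (rule filterlim_compose)
  then have "(v \<longlongrightarrow> l) (at 0)"
    using tendsto_cong[OF eventually_at_of_nhds[OF v(2)]] by simp
  moreover have "(v \<longlongrightarrow> v 0) (at 0)" using analytic_at_imp_isCont[OF v(1)] by (simp add: isCont_def)
  ultimately have "v 0 = l" using tendsto_unique[OF at_neq_bot] by blast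
  then have "w 0 = l" using eventually_nhds_x_imp_x[OF v(2)] s(2) by simp
  then have "isCont w 0" using l by (simp add: isCont_def)
  then show ?thesis using meromorphic_at_isCont_imp_analytic[OF w] by simp
qed

lemma deriv_reparam_0:
  assumes s: "s analytic_on {0}" "s 0 = 0" "deriv s 0 \<noteq> 0" and w: "w meromorphic_on {0}"
    and v: "v analytic_on {0}" "\<forall>\<^sub>F t in nhds 0. v t = w (s t)"
  shows "deriv v 0 = deriv w 0 * deriv s 0"
proof -
  have "\<forall>\<^sub>F t in nhds 0. v t = (w \<circ> s) t" using v(2) by eventually_elim simp
  from deriv_cong_ev[OF this refl] have "deriv v 0 = deriv (w \<circ> s) 0" .
  also have "\<dots> = deriv w (s 0) * deriv s 0"
    using analytic_of_reparam[OF s w v] s by (intro deriv_chain analytic_on_imp_differentiable_at) auto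
  finally show ?thesis using s(2) by simp
qed

lemma upar_some: "P \<in> klein \<Longrightarrow> upar P (SOME \<eta>. upar P \<eta>)"
proof -
  assume "P \<in> klein"
  then obtain \<eta> where "upar P \<eta>" by (rule upar_exists)
  then show ?thesis by (rule someI[where P = "upar P"])
qed

text \<open>The quotient dg / d phi as a function of the point, evaluated in a chosen parameter. It
  is wanted because an equivalence between f dg and \<open>f0\<close> d phi must be witnessed by a
  function on the curve.\<close>

definition ddphi :: "(cp2 \<Rightarrow> complex) \<Rightarrow> cp2 \<Rightarrow> complex" where
  "ddphi g P = (let \<eta> = SOME \<eta>. upar P \<eta> in
     deriv (\<lambda>t. g (proj (\<eta> t))) 0 / deriv (\<lambda>t. phi (proj (\<eta> t))) 0)"

lemma meromorphic_funD:
  "meromorphic_fun klein g \<Longrightarrow> local_param klein P \<gamma> \<Longrightarrow> (\<lambda>t. g (proj (\<gamma> t))) meromorphic_on {0}"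
  using local_param_klein by (auto simp: meromorphic_fun_def)

lemma meromorphic_fun_phi: "meromorphic_fun klein phi"
  using phi_mero by (auto simp: meromorphic_fun_def)

lemma ddphi_eq:
  assumes "local_param klein P \<gamma>" and g: "meromorphic_fun klein g"
  shows "\<forall>\<^sub>F t in at 0. ddphi g (proj (\<gamma> t)) =
    deriv (\<lambda>t. g (proj (\<gamma> t))) t / deriv (\<lambda>t. phi (proj (\<gamma> t))) t"
  using local_param_shift[OF assms(1)] mero_analytic_near[OF meromorphic_funD[OF g assms(1)]]
    mero_analytic_near[OF phi_mero[OF assms(1)]]
proof eventually_elim
  case (elim t0)
  define \<eta> where "\<eta> = (SOME \<eta>. upar (proj (\<gamma> t0)) \<eta>)"
  have e: "upar (proj (\<gamma> t0)) \<eta>"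
    unfolding \<eta>_def by (rule upar_some[OF local_param_klein[OF elim(1)]])
  obtain \<mu> s where m: "\<mu> analytic_on {0}" "\<mu> 0 \<noteq> 0" "s analytic_on {0}" "s 0 = 0" "deriv s 0 \<noteq> 0"
    "\<forall>\<^sub>F t in nhds 0. \<gamma> (t0 + t) = \<mu> t *s \<eta> (s t) \<and> \<mu> t \<noteq> 0 \<and> \<eta> (s t) \<noteq> 0 \<and> proj (\<gamma> (t0 + t)) = proj (\<eta> (s t))"
    by (rule upar_reparam[OF e elim(1)])
  have *: "deriv (\<lambda>t. h (proj (\<gamma> t))) t0 = deriv (\<lambda>t. h (proj (\<eta> t))) 0 * deriv s 0"
    if "meromorphic_fun klein h" "(\<lambda>t. h (proj (\<gamma> t))) analytic_on {t0}" for h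
  proof -
    have "deriv (\<lambda>t. h (proj (\<gamma> (t0 + t)))) 0 = deriv (\<lambda>t. h (proj (\<eta> t))) 0 * deriv s 0"
    proof (rule deriv_reparam_0[OF m(3-5)])
      show "(\<lambda>t. h (proj (\<eta> t))) meromorphic_on {0}"
        by (rule meromorphic_funD[OF that(1) upar_local_param[OF e]])
      show "(\<lambda>t. h (proj (\<gamma> (t0 + t)))) analytic_on {0}" using analytic_shift[OF that(2)] .
      show "\<forall>\<^sub>F t in nhds 0. h (proj (\<gamma> (t0 + t))) = h (proj (\<eta> (s t)))"
        using m(6) by eventually_elim metis
    qed
    then show ?thesis using deriv_shift[of "\<lambda>t. h (proj (\<gamma> t))" t0] by simp
  qed
  show ?case
    unfolding ddphi_def \<eta>_def[symmetric] Let_def *[OF g elim(2)] *[OF meromorphic_fun_phi elim(3)]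
    using m(5) by simp
qed

text \<open>The divisor cut out by the line z = 0, the fixed representative of the canonical class
  from here on.\<close>

definition Dz :: "cp2 \<Rightarrow>\<^sub>0 int" where "Dz = frag_of ptA + frag_cmul 3 (frag_of ptB)"

lemma lookup_Dz: "Poly_Mapping.lookup Dz P = oz P"
  by (auto simp: Dz_def lookup_add oz_def abc_distinct)

lemma keys_Dz: "Poly_Mapping.keys Dz \<subseteq> klein"
  unfolding Dz_def by (intro keys_add_subset) (auto simp: abc_in_klein)

text \<open>The exponents are the solution of 3 j + k = -5, i + 3 k = 11, 3 i + j = -6, which says
  at the three vertices that \<open>f0\<close> d phi has the divisor \<open>Dz\<close>.\<close>

definition f0 :: "cp2 \<Rightarrow> complex" where "f0 = cmono (-1) (-3) 4"

lemma f0_ord: "local_param klein P \<gamma> \<Longrightarrow> ordeq (\<lambda>t. f0 (proj (\<gamma> t))) (- ox P - 3 * oy P + 4 * oz P)"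
  using cmono_ord[of P \<gamma> "-1" "-3" 4] by (simp add: f0_def fun_expr_def[abs_def])

lemma f0_dphi_ord: "local_param klein P \<gamma> \<Longrightarrow>
    ordeq (\<lambda>t. f0 (proj (\<gamma> t)) * deriv (\<lambda>t. phi (proj (\<gamma> t))) t) (oz P)"
proof -
  assume l: "local_param klein P \<gamma>"
  have o: "- ox P - 3 * oy P + 4 * oz P + ophi P = oz P"
    by (auto simp: ox_def oy_def oz_def ophi_def abc_distinct)
  show ?thesis using ordeq_mult[OF f0_ord[OF l] dphi_ord[OF l]] unfolding o .
qed

text \<open>A differential f dg is \<open>f0\<close> d phi times the function f (dg / d phi) /
  \<open>f0\<close>, so its divisor is equivalent to \<open>Dz\<close>. Conversely, multiplying
  \<open>f0\<close> d phi by h realizes every divisor in the class.\<close>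

lemma canonical_class_eq: "canonical_class klein = divisor_class klein Dz"
proof (intro equalityI subsetI)
  fix D assume "D \<in> canonical_class klein"
  then obtain f g where fg: "meromorphic_fun klein f" "meromorphic_fun klein g"
    "has_divisor klein (form_expr f g) D" by (auto simp: canonical_class_def)
  have "fdiv (\<lambda>P. f P * ddphi g P / f0 P) (D - Dz)"
  proof (rule fdivI)
    show "Poly_Mapping.keys (D - Dz) \<subseteq> klein" using keys_diff_subset has_divisor_keys[OF fg(3)] keys_Dz .
    fix P \<gamma> assume l: "local_param klein P \<gamma>"
    have "\<forall>\<^sub>F t in at 0. f (proj (\<gamma> t)) * ddphi g (proj (\<gamma> t)) / f0 (proj (\<gamma> t)) =
      form_expr f g \<gamma> t / (f0 (proj (\<gamma> t)) * deriv (\<lambda>t. phi (proj (\<gamma> t))) t)"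
      using ddphi_eq[OF l fg(2)] by eventually_elim (simp add: form_expr_def mult_ac)
    moreover have "ordeq (\<lambda>t. form_expr f g \<gamma> t / (f0 (proj (\<gamma> t)) * deriv (\<lambda>t. phi (proj (\<gamma> t))) t))
      (Poly_Mapping.lookup D P - oz P)"
      by (rule ordeq_divide[OF has_divisorD[OF fg(3) l] f0_dphi_ord[OF l]])
    ultimately show "ordeq (\<lambda>t. f (proj (\<gamma> t)) * ddphi g (proj (\<gamma> t)) / f0 (proj (\<gamma> t)))
      (Poly_Mapping.lookup (D - Dz) P)"
      unfolding lookup_minus lookup_Dz by (rule ordeq_cong)
  qed
  then show "D \<in> divisor_class klein Dz" unfolding mem_divisor_class PD_iff by blast
next
  fix D assume "D \<in> divisor_class klein Dz"
  then obtain h where h: "fdiv h (D - Dz)" unfolding mem_divisor_class PD_iff by blast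
  have "Poly_Mapping.keys D \<subseteq> klein"
    using keys_add_subset[OF has_divisor_keys[OF h] keys_Dz] by simp
  moreover have "ordeq (form_expr (\<lambda>P. h P * f0 P) phi \<gamma>) (Poly_Mapping.lookup D P)"
    if l: "local_param klein P \<gamma>" for P \<gamma>
    using ordeq_mult[OF fdivD[OF h l] f0_dphi_ord[OF l]]
    by (simp add: form_expr_def[abs_def] lookup_minus lookup_Dz mult.assoc)
  ultimately have "has_divisor klein (form_expr (\<lambda>P. h P * f0 P) phi) D" by (simp add: has_divisor_iff)
  moreover have "meromorphic_fun klein (\<lambda>P. h P * f0 P)"
    unfolding meromorphic_fun_def using ordeq_mero(1)[OF ordeq_mult[OF fdivD[OF h] f0_ord]] by auto
  ultimately show "D \<in> canonical_class klein"
    unfolding canonical_class_def using meromorphic_fun_phi by blast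
qed

subsection \<open>Line sections\<close>

definition lform :: "complex^3 \<Rightarrow> complex^3 \<Rightarrow> complex" where
  "lform u v = u$1 * v$1 + u$2 * v$2 + u$3 * v$3"

lemma line_expr_eq: "line_expr u \<gamma> t = lform u (\<gamma> t)"
  by (simp add: line_expr_def sum_3 lform_def)

lemma lform_scale: "lform u (c *s v) = c * lform u v"
  by (simp add: lform_def algebra_simps)

lemma finite_affine_line:
  fixes a b c :: complex assumes "a \<noteq> 0 \<or> b \<noteq> 0 \<or> c \<noteq> 0"
  shows "finite {(x, y). x^3 * y + y^3 + x = 0 \<and> a * x + b * y + c = 0}" (is "finite ?S")
proof (cases "b = 0")
  case b: False
  define m where "m = - a / b"
  define n where "n = - c / b"
  define p where "p = [: n^3, 3 * m * n^2 + 1, 3 * m^2 * n, m^3 + n, m :]"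
  have y: "y = m * x + n" if "a * x + b * y + c = 0" for x y
  proof -
    have "b * m = - a" "b * n = - c" using b by (simp_all add: m_def n_def)
    then have "b * y = b * (m * x + n)" using that by Groebner_Basis.algebra
    then show ?thesis using b by simp
  qed
  \<comment> \<open>If the constant coefficient n^3 vanishes, the next coefficient is 1.\<close>
  have "p \<noteq> 0" by (auto simp: p_def)
  have "poly p x = x^3 * (m*x + n) + (m*x + n)^3 + x" for x
    unfolding p_def poly_pCons poly_0 by Groebner_Basis.algebra
  then have "?S \<subseteq> (\<lambda>x. (x, m * x + n)) ` {x. poly p x = 0}" using y by auto
  then show ?thesis using poly_roots_finite[OF \<open>p \<noteq> 0\<close>] finite_subset by blast
next
  case b: True
  show ?thesis
  proof (cases "a = 0")
    case True then have e: "?S = {}" using b assms by auto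
    show ?thesis unfolding e by simp
  next
    case False
    define x0 where "x0 = - c / a"
    define p where "p = [: x0, x0^3, 0, 1 :]"
    have "p \<noteq> 0" by (auto simp: p_def)
    have x: "x = x0" if "a * x + b * y + c = 0" for x y
    proof -
      have "a * x0 = - c" using False by (simp add: x0_def)
      then have "a * x = a * x0" using that b by Groebner_Basis.algebra
      then show ?thesis using False by simp
    qed
    have "poly p y = x0^3 * y + y^3 + x0" for y unfolding p_def poly_pCons poly_0 by Groebner_Basis.algebra
    then have "?S \<subseteq> (\<lambda>y. (x0, y)) ` {y. poly p y = 0}" using x by auto
    then show ?thesis using poly_roots_finite[OF \<open>p \<noteq> 0\<close>] finite_subset by blast
  qed
qed

lemma finite_line_section: assumes "u \<noteq> 0" shows "finite {P \<in> klein. lform u (rep P) = 0}"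
proof -
  define S where "S = {(x, y). x^3 * y + y^3 + x = 0 \<and> u$1 * x + u$2 * y + u$3 = 0}"
  have "finite S" unfolding S_def using assms by (intro finite_affine_line) (auto simp: vec3_eq_iff)
  have "{P \<in> klein. lform u (rep P) = 0} \<subseteq> {ptA, ptB} \<union> (\<lambda>(x, y). pt x y 1) ` S"
  proof
    fix P assume P: "P \<in> {P \<in> klein. lform u (rep P) = 0}"
    define v where "v = rep P"
    have v: "v \<noteq> 0" "proj v = P" "F4 v = 0" "lform u v = 0" using P rep[of P] by (auto simp: v_def klein_iff_rep)
    show "P \<in> {ptA, ptB} \<union> (\<lambda>(x, y). pt x y 1) ` S"
    proof (cases "v$3 = 0")
      case True then show ?thesis using klein_coord_zero(3)[OF v(1,3)] v(2) by auto
    next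
      case False
      define w where "w = inverse (v$3) *s v"
      have w: "F4 w = 0" "lform u w = 0" "w$3 = 1" using v False by (auto simp: w_def F4_scale lform_scale)
      have "proj w = P" unfolding w_def using v False by (simp add: proj_scale)
      moreover have "vector [w$1, w$2, 1] = w" using w(3) by (simp add: vec3_eq_iff)
      ultimately have "P = pt (w$1) (w$2) 1" by (simp add: pt_def)
      moreover have "(w$1, w$2) \<in> S" using w by (simp add: S_def F4_def lform_def)
      ultimately show ?thesis by force
    qed
  qed
  then show ?thesis using \<open>finite S\<close> finite_subset by blast
qed

text \<open>The form vanishes at finitely many points of the curve, and the parameter avoids each of
  them for small nonzero t.\<close>

lemma lform_eventually_nonzero:
  assumes "u \<noteq> 0" "local_param klein P \<gamma>" shows "\<forall>\<^sub>F t in at 0. lform u (\<gamma> t) \<noteq> 0"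
proof -
  have "\<forall>\<^sub>F t in at 0. \<forall>Q \<in> {P \<in> klein. lform u (rep P) = 0}. proj (\<gamma> t) \<noteq> Q"
    using finite_line_section[OF assms(1)] local_param_avoids[OF assms(2)]
    by (intro eventually_ball_finite) auto
  then show ?thesis using local_param_eventually[OF assms(2)]
  proof eventually_elim
    case (elim t)
    have g: "\<gamma> t \<noteq> 0" "proj (\<gamma> t) \<in> klein" using elim(2) by blast+
    obtain c where "c \<noteq> 0" "rep (proj (\<gamma> t)) = c *s \<gamma> t" by (rule rep_proj[OF g(1)])
    then have r: "lform u (rep (proj (\<gamma> t))) = c * lform u (\<gamma> t)" by (simp only: lform_scale)
    show ?case
    proof
      assume "lform u (\<gamma> t) = 0"
      then have "lform u (rep (proj (\<gamma> t))) = 0" using r by simp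
      then show False using elim(1) g(2) by blast
    qed
  qed
qed

lemma lform_analytic: "local_param klein P \<gamma> \<Longrightarrow> (\<lambda>t. lform u (\<gamma> t)) analytic_on {0}"
  unfolding lform_def local_param_iff karc_def by (auto intro!: analytic_intros)

lemma lookup_sum_frag:
  "finite Z \<Longrightarrow> Poly_Mapping.lookup (\<Sum>P\<in>Z. frag_cmul (n P) (frag_of P)) Q = (if Q \<in> Z then n Q else 0)"
  by (simp add: lookup_sum when_def if_distrib[of "\<lambda>x. n _ * x"] sum.delta cong: if_cong)

text \<open>Finiteness of the line section makes the local orders a divisor; the quotient of the
  linear form by z shows that it is equivalent to \<open>Dz\<close>.\<close>

lemma line_divisor:
  assumes "u \<noteq> 0"
  obtains D where "has_divisor klein (line_expr u) D" "D - Dz \<in> PD"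
proof -
  define Z where "Z = {P \<in> klein. lform u (rep P) = 0}"
  have Z: "finite Z" unfolding Z_def using finite_line_section[OF assms] .
  define \<eta> where "\<eta> P = (SOME \<eta>. upar P \<eta>)" for P
  have e: "upar P (\<eta> P)" if "P \<in> klein" for P
    unfolding \<eta>_def by (rule upar_some[OF that])
  define n where "n P = zorder (line_expr u (\<eta> P)) 0" for P
  define D where "D = (\<Sum>P\<in>Z. frag_cmul (n P) (frag_of P))"
  have an: "line_expr u (\<eta> P) analytic_on {0}" if "P \<in> klein" for P
    using lform_analytic[OF upar_local_param[OF e[OF that]], of u] by (simp add: line_expr_eq[abs_def])
  have n: "ordeq (line_expr u (\<eta> P)) (n P)" if "P \<in> klein" for P
    unfolding n_def using an[OF that] lform_eventually_nonzero[OF assms upar_local_param[OF e[OF that]]]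
    by (intro mero_ordeq analytic_on_imp_meromorphic_on) (auto simp: line_expr_eq eventually_frequently)
  have "Poly_Mapping.lookup D P = n P" if P: "P \<in> klein" for P
  proof (cases "P \<in> Z")
    case True then show ?thesis by (simp add: D_def lookup_sum_frag[OF Z])
  next
    case False
    have e0: "\<eta> P 0 \<noteq> 0" "proj (\<eta> P 0) = P" using upar_local_param[OF e[OF P]] by (auto simp: local_param_iff karc_def)
    obtain c where "rep (proj (\<eta> P 0)) = c *s \<eta> P 0" by (rule rep_proj[OF e0(1)])
    then have "rep P = c *s \<eta> P 0" by (simp only: e0(2))
    then have "line_expr u (\<eta> P) 0 \<noteq> 0" using False P by (auto simp: Z_def line_expr_eq lform_scale)
    then have "n P = 0" using ordeq_unique[OF n[OF P] ordeq_analytic[OF an[OF P]]] by simp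
    then show ?thesis using False by (simp add: D_def lookup_sum_frag[OF Z])
  qed
  moreover have kD: "Poly_Mapping.keys D \<subseteq> klein"
    unfolding D_def using keys_sum[of "\<lambda>P. frag_cmul (n P) (frag_of P)" Z] by (fastforce simp: Z_def)
  ultimately have D: "has_divisor klein (line_expr u) D"
    unfolding has_divisor_iff using n line_expr_upar[OF e] by auto
  have "fdiv (ratf (lform u) (\<lambda>v. v$3)) (D - Dz)"
  proof (rule fdivI)
    show "Poly_Mapping.keys (D - Dz) \<subseteq> klein" using keys_diff_subset kD keys_Dz .
    fix P \<gamma> assume l: "local_param klein P \<gamma>"
    have "\<forall>\<^sub>F t in at 0. ratf (lform u) (\<lambda>v. v$3) (proj (\<gamma> t)) = line_expr u \<gamma> t / \<gamma> t $ 3"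
      using local_param_eventually[OF l]
      by eventually_elim (subst ratf_proj[where n = 1]; simp add: lform_scale line_expr_eq)
    moreover have "ordeq (\<lambda>t. line_expr u \<gamma> t / \<gamma> t $ 3) (Poly_Mapping.lookup D P - oz P)"
      by (rule ordeq_divide[OF has_divisorD[OF D l] coord_ord(3)[OF local_param_klein[OF l] l]])
    ultimately show "ordeq (\<lambda>t. ratf (lform u) (\<lambda>v. v$3) (proj (\<gamma> t))) (Poly_Mapping.lookup (D - Dz) P)"
      unfolding lookup_minus lookup_Dz by (rule ordeq_cong)
  qed
  then show ?thesis using that D PD_iff by blast
qed

section \<open>The symmetry of order seven\<close>

definition zeta :: complex where "zeta = exp (2 * of_real pi * \<i> / 7)"

lemma zeta_power: "zeta ^ j = exp (2 * of_real pi * \<i> * of_nat j / of_nat 7)"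
  unfolding zeta_def exp_of_nat_mult[symmetric] by (simp add: field_simps)

lemma zeta_7 [simp]: "zeta ^ 7 = 1"
  unfolding zeta_power using complex_root_unity_eq_1[of 7 7] by simp

lemma zeta_power_eq_1_iff: "zeta ^ j = 1 \<longleftrightarrow> 7 dvd j"
  unfolding zeta_power using complex_root_unity_eq_1[of 7 j] by simp

lemma zeta_nonzero [simp]: "zeta \<noteq> 0" by (simp add: zeta_def)

lemma zeta_7_mult [simp]: "zeta ^ (7 * k) = 1" by (simp add: power_mult)

lemma root_of_unity_7: "w ^ 7 = 1 \<Longrightarrow> \<exists>j<7. w = zeta ^ j"
proof -
  assume "w ^ 7 = 1"
  then have "w \<in> {z. z ^ 7 = 1}" by simp
  also have "{z::complex. z ^ 7 = 1} = {exp (2 * of_real pi * \<i> * of_nat j / of_nat 7) | j. j < 7}"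
    by (rule complex_roots_unity) simp
  finally show ?thesis unfolding zeta_power by blast
qed

text \<open>The weights 4, 2, 1 fix each monomial of the quartic: 3 * 4 + 2, 3 * 2 + 1 and 3 * 1 + 4
  are divisible by 7. Exponents are natural numbers, so the inverse of \<open>gM i\<close> is
  \<open>gM (6 * i)\<close>.\<close>

definition gM :: "nat \<Rightarrow> complex^3^3" where
  "gM i = vector [vector [zeta ^ (4*i), 0, 0], vector [0, zeta ^ (2*i), 0], vector [0, 0, zeta ^ i]]"

lemma gM_nth: "(gM i *v v) $ 1 = zeta ^ (4*i) * v$1" "(gM i *v v) $ 2 = zeta ^ (2*i) * v$2"
  "(gM i *v v) $ 3 = zeta ^ i * v$3"
  unfolding gM_def mat3_mult_vec by auto

lemma gM_mult: "gM i ** gM j = gM (i + j)"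
  by (rule matrix_eq_3I)
    (simp add: matrix_vector_mul_assoc[symmetric] vec3_eq_iff gM_nth algebra_simps power_add)

lemma gM_7: "gM (7 * k) = mat 1"
proof (rule matrix_eq_3I)
  fix v :: "complex^3"
  have "zeta ^ (4 * (7 * k)) = 1" "zeta ^ (2 * (7 * k)) = 1"
    using zeta_7_mult[of "4 * k"] zeta_7_mult[of "2 * k"] by (simp_all add: mult_ac)
  then show "gM (7 * k) *v v = mat 1 *v v" by (simp add: vec3_eq_iff gM_nth)
qed

lemma F4_gM: "F4 (gM i *v v) = F4 v"
proof -
  have p: "(zeta ^ (4*i))^3 * zeta ^ (2*i) = 1" "(zeta ^ (2*i))^3 * zeta ^ i = 1" "(zeta ^ i)^3 * zeta ^ (4*i) = 1"
    using zeta_7_mult[of "2 * i"] zeta_7_mult[of i] by (simp_all flip: power_mult power_add)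
  have "F4 (gM i *v v) = ((zeta ^ (4*i))^3 * zeta ^ (2*i)) * (v$1^3 * v$2) +
      ((zeta ^ (2*i))^3 * zeta ^ i) * (v$2^3 * v$3) + ((zeta ^ i)^3 * zeta ^ (4*i)) * (v$3^3 * v$1)"
    unfolding F4_def gM_nth by Groebner_Basis.algebra
  then show ?thesis unfolding p by (simp add: F4_def)
qed

lemma F4sym_gM: "F4sym (gM i)"
proof -
  have "gM i ** gM (6 * i) = mat 1" "gM (6 * i) ** gM i = mat 1" using gM_7[of i] by (simp_all add: gM_mult)
  then have "invertible (gM i)" unfolding invertible_def by blast
  then show ?thesis unfolding F4sym_def using F4_gM by (intro conjI exI[of _ 1]) auto
qed

definition gact :: "nat \<Rightarrow> cp2 \<Rightarrow> cp2" where "gact i = lin (gM i)"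

lemma gact_add: "gact (i + j) P = gact i (gact j P)"
  unfolding gact_def by (simp add: lin_mult[symmetric] F4sym_invertible F4sym_gM gM_mult)

lemma gact_0 [simp]: "gact 0 P = P" using gM_7[of 0] by (simp add: gact_def lin_id)
lemma gact_7: "gact (7 * k) P = P" by (simp add: gact_def gM_7 lin_id)

lemma gact_proj: "v \<noteq> 0 \<Longrightarrow> gact i (proj v) = proj (gM i *v v)"
  unfolding gact_def by (rule lin_proj[OF F4sym_invertible[OF F4sym_gM]])

lemma gact_klein: "P \<in> klein \<Longrightarrow> gact i P \<in> klein"
  unfolding gact_def by (rule lin_klein[OF F4sym_gM])

lemma gM_nonzero: "gM i *v v = 0 \<longleftrightarrow> v = 0"
  by (rule invertible_nonzero[OF F4sym_invertible[OF F4sym_gM]])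

lemma gact_abc: "gact i P = ptA \<longleftrightarrow> P = ptA" "gact i P = ptB \<longleftrightarrow> P = ptB" "gact i P = ptC \<longleftrightarrow> P = ptC"
proof -
  obtain v where v: "v \<noteq> 0" "P = proj v" by (rule proj_cases)
  then have e: "gact i P = proj (gM i *v v)" "gM i *v v \<noteq> 0" by (simp_all add: gact_proj gM_nonzero)
  show "gact i P = ptA \<longleftrightarrow> P = ptA" "gact i P = ptB \<longleftrightarrow> P = ptB" "gact i P = ptC \<longleftrightarrow> P = ptC"
    unfolding v(2) gact_proj[OF v(1)] proj_eq_abc[OF e(2)] proj_eq_abc[OF v(1)] by (simp_all add: gM_nth)
qed

lemma phi_gact: "phi (gact i P) = phi P"
proof -
  obtain v where v: "v \<noteq> 0" "P = proj v" by (rule proj_cases)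
  have p: "(zeta ^ (4*i))^2 * zeta ^ (2*i) = (zeta ^ i)^3"
  proof -
    have "i*10 = 7*i + i*3" by simp
    then have "zeta ^ (i*10) = zeta ^ (i*3)" by (simp only: power_add zeta_7_mult mult_1)
    then show ?thesis by (simp add: power_add[symmetric] power_mult[symmetric] mult.commute)
  qed
  have "(gM i *v v)$1^2 * (gM i *v v)$2 = ((zeta ^ (4*i))^2 * zeta ^ (2*i)) * (v$1^2 * v$2)"
    unfolding gM_nth by Groebner_Basis.algebra
  then show ?thesis using v by (simp add: gact_proj phi_proj gM_nonzero p gM_nth(3) power_mult_distrib)
qed

text \<open>For fixed phi, y^7 is fixed and x is determined by y. Hence two points of a fibre differ
  by a seventh root of unity in y / z, which is what \<open>gact\<close> multiplies y / z
  by.\<close>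

lemma phi_fibre:
  assumes P: "P \<in> klein" "P \<noteq> ptA" "P \<noteq> ptB" "P \<noteq> ptC"
    and Q: "Q \<in> klein" "Q \<noteq> ptA" "Q \<noteq> ptB" "Q \<noteq> ptC" and e: "phi P = phi Q"
  shows "\<exists>i<7. Q = gact i P"
proof -
  obtain y where y: "1 + phi P \<noteq> 0" "phi P \<noteq> 0" "y^7 = phi P * (1 + phi P)^2" "P = proj (vector [- (y^3) / (1 + phi P), y, 1])"
    by (rule klein_generic[OF P])
  obtain y' where y': "y'^7 = phi Q * (1 + phi Q)^2" "Q = proj (vector [- (y'^3) / (1 + phi Q), y', 1])"
    by (rule klein_generic[OF Q])
  have y0: "y \<noteq> 0" using y(1-3) by auto
  have "(y' / y)^7 = 1" using y y' e y0 by (simp add: power_divide)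
  then obtain j where j: "j < 7" "y' / y = zeta ^ j" using root_of_unity_7 by blast
  then have yy: "y' = zeta ^ j * y" using y0 by (simp add: field_simps)
  define v where "v = (vector [- (y^3) / (1 + phi P), y, 1] :: complex^3)"
  have v0: "v \<noteq> 0" by (auto simp: v_def vec3_eq_iff)
  have z: "zeta ^ (4 * j) = zeta ^ j * (zeta ^ j)^3" "zeta ^ (2 * j) = zeta ^ j * zeta ^ j"
    by (simp_all add: mult_2 power_add flip: power_mult) (simp add: mult.commute[of 4] mult.commute[of j 3] flip: power_add)
  have "gM j *v v = zeta ^ j *s vector [- (y'^3) / (1 + phi Q), y', 1]"
    by (simp add: vec3_eq_iff gM_nth v_def z yy e power_mult_distrib)
  moreover have nz: "vector [- (y'^3) / (1 + phi Q), y', 1] \<noteq> (0 :: complex^3)" by (simp add: vec3_eq_iff)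
  ultimately have "proj (gM j *v v) = Q"
    using y'(2) proj_scale[OF nz, of "zeta ^ j"] by simp
  then have "gact j P = Q" using gact_proj[OF v0] y(4) v_def by simp
  then show ?thesis using j(1) by blast
qed

section \<open>Functions on the quotient\<close>

text \<open>The branch jumps across its cut, but its absolute value is the real seventh root, so it
  still tends to 0 with its argument.\<close>

lemma root7_filterlim:
  assumes "(f \<longlongrightarrow> 0) F" "\<forall>\<^sub>F x in F. f x \<noteq> 0"
  shows "filterlim (\<lambda>x. root7 (f x)) (at 0) F"
proof -
  have n: "cmod (root7 w) = root 7 (cmod w)" if "w \<noteq> 0" for w
    using root7_pow[OF that] by (intro real_root_pos_unique[symmetric]) (auto simp flip: norm_power)
  have "((\<lambda>x. root 7 (cmod (f x))) \<longlongrightarrow> root 7 (cmod 0)) F"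
    by (intro tendsto_intros assms)
  then have r: "((\<lambda>x. root 7 (cmod (f x))) \<longlongrightarrow> 0) F" by simp
  have "\<forall>\<^sub>F x in F. root 7 (cmod (f x)) = cmod (root7 (f x))"
    using assms(2) by eventually_elim (simp add: n)
  from tendsto_cong[OF this] r have "((\<lambda>x. cmod (root7 (f x))) \<longlongrightarrow> 0) F" by simp
  then have "((\<lambda>x. root7 (f x)) \<longlongrightarrow> 0) F" by (rule tendsto_norm_zero_cancel)
  then show ?thesis by (simp add: filterlim_at root7_def)
qed

lemma tendsto_Lim_bound:
  fixes T V :: "complex \<Rightarrow> complex"
  assumes "(T \<longlongrightarrow> V l) (at l)" "\<forall>\<^sub>F x in at l. cmod (T x) \<le> e" shows "cmod (V l) \<le> e"
  using tendsto_upperbound[OF tendsto_norm[OF assms(1)] assms(2)] by simp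

text \<open>Liouville leaves a polynomial of degree at most 3; the limit at infinity kills the cubic
  coefficient, and the two zeros fix the rest up to a factor.\<close>

lemma entire_subcubic:
  assumes hol: "V holomorphic_on UNIV" and V: "V 0 = 0" "V (-1) = 0"
    and lim: "((\<lambda>l. V l / l^3) \<longlongrightarrow> 0) at_infinity"
  shows "\<exists>\<kappa>. \<forall>l. V l = \<kappa> * (l * (1 + l))"
proof -
  have "\<forall>\<^sub>F l in at_infinity. dist (V l / l^3) 0 < 1" using lim by (rule tendstoD) simp
  then obtain A where A: "\<And>l. A \<le> cmod l \<Longrightarrow> cmod (V l / l^3) < 1" unfolding eventually_at_infinity by auto
  have b: "cmod (V l) \<le> 1 * cmod l ^ 3" if "max A 1 \<le> cmod l" for l
  proof -
    have "l \<noteq> 0" using that by auto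
    then show ?thesis using A[of l] that by (simp add: norm_divide norm_power divide_simps split: if_splits)
  qed
  define c where "c k = (deriv ^^ k) V 0 / fact k" for k
  have c: "V l = (\<Sum>k\<le>3. c k * l^k)" for l
    unfolding c_def by (rule Liouville_polynomial[OF hol b])
  have c': "V l = c 0 + c 1 * l + c 2 * l^2 + c 3 * l^3" for l
    unfolding c by (simp add: eval_nat_numeral)
  have "((\<lambda>l. c 0 * inverse l ^ 3 + c 1 * inverse l ^ 2 + c 2 * inverse l + c 3) \<longlongrightarrow>
      c 0 * 0 ^ 3 + c 1 * 0 ^ 2 + c 2 * 0 + c 3) at_infinity"
    by (intro tendsto_intros tendsto_inverse_0)
  moreover have "\<forall>\<^sub>F l in at_infinity. c 0 * inverse l ^ 3 + c 1 * inverse l ^ 2 + c 2 * inverse l + c 3 = V l / l^3"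
    using eventually_not_equal_at_infinity[of 0]
    by eventually_elim (simp add: c' field_simps power2_eq_square power3_eq_cube)
  ultimately have "((\<lambda>l. V l / l^3) \<longlongrightarrow> c 3) at_infinity" using tendsto_cong by force
  then have c3: "c 3 = 0" by (rule tendsto_unique[OF trivial_limit_at_infinity _ lim])
  have c0: "c 0 = 0" using V(1) c'[of 0] by simp
  have "c 2 = c 1" using V(2) c'[of "-1"] c0 c3 by simp
  then show ?thesis using c' c0 c3 by (intro exI[of _ "c 1"]) (simp add: algebra_simps power2_eq_square)
qed

text \<open>A set-theoretic section of phi. It need not be continuous, since invariant functions do
  not depend on the point chosen in a fibre.\<close>

definition pl :: "complex \<Rightarrow> cp2" where
  "pl l = proj (vector [- (root7 (l * (1 + l)^2) ^ 3) / (1 + l), root7 (l * (1 + l)^2), 1])"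

lemma pl:
  assumes "l \<noteq> 0" "1 + l \<noteq> 0"
  shows "phi (pl l) = l" "pl l \<in> klein" "pl l \<noteq> ptA" "pl l \<noteq> ptB" "pl l \<noteq> ptC"
    "upar (pl l) (par l (root7 (l * (1 + l)^2)))"
proof -
  have y: "root7 (l * (1 + l)^2) ^ 7 = l * (1 + l)^2" using assms by (simp add: root7_pow)
  have y0: "root7 (l * (1 + l)^2) \<noteq> 0" by (simp add: root7_def)
  note k = klein_of_phi[OF y assms(2)]
  show "phi (pl l) = l" unfolding pl_def phi_proj[OF k(2)] k(3) ..
  show "pl l \<in> klein" unfolding pl_def proj_in_klein_iff[OF k(2)] k(1) ..
  show "pl l \<noteq> ptA" "pl l \<noteq> ptB" "pl l \<noteq> ptC"
    unfolding pl_def proj_eq_abc[OF k(2)] using y0 by auto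
  show "upar (pl l) (par l (root7 (l * (1 + l)^2)))" unfolding pl_def by (rule par_upar[OF assms y])
qed

definition special :: "cp2 \<Rightarrow> bool" where "special P \<longleftrightarrow> P = ptA \<or> P = ptB \<or> P = ptC"

lemma not_special: "\<not> special P \<longleftrightarrow> P \<noteq> ptA \<and> P \<noteq> ptB \<and> P \<noteq> ptC"
  by (auto simp: special_def)

text \<open>The bound 6 lies just below the ramification index 7 of phi at the vertices: seen from
  the quotient, the pole has order less than one.\<close>

locale invariant_function =
  fixes u :: "cp2 \<Rightarrow> complex"
  assumes inv: "\<And>P i. P \<in> klein \<Longrightarrow> u (gact i P) = u P"
    and ord: "\<And>P \<gamma>. local_param klein P \<gamma> \<Longrightarrow> ordge (\<lambda>t. u (proj (\<gamma> t))) (if special P then -6 else 0)"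
begin

text \<open>\<open>U\<close> is u as a function on the sphere. The factor l (1 + l) makes the
  possible singularities at the branch values 0 and -1 tend to 0, and \<open>V\<close> replaces the
  arbitrary values of \<open>T\<close> by limits so that it can be entire.\<close>

definition "U l = u (pl l)"
definition "T l = l * (1 + l) * U l"
definition "V l = Lim (at l) T"

lemma u_eq_U: assumes "P \<in> klein" "\<not> special P" shows "u P = U (phi P)"
proof -
  obtain y where y: "phi P \<noteq> 0" "1 + phi P \<noteq> 0"
    by (rule klein_generic[OF assms(1)]) (use assms(2) not_special in auto)
  note p = pl[OF y]
  obtain i where "P = gact i (pl (phi P))"
    using phi_fibre[OF p(2-5) assms(1)] assms(2) p(1) not_special by auto
  then show ?thesis using inv[OF p(2), of i] by (simp add: U_def)
qed

lemma U_along: assumes "local_param klein P \<gamma>"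
  shows "\<forall>\<^sub>F t in at 0. u (proj (\<gamma> t)) = U (phi (proj (\<gamma> t)))"
  using local_param_eventually[OF assms] by eventually_elim (auto intro!: u_eq_U simp: special_def)

text \<open>Away from the branch values phi - l is a local coordinate, so the local expression of u
  is already one of \<open>U\<close>.\<close>

lemma U_generic:
  assumes "l \<noteq> 0" "1 + l \<noteq> 0"
  obtains A where "A analytic_on {l}" "\<forall>\<^sub>F x in at l. T x = A x"
proof -
  let ?g = "par l (root7 (l * (1 + l)^2))"
  note p = pl[OF assms]
  have lp: "local_param klein (pl l) ?g" by (rule upar_local_param[OF p(6)])
  have "\<not> special (pl l)" using p not_special by blast
  then obtain a where a: "a analytic_on {0}" "\<forall>\<^sub>F t in at 0. u (proj (?g t)) = a t"
    using ord[OF lp] by (auto simp: ordge_def)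
  have y: "root7 (l * (1 + l)^2) ^ 7 = l * (1 + l)^2" using assms by (simp add: root7_pow)
  have "\<forall>\<^sub>F t in at 0. U (l + t) = a t"
    using a(2) U_along[OF lp] eventually_at_of_nhds[OF par_near[OF assms y]] by eventually_elim metis
  then have "\<forall>\<^sub>F x in at l. U x = a (x - l)" unfolding at_to_0[of l] eventually_filtermap by (simp add: add.commute)
  then have "\<forall>\<^sub>F x in at l. T x = x * (1 + x) * a (x - l)" by eventually_elim (simp add: T_def)
  moreover have "(\<lambda>x. a (x - l)) analytic_on {l}"
  proof -
    have "(\<lambda>x. x - l) analytic_on {l}" by (intro analytic_intros)
    from analytic_on_compose_gen[OF this a(1)] show ?thesis by (simp add: o_def)
  qed
  then have "(\<lambda>x. x * (1 + x) * a (x - l)) analytic_on {l}" by (intro analytic_intros)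
  ultimately show ?thesis using that by blast
qed

text \<open>\<open>T\<close> agrees with the continuous A on a punctured neighbourhood of l, hence
  near each point of it; the limits defining \<open>V\<close> therefore equal A there and at
  l.\<close>

lemma V_eq: assumes "A analytic_on {l}" "\<forall>\<^sub>F x in at l. T x = A x" shows "\<forall>\<^sub>F x in nhds l. V x = A x"
proof -
  have V: "V x = A x" if "isCont A x" "\<forall>\<^sub>F y in at x. T y = A y" for x
  proof -
    have "(T \<longlongrightarrow> A x) (at x)" using that tendsto_cong[OF that(2)] by (simp add: isCont_def)
    then show ?thesis unfolding V_def by (intro tendsto_Lim) auto
  qed
  have c: "\<forall>\<^sub>F x in nhds l. isCont A x"
  proof -
    obtain S where S: "open S" "l \<in> S" "A holomorphic_on S" using assms(1) by (auto simp: analytic_at)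
    then have "\<forall>\<^sub>F x in nhds l. x \<in> S" by (simp add: eventually_nhds_in_open)
    then show ?thesis
      by eventually_elim (use S holomorphic_on_imp_continuous_on continuous_on_eq_continuous_at in blast)
  qed
  have ca: "\<forall>\<^sub>F x in at l. isCont A x"
    unfolding eventually_at_filter using c by eventually_elim simp
  have va: "\<forall>\<^sub>F x in at l. V x = A x"
    using eventually_at_nhds[OF assms(2)] ca
  proof eventually_elim
    case (elim x)
    have "\<forall>\<^sub>F y in at x. T y = A y"
      unfolding eventually_at_filter using elim(1) by eventually_elim simp
    then show ?case using V elim(2) by blast
  qed
  have vl: "V l = A l" using V[OF eventually_nhds_x_imp_x[OF c] assms(2)] .
  show ?thesis using va unfolding eventually_at_filter
  proof eventually_elim
    case (elim x) then show ?case using vl by (cases "x = l") auto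
  qed
qed

text \<open>Here q inverts the expression h of phi along the parameter, and w is the factor in front
  of \<open>U\<close> rewritten in t. Its order 7 beats a pole of order 6. The argument Z lets the
  lemma serve for \<open>T\<close> and for \<open>T l / l^3\<close>.\<close>

lemma T_limit_transfer:
  fixes F :: "complex filter"
  assumes u: "local_param klein P \<gamma>" and q: "filterlim q (at 0) F"
    and h: "\<forall>\<^sub>F t in at 0. phi (proj (\<gamma> t)) = h t" and hq: "\<forall>\<^sub>F l in F. h (q l) = l"
    and w: "ordge w 7" and Z: "\<forall>\<^sub>F l in F. Z (T l) l = w (q l) * U l"
  shows "((\<lambda>l. Z (T l) l) \<longlongrightarrow> 0) F"
proof -
  have "ordge (\<lambda>t. u (proj (\<gamma> t))) (-6)" using ord[OF u] ordge_mono[of _ 0 "-6"] by (auto split: if_splits)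
  from ordge_mult[OF w this] have o: "ordge (\<lambda>t. w t * u (proj (\<gamma> t))) 1" by simp
  have "((\<lambda>t. w t * u (proj (\<gamma> t))) \<longlongrightarrow> 0) (at 0)" by (rule ordge_tendsto_0[OF o]) simp
  moreover have "\<forall>\<^sub>F t in at 0. w t * u (proj (\<gamma> t)) = w t * U (h t)"
    using h U_along[OF u] by eventually_elim simp
  ultimately have "((\<lambda>t. w t * U (h t)) \<longlongrightarrow> 0) (at 0)" using tendsto_cong by fast
  from filterlim_compose[OF this q] have "((\<lambda>l. w (q l) * U (h (q l))) \<longlongrightarrow> 0) F" .
  moreover have "\<forall>\<^sub>F l in F. w (q l) * U (h (q l)) = Z (T l) l" using hq Z by eventually_elim simp
  ultimately show ?thesis using tendsto_cong by fast
qed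

section \<open>Limits at the three branch values\<close>

lemma T_0: "(T \<longlongrightarrow> 0) (at 0)"
proof -
  have "((\<lambda>l. T l) \<longlongrightarrow> 0) (at 0)"
  proof (rule T_limit_transfer[where Z = "\<lambda>t l. t"])
    show "local_param klein ptC parC" by (rule upar_local_param[OF parC_upar])
    show "filterlim (\<lambda>l. root7 l) (at 0) (at 0)"
      by (rule root7_filterlim[where f = "\<lambda>l. l"]) (auto simp: eventually_at_nonzero)
    show "\<forall>\<^sub>F t in at 0. phi (proj (parC t)) = t^7" by (rule phi_parC)
    show "\<forall>\<^sub>F l in at 0. root7 l ^ 7 = l"
      using eventually_at_nonzero by eventually_elim (simp add: root7_pow)
    show "ordge (\<lambda>t. t^7 * (1 + t^7)) 7"
    proof -
      have "(\<lambda>t::complex. 1 + t^7) analytic_on {0}" by (intro analytic_intros)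
      from ordge_mult[OF ordeq_ordge[OF ordeq_power[OF ordeq_ident, of 7]] ordge_analytic[OF this]] show ?thesis by simp
    qed
    show "\<forall>\<^sub>F l in at 0. T l = (root7 l ^ 7 * (1 + root7 l ^ 7)) * U l"
      using eventually_at_nonzero by eventually_elim (simp add: root7_pow T_def)
  qed
  then show ?thesis by simp
qed

lemma T_m1: "(T \<longlongrightarrow> 0) (at (-1))"
proof -
  have nz: "\<forall>\<^sub>F l in at (-1). l \<noteq> 0 \<and> 1 + l \<noteq> (0::complex)"
  proof -
    have "\<forall>\<^sub>F l in at (-1). l \<in> - {0::complex} - {-1}" by (rule eventually_at_in_open) auto
    then show ?thesis by eventually_elim (auto simp: add_eq_0_iff)
  qed
  have e7: "\<forall>\<^sub>F l in at (-1). root7 (- (1 + l) / l) ^ 7 = - (1 + l) / l"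
    using nz
  proof eventually_elim
    case (elim l)
    then have "- (1 + l) / l \<noteq> 0" by (simp only: divide_eq_0_iff neg_equal_0_iff_equal) blast
    then show ?case by (rule root7_pow)
  qed
  have "((\<lambda>l. T l) \<longlongrightarrow> 0) (at (-1))"
  proof (rule T_limit_transfer[where Z = "\<lambda>t l. t"])
    show "local_param klein ptA parA" by (rule upar_local_param[OF parA_upar])
    \<comment> \<open>Solving - 1 / (1 + t^7) = l gives t^7 = - (1 + l) / l.\<close>
    show "filterlim (\<lambda>l. root7 (- (1 + l) / l)) (at 0) (at (-1))"
    proof (rule root7_filterlim)
      have "((\<lambda>l. - (1 + l) / l) \<longlongrightarrow> - (1 + - 1) / - 1) (at (- 1 :: complex))" by (intro tendsto_intros) auto
      then show "((\<lambda>l. - (1 + l) / l) \<longlongrightarrow> 0) (at (- 1 :: complex))" by simp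
      show "\<forall>\<^sub>F l in at (-1). - (1 + l) / l \<noteq> (0::complex)"
        using nz by eventually_elim (simp only: divide_eq_0_iff neg_equal_0_iff_equal, blast)
    qed
    show "\<forall>\<^sub>F t in at 0. phi (proj (parA t)) = - inverse (1 + t^7)" by (rule phi_parA)
    show "\<forall>\<^sub>F l in at (-1). - inverse (1 + root7 (- (1 + l) / l) ^ 7) = l"
      using nz e7
    proof eventually_elim
      case (elim l)
      have "1 + - (1 + l) / l = - inverse l" using elim(1) by (simp add: field_simps)
      then show ?case unfolding elim(2) by simp
    qed
    \<comment> \<open>This is l (1 + l) in terms of t, since 1 + l = t^7 / (1 + t^7).\<close>
    show "ordge (\<lambda>t. - (t^7) * inverse (1 + t^7)^2) 7"
    proof -
      have "(\<lambda>t::complex. - (inverse (1 + t^7)^2)) analytic_on {0}" by (intro analytic_intros) auto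
      from ordge_mult[OF ordeq_ordge[OF ordeq_power[OF ordeq_ident, of 7]] ordge_analytic[OF this]] show ?thesis by simp
    qed
    show "\<forall>\<^sub>F l in at (-1). T l = (- (root7 (- (1 + l) / l) ^ 7) * inverse (1 + root7 (- (1 + l) / l) ^ 7)^2) * U l"
      using nz e7
    proof eventually_elim
      case (elim l)
      have "1 + - (1 + l) / l = - inverse l" using elim(1) by (simp add: field_simps)
      moreover have "- (- n / l) * inverse (- inverse l)^2 = l * n" for n
        using elim(1) by (simp add: power2_eq_square)
      ultimately have "- (- (1 + l) / l) * inverse (1 + - (1 + l) / l)^2 = l * (1 + l)" by (simp only:)
      then show ?case unfolding elim(2) T_def by simp
    qed
  qed
  then show ?thesis by simp
qed

lemma T_inf: "((\<lambda>l. T l / l^3) \<longlongrightarrow> 0) at_infinity"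
proof -
  have nz: "\<forall>\<^sub>F l in at_infinity. l \<noteq> 0 \<and> 1 + l \<noteq> (0::complex)"
    using eventually_not_equal_at_infinity[of 0] eventually_not_equal_at_infinity[of "-1::complex"]
    by eventually_elim (auto simp: add_eq_0_iff)
  have e7: "\<forall>\<^sub>F l in at_infinity. root7 (- inverse (1 + l)) ^ 7 = - inverse (1 + l)"
    using nz by eventually_elim (subst root7_pow; simp)
  show ?thesis
  proof (rule T_limit_transfer[where Z = "\<lambda>t l. t / l^3"])
    show "local_param klein ptB parB" by (rule upar_local_param[OF parB_upar])
    \<comment> \<open>Solving - 1 - 1 / t^7 = l gives t^7 = - 1 / (1 + l).\<close>
    show "filterlim (\<lambda>l. root7 (- inverse (1 + l))) (at 0) at_infinity"
    proof (rule root7_filterlim)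
      have "filterlim (\<lambda>l::complex. 1 + l) at_infinity at_infinity"
        by (rule tendsto_add_filterlim_at_infinity[OF tendsto_const filterlim_ident])
      from filterlim_compose[OF tendsto_inverse_0 this]
      have "((\<lambda>l::complex. - inverse (1 + l)) \<longlongrightarrow> - 0) at_infinity" by (intro tendsto_minus)
      then show "((\<lambda>l::complex. - inverse (1 + l)) \<longlongrightarrow> 0) at_infinity" by simp
      show "\<forall>\<^sub>F l in at_infinity. - inverse (1 + l) \<noteq> (0::complex)"
        using nz by eventually_elim simp
    qed
    show "\<forall>\<^sub>F t in at 0. phi (proj (parB t)) = - 1 - inverse (t^7)" by (rule phi_parB)
    show "\<forall>\<^sub>F l in at_infinity. - 1 - inverse (root7 (- inverse (1 + l)) ^ 7) = l"
      using nz e7 by eventually_elim simp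
    \<comment> \<open>This is l (1 + l) / l^3 in terms of t, since l = - (1 + t^7) / t^7; the
      division by l^3 is what produces order 7.\<close>
    show "ordge (\<lambda>t. - (t^7) * inverse (1 + t^7)^2) 7"
    proof -
      have "(\<lambda>t::complex. - (inverse (1 + t^7)^2)) analytic_on {0}" by (intro analytic_intros) auto
      from ordge_mult[OF ordeq_ordge[OF ordeq_power[OF ordeq_ident, of 7]] ordge_analytic[OF this]] show ?thesis by simp
    qed
    show "\<forall>\<^sub>F l in at_infinity. T l / l^3 = (- (root7 (- inverse (1 + l)) ^ 7) * inverse (1 + root7 (- inverse (1 + l)) ^ 7)^2) * U l"
      using nz e7
    proof eventually_elim
      case (elim l)
      have "1 + - inverse (1 + l) = l / (1 + l)" using elim(1) by (simp add: field_simps)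
      moreover have "- (- inverse n) * inverse (l / n)^2 = l * n / l^3" if "n \<noteq> 0" for n
        using elim(1) that by (simp add: power2_eq_square power3_eq_cube)
      ultimately have "- (- inverse (1 + l)) * inverse (1 + - inverse (1 + l))^2 = l * (1 + l) / l^3"
        using elim(1) by simp
      then show ?case unfolding elim(2) T_def by simp
    qed
  qed
qed

lemma V_analytic: assumes "l \<noteq> 0" "1 + l \<noteq> 0" shows "V analytic_on {l}" "\<forall>\<^sub>F x in at l. T x = V x"
proof -
  obtain A where A: "A analytic_on {l}" "\<forall>\<^sub>F x in at l. T x = A x" by (rule U_generic[OF assms])
  note V = V_eq[OF A]
  have "\<forall>\<^sub>F x in nhds l. A x = V x" using V by eventually_elim simp
  from analytic_at_cong[OF this refl] show "V analytic_on {l}" using A(1) by simp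
  have "\<forall>\<^sub>F x in at l. V x = A x" unfolding eventually_at_filter using V by eventually_elim simp
  then show "\<forall>\<^sub>F x in at l. T x = V x" using A(2) by eventually_elim simp
qed

lemma V_eq_0: "(T \<longlongrightarrow> 0) (at l) \<Longrightarrow> V l = 0"
  unfolding V_def by (rule tendsto_Lim) simp

lemma T_tendsto_V: "(T \<longlongrightarrow> V l) (at l)"
proof -
  consider "l = 0" | "l = -1" | "l \<noteq> 0" "1 + l \<noteq> 0" by (cases "1 + l = 0") (auto simp: add_eq_0_iff)
  then show ?thesis
  proof cases
    case 1
    then show ?thesis using T_0 V_eq_0[OF T_0] by simp
  next
    case 2
    then show ?thesis using T_m1 V_eq_0[OF T_m1] by simp
  next
    case 3
    have "(V \<longlongrightarrow> V l) (at l)" using analytic_at_imp_isCont[OF V_analytic(1)[OF 3]] by (simp add: isCont_def)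
    then show ?thesis using tendsto_cong[OF V_analytic(2)[OF 3]] by simp
  qed
qed

section \<open>Passing from \<open>T\<close> to the entire function \<open>V\<close>\<close>

lemma V_bound:
  assumes "\<forall>\<^sub>F x in nhds l. x \<noteq> l \<longrightarrow> cmod (T x) \<le> e" shows "cmod (V l) \<le> e"
  by (rule tendsto_Lim_bound[OF T_tendsto_V]) (use assms in \<open>simp add: eventually_at_filter\<close>)

lemma V_tendsto_0: assumes "(T \<longlongrightarrow> 0) (at l)" shows "(V \<longlongrightarrow> 0) (at l)"
proof (rule tendstoI)
  fix e :: real assume e: "e > 0"
  then have "\<forall>\<^sub>F x in at l. dist (T x) 0 < e / 2" using assms by (intro tendstoD) auto
  from eventually_at_nhds[OF this] show "\<forall>\<^sub>F x in at l. dist (V x) 0 < e"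
  proof eventually_elim
    case (elim x)
    then have "\<forall>\<^sub>F y in nhds x. y \<noteq> x \<longrightarrow> cmod (T y) \<le> e / 2" by eventually_elim simp
    then have "cmod (V x) \<le> e / 2" by (rule V_bound)
    then show ?case using e by simp
  qed
qed

lemma V_holomorphic: "V holomorphic_on UNIV"
proof (rule no_isolated_singularity'[where K = "{0, -1}"])
  fix z :: complex assume "z \<in> {0, -1}"
  then have t: "(T \<longlongrightarrow> 0) (at z)" using T_0 T_m1 by blast
  show "(V \<longlongrightarrow> V z) (at z within UNIV)" unfolding V_eq_0[OF t] by (rule V_tendsto_0[OF t])
next
  have "V analytic_on UNIV - {0, -1}"
  proof (subst analytic_on_analytic_at, intro ballI)
    fix z :: complex assume "z \<in> UNIV - {0, -1}"
    then show "V analytic_on {z}" by (intro V_analytic(1)) (auto simp: add_eq_0_iff)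
  qed
  then show "V holomorphic_on UNIV - {0, -1}" by (rule analytic_imp_holomorphic)
qed auto

lemma V_inf: "((\<lambda>l. V l / l^3) \<longlongrightarrow> 0) at_infinity"
proof (rule tendstoI)
  fix e :: real assume e: "e > 0"
  then have "\<forall>\<^sub>F l in at_infinity. dist (T l / l^3) 0 < e / 2" using T_inf by (intro tendstoD) auto
  then obtain b where b: "\<And>l. b \<le> cmod l \<Longrightarrow> cmod (T l / l^3) < e / 2"
    unfolding eventually_at_infinity by auto
  have "cmod (V l / l^3) < e" if l: "max b 1 < cmod l" for l
  proof -
    have "((\<lambda>x. T x / x^3) \<longlongrightarrow> V l / l^3) (at l)"
      using l by (intro tendsto_intros T_tendsto_V) auto
    moreover have "\<forall>\<^sub>F x in at l. cmod (T x / x^3) \<le> e / 2"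
    proof -
      have "open {x. max b 1 < cmod x}" by (intro open_Collect_less continuous_intros)
      then have "\<forall>\<^sub>F x in at l. x \<in> {x. max b 1 < cmod x} - {l}" using l by (intro eventually_at_in_open) auto
      then show ?thesis
      proof eventually_elim
        case (elim x)
        then have "b \<le> cmod x" by simp
        from b[OF this] show ?case by simp
      qed
    qed
    ultimately have "cmod (V l / l^3) \<le> e / 2"
      by (rule tendsto_Lim_bound[where V = "\<lambda>x. V x / x^3"])
    then show ?thesis using e by simp
  qed
  moreover have "max b 1 < r" if "max b 1 + 1 \<le> r" for r :: real using that by linarith
  ultimately have "\<forall>x. max b 1 + 1 \<le> cmod x \<longrightarrow> cmod (V x / x^3) < e" by blast
  then show "\<forall>\<^sub>F l in at_infinity. dist (V l / l^3) 0 < e"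
    unfolding eventually_at_infinity dist_0_norm dist_commute[of _ 0] by blast
qed

text \<open>\<open>V\<close> is entire, vanishes at 0 and -1 and grows less than cubically, hence is
  a multiple of l (1 + l), and this factor cancels against the one in \<open>T\<close>.\<close>

lemma U_const: "\<exists>\<kappa>. \<forall>l. l \<noteq> 0 \<longrightarrow> 1 + l \<noteq> 0 \<longrightarrow> (\<forall>\<^sub>F x in at l. U x = \<kappa>)"
proof -
  obtain \<kappa> where "\<forall>l. V l = \<kappa> * (l * (1 + l))"
    using entire_subcubic[OF V_holomorphic V_eq_0[OF T_0] V_eq_0[OF T_m1] V_inf] ..
  then have k: "V l = \<kappa> * (l * (1 + l))" for l by blast
  have "\<forall>\<^sub>F x in at l. U x = \<kappa>" if l: "l \<noteq> 0" "1 + l \<noteq> 0" for l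
  proof -
    have "open (- {0, -1 :: complex})" by (intro open_Compl finite_imp_closed) simp
    moreover have "l \<in> - {0, -1}" using l by auto
    ultimately have "\<forall>\<^sub>F x in at l. x \<in> - {0, -1} - {l}" by (rule eventually_at_in_open)
    then show ?thesis using V_analytic(2)[OF l]
    proof eventually_elim
      case (elim x)
      then have "x \<noteq> 0" "1 + x \<noteq> 0" by (auto simp: add_eq_0_iff)
      then show ?case using elim(2) by (simp add: T_def k mult.commute[of \<kappa>])
    qed
  qed
  then show ?thesis by blast
qed

text \<open>At a nearby point of the arc, phi is continuous and not constant, so constancy of
  \<open>U\<close> off its base value gives constancy of u off that point. Analyticity of u along
  the arc recovers the value at the point itself.\<close>

lemma const:
  "\<exists>\<kappa>. \<forall>P \<gamma>. local_param klein P \<gamma> \<longrightarrow> (\<forall>\<^sub>F t in at 0. u (proj (\<gamma> t)) = \<kappa>)"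
proof -
  obtain \<kappa> where k: "\<forall>l. l \<noteq> 0 \<longrightarrow> 1 + l \<noteq> 0 \<longrightarrow> (\<forall>\<^sub>F x in at l. U x = \<kappa>)" using U_const ..
  have "\<forall>\<^sub>F t in at 0. u (proj (\<gamma> t)) = \<kappa>" if lp: "local_param klein P \<gamma>" for P \<gamma>
    using local_param_shift[OF lp] local_param_eventually[OF lp] mero_analytic_near[OF ordge_mero[OF ord[OF lp]]]
  proof eventually_elim
    case (elim t0)
    define \<delta> where "\<delta> t = \<gamma> (t0 + t)" for t
    have d: "local_param klein (proj (\<gamma> t0)) \<delta>" using elim(1) by (simp add: \<delta>_def[abs_def])
    have g: "proj (\<gamma> t0) \<in> klein" "proj (\<gamma> t0) \<noteq> ptA" "proj (\<gamma> t0) \<noteq> ptB" "proj (\<gamma> t0) \<noteq> ptC"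
      using elim(2) by auto
    have l: "phi (proj (\<gamma> t0)) \<noteq> 0" "1 + phi (proj (\<gamma> t0)) \<noteq> 0" using klein_generic[OF g] by blast+
    define l where "l = phi (proj (\<gamma> t0))"
    have "isCont (\<lambda>t. phi (proj (\<delta> t))) 0"
    proof -
      have "ox (proj (\<gamma> t0)) = 0" "oy (proj (\<gamma> t0)) = 0" "oz (proj (\<gamma> t0)) = 0"
        using g by (auto simp: ox_def oy_def oz_def)
      have nz: "\<delta> 0 $ 3 \<noteq> 0" using elim(2) by (simp add: \<delta>_def)
      have k: "karc \<delta>" using d by (simp add: local_param_iff)
      have "(\<lambda>t. \<delta> t $ 1^2 * \<delta> t $ 2 / \<delta> t $ 3^3) analytic_on {0}"
        using k nz by (auto simp: karc_def intro!: analytic_intros)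
      moreover have pe: "\<forall>\<^sub>F t in nhds 0. \<delta> t $ 1^2 * \<delta> t $ 2 / \<delta> t $ 3^3 = phi (proj (\<delta> t))"
        using karc_eventually_klein[OF k] by eventually_elim (simp add: phi_proj)
      ultimately have "(\<lambda>t. phi (proj (\<delta> t))) analytic_on {0}"
        by (simp only: analytic_at_cong[OF pe refl])
      then show ?thesis by (rule analytic_at_imp_isCont)
    qed
    then have "((\<lambda>t. phi (proj (\<delta> t))) \<longlongrightarrow> l) (at 0)" by (simp add: isCont_def l_def \<delta>_def)
    moreover have "\<forall>\<^sub>F t in at 0. phi (proj (\<delta> t)) \<noteq> l" by (rule phi_not_eventually_const[OF d])
    ultimately have f: "filterlim (\<lambda>t. phi (proj (\<delta> t))) (at l) (at 0)" by (simp add: filterlim_at)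
    have "\<forall>\<^sub>F x in at l. U x = \<kappa>" using k l by (simp add: l_def)
    then have "\<forall>\<^sub>F t in at 0. U (phi (proj (\<delta> t))) = \<kappa>"
      using f by (rule eventually_compose_filterlim)
    then have e: "\<forall>\<^sub>F t in at 0. u (proj (\<delta> t)) = \<kappa>"
      using U_along[OF d] by eventually_elim simp
    have "(\<lambda>t. u (proj (\<delta> t))) analytic_on {0}"
      unfolding \<delta>_def by (rule analytic_shift[OF elim(3)])
    then have "((\<lambda>t. u (proj (\<delta> t))) \<longlongrightarrow> u (proj (\<delta> 0))) (at 0)"
      using analytic_at_imp_isCont unfolding isCont_def by blast
    then have "((\<lambda>_. \<kappa>) \<longlongrightarrow> u (proj (\<delta> 0))) (at (0::complex))" using tendsto_cong[OF e] by simp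
    from tendsto_unique[OF _ this tendsto_const] show ?case by (simp add: \<delta>_def)
  qed
  then show ?thesis by blast
qed

end

section \<open>Sections of the canonical class\<close>

lemma cmono_gact: assumes "i + j + l = 0"
  shows "cmono i j l (gact 1 P) = zeta powi (4 * i + 2 * j + l) * cmono i j l P"
proof -
  obtain v where v: "v \<noteq> 0" "P = proj v" by (rule proj_cases)
  have z: "(zeta ^ (4 * 1)) powi i * (zeta ^ (2 * 1)) powi j * (zeta ^ 1) powi l = zeta powi (4 * i + 2 * j + l)"
    by (simp add: power_int_add power_int_mult)
  have "cmono i j l (gact 1 P) = (zeta ^ (4 * 1) * v$1) powi i * (zeta ^ (2 * 1) * v$2) powi j * (zeta ^ 1 * v$3) powi l"
    unfolding v(2) gact_proj[OF v(1)] using v(1) assms by (subst cmono_proj) (auto simp: gM_nonzero gM_nth)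
  also have "\<dots> = ((zeta ^ (4 * 1)) powi i * (zeta ^ (2 * 1)) powi j * (zeta ^ 1) powi l) * cmono i j l P"
    unfolding v(2) cmono_proj[OF v(1) assms] power_int_mult_distrib by (simp only: mult_ac)
  finally show ?thesis unfolding z .
qed

lemma zeta_powi_7 [simp]: "zeta powi (7 * k) = 1"
  by (simp add: power_int_mult)

text \<open>The condition is div h + \<open>Dz\<close> \<ge> 0: such h are the sections of the
  canonical class divided by z.\<close>

locale canonical_section =
  fixes h :: "cp2 \<Rightarrow> complex"
  assumes h: "\<And>P \<gamma>. local_param klein P \<gamma> \<Longrightarrow> ordge (\<lambda>t. h (proj (\<gamma> t))) (- oz P)"
begin

text \<open>Seven times the projection to the eigenspace of eigenvalue zeta^k; the exponent 6 k i
  stands for - k i.\<close>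

definition "eig k P = (\<Sum>i<7. zeta ^ (6 * k * i) * h (gact i P))"

lemma eig_ord: assumes "local_param klein P \<gamma>" shows "ordge (\<lambda>t. eig k (proj (\<gamma> t))) (- oz P)"
proof -
  have "ordge (\<lambda>t. h (gact i (proj (\<gamma> t)))) (- oz P)" for i
  proof (rule ordge_cong)
    have l: "local_param klein (gact i P) (\<lambda>t. gM i *v \<gamma> t)"
      unfolding gact_def by (rule local_param_lin[OF F4sym_gM assms])
    have "oz (gact i P) = oz P" by (simp add: oz_def gact_abc)
    then show "ordge (\<lambda>t. h (proj (gM i *v \<gamma> t))) (- oz P)" using h[OF l] by simp
    show "\<forall>\<^sub>F t in at 0. h (gact i (proj (\<gamma> t))) = h (proj (gM i *v \<gamma> t))"
      using local_param_eventually[OF assms] by eventually_elim (simp add: gact_proj)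
  qed
  then show ?thesis unfolding eig_def by (intro ordge_sum ordge_cmult)
qed

lemma eig_gact: "eig k (gact 1 P) = zeta ^ k * eig k P"
proof -
  define f where "f i = zeta ^ (6 * k * i) * h (gact i P)" for i
  have f: "zeta ^ (6 * k * i) * h (gact i (gact 1 P)) = zeta ^ k * f (Suc i)" for i
  proof -
    have "zeta ^ k * zeta ^ (6 * k * Suc i) = zeta ^ (7 * k + 6 * k * i)" by (simp flip: power_add add: algebra_simps)
    also have "\<dots> = zeta ^ (6 * k * i)" by (simp add: power_add)
    finally show ?thesis by (simp add: f_def gact_add[symmetric] mult.assoc[symmetric])
  qed
  have f7: "f 7 = f 0"
    using zeta_7_mult[of "6 * k"] gact_7[of 1 P] by (simp add: f_def mult.commute)
  have "(\<Sum>i<7. f (Suc i)) = (\<Sum>i<7. f i)"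
    using f7 by (simp add: lessThan_nat_numeral lessThan_Suc eval_nat_numeral)
  then show ?thesis unfolding eig_def f f_def[symmetric] by (simp add: sum_distrib_left[symmetric])
qed

text \<open>Orthogonality of characters: for i other than 0 the inner sum over k is a full geometric
  sum of a nontrivial seventh root of unity.\<close>

lemma sum_eig: "(\<Sum>k<7. eig k P) = 7 * h P"
proof -
  have "(\<Sum>k<7. eig k P) = (\<Sum>i<7. (\<Sum>k<7. (zeta ^ (6 * i)) ^ k) * h (gact i P))"
    unfolding eig_def sum_distrib_right by (subst sum.swap) (simp add: power_mult[symmetric] mult_ac)
  also have "\<dots> = (\<Sum>i<7. if i = (0::nat) then 7 * h P else 0)"
  proof (rule sum.cong[OF refl])
    fix i :: nat assume i: "i \<in> {..<7}"
    show "(\<Sum>k<7. (zeta ^ (6 * i)) ^ k) * h (gact i P) = (if i = 0 then 7 * h P else 0)"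
    proof (cases "i = 0")
      case False
      define w where "w = zeta ^ (6 * i)"
      have "\<not> 7 dvd 6 * i"
      proof
        assume "7 dvd 6 * i"
        moreover have "coprime 7 (6::nat)" by (rule coprime_Suc_left_nat[of 6, simplified])
        ultimately have "7 dvd i" using coprime_dvd_mult_right_iff by blast
        then show False using i False by (auto dest: dvd_imp_le)
      qed
      then have "w \<noteq> 1" unfolding w_def zeta_power_eq_1_iff .
      moreover have "w ^ 7 = 1" unfolding w_def using zeta_7_mult[of "6 * i"] by (simp add: power_mult[symmetric] mult.commute)
      ultimately have "(\<Sum>k<7. w ^ k) = 0" by (simp add: geometric_sum)
      then show ?thesis using False by (simp add: w_def)
    qed simp
  qed
  also have "\<dots> = 7 * h P" by simp
  finally show ?thesis .
qed

text \<open>The monomial x^i y^j z^(- i - j) has eigenvalue zeta^(3 i + j), so dividing by it makes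
  \<open>eig k\<close> invariant. The three inequalities bound the order of the quotient below by -6
  at \<open>ptC\<close>, \<open>ptA\<close> and \<open>ptB\<close>. If 3 i + j is negative, the
  quotient vanishes at \<open>ptC\<close>, so its constant value is 0.\<close>

lemma eig_monomial:
  assumes k: "7 dvd int k - (3 * i + j)"
    and i: "3 * i + j \<le> 6" "2 * j - i \<le> 5" "- 2 * i - 3 * j \<le> 3"
  shows "\<exists>\<kappa>. (\<forall>P \<gamma>. local_param klein P \<gamma> \<longrightarrow>
      (\<forall>\<^sub>F t in at 0. eig k (proj (\<gamma> t)) = \<kappa> * cmono i j (- i - j) (proj (\<gamma> t)))) \<and> (3 * i + j < 0 \<longrightarrow> \<kappa> = 0)"
proof -
  define u where "u P = eig k P * cmono (- i) (- j) (i + j) P" for P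
  have s: "- i + - j + (i + j) = 0" "i + j + (- i - j) = 0" by auto
  obtain m where m: "int k - (3 * i + j) = 7 * m" using k by (rule dvdE)
  have u1: "u (gact 1 P) = u P" for P
  proof -
    have e: "int k + (4 * (- i) + 2 * (- j) + (i + j)) = 7 * m" using m by simp
    have "zeta powi int k * zeta powi (4 * (- i) + 2 * (- j) + (i + j)) = 1"
      unfolding power_int_add[OF disjI1[OF zeta_nonzero], symmetric] e by simp
    then have z: "zeta ^ k * zeta powi (4 * (- i) + 2 * (- j) + (i + j)) = 1" by (simp only: power_int_of_nat)
    have "u (gact 1 P) = (zeta ^ k * zeta powi (4 * (- i) + 2 * (- j) + (i + j))) * u P"
      unfolding u_def eig_gact cmono_gact[OF s(1)] by (simp only: mult_ac)
    then show ?thesis unfolding z by simp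
  qed
  have uinv: "u (gact n P) = u P" for n P
  proof (induction n)
    case (Suc n)
    have "u (gact (Suc n) P) = u (gact 1 (gact n P))" using gact_add[of 1 n P] by (simp only: plus_1_eq_Suc)
    then show ?case unfolding u1 Suc .
  qed simp
  have uo: "ordge (\<lambda>t. u (proj (\<gamma> t))) (- oz P + (- i * ox P + - j * oy P + (i + j) * oz P))"
    if l: "local_param klein P \<gamma>" for P \<gamma>
    unfolding u_def using ordge_mult[OF eig_ord[OF l] ordeq_ordge[OF cmono_ord[OF l s(1)]]] by (simp add: fun_expr_def)
  interpret invariant_function u
  proof
    fix P \<gamma> assume l: "local_param klein P \<gamma>"
    show "ordge (\<lambda>t. u (proj (\<gamma> t))) (if special P then - 6 else 0)"
      by (rule ordge_mono[OF uo[OF l]])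
        (use i in \<open>auto simp: special_def ox_def oy_def oz_def abc_distinct\<close>)
  qed (rule uinv)
  obtain \<kappa> where "\<forall>P \<gamma>. local_param klein P \<gamma> \<longrightarrow> (\<forall>\<^sub>F t in at 0. u (proj (\<gamma> t)) = \<kappa>)"
    using const ..
  then have c: "\<forall>\<^sub>F t in at 0. u (proj (\<gamma> t)) = \<kappa>" if "local_param klein P \<gamma>" for P \<gamma>
    using that by blast
  have "\<forall>\<^sub>F t in at 0. eig k (proj (\<gamma> t)) = \<kappa> * cmono i j (- i - j) (proj (\<gamma> t))"
    if l: "local_param klein P \<gamma>" for P \<gamma>
    using c[OF l] local_param_eventually[OF l]
  proof eventually_elim
    case (elim t)
    have nz: "\<gamma> t \<noteq> 0" "\<gamma> t $ 1 \<noteq> 0" "\<gamma> t $ 2 \<noteq> 0" "\<gamma> t $ 3 \<noteq> 0" using elim(2) by auto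
    have p: "x powi (- n) * x powi n = 1" if "x \<noteq> (0::complex)" for x n
      using that by (simp add: power_int_add[symmetric])
    have "cmono (- i) (- j) (i + j) (proj (\<gamma> t)) * cmono i j (- i - j) (proj (\<gamma> t)) =
      (\<gamma> t $ 1 powi (- i) * \<gamma> t $ 1 powi i) * (\<gamma> t $ 2 powi (- j) * \<gamma> t $ 2 powi j) *
      (\<gamma> t $ 3 powi (- (- i - j)) * \<gamma> t $ 3 powi (- i - j))"
      unfolding cmono_proj[OF nz(1) s(1)] cmono_proj[OF nz(1) s(2)] by (simp add: mult_ac add.commute)
    also have "\<dots> = 1" by (simp only: p[OF nz(2)] p[OF nz(3)] p[OF nz(4)] mult_1)
    finally have m1: "cmono (- i) (- j) (i + j) (proj (\<gamma> t)) * cmono i j (- i - j) (proj (\<gamma> t)) = 1" .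
    have "eig k (proj (\<gamma> t)) = u (proj (\<gamma> t)) * cmono i j (- i - j) (proj (\<gamma> t))"
      unfolding u_def mult.assoc m1 by simp
    then show ?case unfolding elim(1) .
  qed
  moreover have "\<kappa> = 0" if n: "3 * i + j < 0"
  proof -
    have l: "local_param klein ptC parC" by (rule upar_local_param[OF parC_upar])
    have "((\<lambda>t. u (proj (parC t))) \<longlongrightarrow> 0) (at 0)"
      by (rule ordge_tendsto_0[OF uo[OF l]]) (use n in \<open>simp add: ox_def oy_def oz_def abc_distinct\<close>)
    then have "((\<lambda>_. \<kappa>) \<longlongrightarrow> 0) (at (0::complex))" using tendsto_cong[OF c[OF l]] by simp
    then show ?thesis by (simp add: tendsto_const_iff)
  qed
  ultimately show ?thesis by blast
qed

lemma linear_form: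
  "\<exists>a. \<forall>P \<gamma>. local_param klein P \<gamma> \<longrightarrow> (\<forall>\<^sub>F t in at 0. h (proj (\<gamma> t)) = lform a (\<gamma> t) / \<gamma> t $ 3)"
proof -
  define E where "E k \<kappa> i j \<longleftrightarrow> (\<forall>P \<gamma>. local_param klein P \<gamma> \<longrightarrow>
      (\<forall>\<^sub>F t in at 0. eig k (proj (\<gamma> t)) = \<kappa> * cmono i j (- i - j) (proj (\<gamma> t))))" for k \<kappa> i j
  obtain k0 k1 k3 where k: "E 0 k0 0 0" "E 1 k1 0 1" "E 3 k3 1 0"
    using eig_monomial[of 0 0 0] eig_monomial[of 1 0 1] eig_monomial[of 3 1 0] by (auto simp: E_def)
  \<comment> \<open>For the remaining eigenvalues 2, 4, 5, 6 the weights 3 i + j are chosen as -5,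
    -3, -2, -8, all negative, which forces these components to vanish.\<close>
  have z: "E 2 0 (-2) 1" "E 4 0 (-1) 0" "E 5 0 (-1) 1" "E 6 0 (-3) 1"
    using eig_monomial[of 2 "-2" 1] eig_monomial[of 4 "-1" 0] eig_monomial[of 5 "-1" 1] eig_monomial[of 6 "-3" 1]
    by (auto simp: E_def)
  have "\<forall>\<^sub>F t in at 0. h (proj (\<gamma> t)) = lform (vector [k3/7, k1/7, k0/7]) (\<gamma> t) / \<gamma> t $ 3"
    if l: "local_param klein P \<gamma>" for P \<gamma>
    using k[unfolded E_def, rule_format, OF l] z[unfolded E_def, rule_format, OF l] local_param_eventually[OF l]
  proof eventually_elim
    case (elim t)
    have nz: "\<gamma> t \<noteq> 0" "\<gamma> t $ 3 \<noteq> 0" using elim(8) by auto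
    have "7 * h (proj (\<gamma> t)) = k0 + k1 * (\<gamma> t $ 2 / \<gamma> t $ 3) + k3 * (\<gamma> t $ 1 / \<gamma> t $ 3)"
      unfolding sum_eig[symmetric] using elim(1-7) nz
      by (simp add: lessThan_nat_numeral lessThan_Suc eval_nat_numeral cmono_proj power_int_minus divide_inverse)
    then show ?case using nz by (simp add: lform_def field_simps)
  qed
  then show ?thesis by blast
qed

end

section \<open>Automorphisms are linear\<close>

definition Aut :: "(cp2 \<Rightarrow> cp2) set" where "Aut = carrier (aut_group klein)"

lemma Aut_iff: "f \<in> Aut \<longleftrightarrow> f \<in> Bij klein \<and> holomorphic_map klein f \<and> holomorphic_map klein (inv_into klein f)"
  by (simp add: Aut_def aut_group_def)

lemma Aut_klein: "f \<in> Aut \<Longrightarrow> P \<in> klein \<Longrightarrow> f P \<in> klein"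
  by (auto simp: Aut_iff Bij_def bij_betw_def)

lemma Aut_inv: "f \<in> Aut \<Longrightarrow> P \<in> klein \<Longrightarrow> inv_into klein f (f P) = P"
  "f \<in> Aut \<Longrightarrow> P \<in> klein \<Longrightarrow> f (inv_into klein f P) = P"
  "f \<in> Aut \<Longrightarrow> P \<in> klein \<Longrightarrow> inv_into klein f P \<in> klein"
proof -
  assume f: "f \<in> Aut" and P: "P \<in> klein"
  then have b: "bij_betw f klein klein" by (simp add: Aut_iff Bij_def)
  show "inv_into klein f (f P) = P" by (rule bij_betw_inv_into_left[OF b P])
  show "f (inv_into klein f P) = P" by (rule bij_betw_inv_into_right[OF b P])
  show "inv_into klein f P \<in> klein" by (rule inv_into_into) (use b P in \<open>simp add: bij_betw_def\<close>)
qed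

lemma holomorphic_map_arc:
  assumes f: "holomorphic_map klein f" and l: "local_param klein P \<gamma>"
  obtains \<delta> where "karc \<delta>" "proj (\<delta> 0) = f P" "\<forall>\<^sub>F t in nhds 0. f (proj (\<gamma> t)) = proj (\<delta> t)"
proof -
  obtain r \<delta> where r: "r > 0" "holo_arc r \<delta>" "\<And>t. t \<in> ball 0 r \<Longrightarrow> f (proj (\<gamma> t)) = proj (\<delta> t)"
    using f[unfolded holomorphic_map_def, THEN conjunct2, THEN bspec, OF local_param_klein[OF l], rule_format, OF l] by blast
  have "\<forall>\<^sub>F t in nhds 0. t \<in> ball (0::complex) r" using r(1) by (intro eventually_nhds_in_open) auto
  then have e: "\<forall>\<^sub>F t in nhds 0. f (proj (\<gamma> t)) = proj (\<delta> t)" by eventually_elim (rule r(3))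
  have "karc \<gamma>" "proj (\<gamma> 0) = P" using l by (auto simp: local_param_iff)
  have nz: "\<delta> t \<noteq> 0" if "t \<in> ball 0 r" for t using r(2) that by (simp add: holo_arc_def)
  have "\<forall>\<^sub>F t in nhds 0. F4 (\<delta> t) = 0"
    using \<open>\<forall>\<^sub>F t in nhds 0. t \<in> ball 0 r\<close> e karc_eventually_klein[OF \<open>karc \<gamma>\<close>]
  proof eventually_elim
    case (elim t)
    have "f ` klein \<subseteq> klein" using f by (simp only: holomorphic_map_def)
    then have "f (proj (\<gamma> t)) \<in> klein" using elim(3) by blast
    then have "proj (\<delta> t) \<in> klein" using elim(2) by simp
    then show ?case using proj_in_klein_iff[OF nz[OF elim(1)]] by simp
  qed
  then have "karc \<delta>" unfolding karc_def using nz[of 0] r(1,2)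
    by (auto simp: holo_arc_def analytic_at_ball)
  moreover have "proj (\<delta> 0) = f P" using eventually_nhds_x_imp_x[OF e] \<open>proj (\<gamma> 0) = P\<close> by simp
  ultimately show ?thesis using e that by blast
qed

lemma analytic_filterlim_nhds:
  assumes "s analytic_on {0 :: complex}" "s 0 = (0 :: complex)" shows "filterlim s (nhds 0) (nhds 0)"
proof -
  have "(s \<longlongrightarrow> s 0) (at 0)" using analytic_at_imp_isCont[OF assms(1)] by (simp only: isCont_def)
  then have "(s \<longlongrightarrow> s 0) (nhds 0)" by (simp only: tendsto_at_iff_tendsto_nhds)
  then show ?thesis unfolding assms(2) .
qed

text \<open>A parameter factoring through s with \<open>deriv s 0 = 0\<close> would have derivative
  a multiple of its value, by \<open>vderiv_product\<close>.\<close>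

lemma not_immersive_compose:
  assumes l: "local_param klein P \<gamma>" and e: "karc \<epsilon>"
    and s: "s analytic_on {0}" "s 0 = 0" "deriv s 0 = 0"
    and eq: "\<forall>\<^sub>F t in nhds 0. proj (\<gamma> t) = proj (\<epsilon> (s t))"
  shows False
proof -
  have k: "karc \<gamma>" and im: "\<nexists>c. vderiv \<gamma> = c *s \<gamma> 0" using l by (auto simp: local_param_iff)
  obtain i where i: "\<epsilon> 0 $ i \<noteq> 0" using e by (auto simp: karc_def vec_eq_iff)
  have ea: "\<forall>i. (\<lambda>t. \<epsilon> t $ i) analytic_on {0}" and ga: "(\<lambda>t. \<gamma> t $ i) analytic_on {0}"
    using e k by (auto simp: karc_def)
  have esa: "(\<lambda>t. \<epsilon> (s t) $ i) analytic_on {0}" using analytic_compose_0[of "\<lambda>t. \<epsilon> t $ i" s] ea s by simp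
  define \<mu> where "\<mu> t = \<gamma> t $ i / \<epsilon> (s t) $ i" for t
  have mu: "\<mu> analytic_on {0}" unfolding \<mu>_def using ga esa i s(2) by (auto intro!: analytic_intros)
  have lim: "filterlim s (nhds 0) (nhds 0)"
    by (rule analytic_filterlim_nhds[OF s(1,2)])
  have ez: "\<forall>\<^sub>F t in nhds 0. \<epsilon> (s t) \<noteq> 0"
    by (rule eventually_compose_filterlim[OF karc_nonzero lim]) (use e in \<open>auto simp: karc_def\<close>)
  have "\<forall>\<^sub>F t in nhds 0. \<gamma> t = \<mu> t *s \<epsilon> (s t)"
    using eq ez karc_eventually_klein[OF k] analytic_eventually_nonzero[OF esa, unfolded s(2), OF i]
  proof eventually_elim
    case (elim t)
    obtain c where "\<gamma> t = c *s \<epsilon> (s t)" using proj_eq_iff[of "\<epsilon> (s t)" "\<gamma> t"] elim(1-3) by auto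
    then show ?case using elim(4) by (simp add: \<mu>_def)
  qed
  note eqn = this
  have "vderiv \<gamma> = deriv \<mu> 0 *s \<epsilon> 0" using vderiv_product[OF mu s(1,2) ea eqn] s(3) by simp
  moreover have g0: "\<gamma> 0 = \<mu> 0 *s \<epsilon> 0" using eventually_nhds_x_imp_x[OF eqn] s(2) by simp
  moreover have "\<mu> 0 \<noteq> 0" using g0 karc_at_0[OF k] by auto
  ultimately have "vderiv \<gamma> = (deriv \<mu> 0 / \<mu> 0) *s \<gamma> 0" by simp
  then show False using im by blast
qed

text \<open>The image arc factors as \<open>\<eta>\<close> composed with s. Applying the holomorphic
  inverse of f makes the original parameter factor through the same s, so \<open>deriv s 0\<close>
  is nonzero and the image arc is immersed.\<close>

lemma Aut_param:
  assumes f: "f \<in> Aut" and l: "local_param klein P \<gamma>"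
  obtains \<delta> where "local_param klein (f P) \<delta>" "\<forall>\<^sub>F t in nhds 0. f (proj (\<gamma> t)) = proj (\<delta> t)"
proof -
  have hf: "holomorphic_map klein f" "holomorphic_map klein (inv_into klein f)" using f by (auto simp: Aut_iff)
  have P: "P \<in> klein" by (rule local_param_klein[OF l])
  obtain \<delta> where d: "karc \<delta>" "proj (\<delta> 0) = f P" "\<forall>\<^sub>F t in nhds 0. f (proj (\<gamma> t)) = proj (\<delta> t)"
    by (rule holomorphic_map_arc[OF hf(1) l])
  obtain \<eta> where e: "upar (f P) \<eta>" by (rule upar_exists[OF Aut_klein[OF f P]])
  then obtain \<mu> s where m: "\<mu> analytic_on {0}" "\<mu> 0 \<noteq> 0" "s analytic_on {0}" "s 0 = 0"
    "\<forall>\<^sub>F t in nhds 0. \<delta> t = \<mu> t *s \<eta> (s t)"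
    using d(1,2) unfolding upar_def by blast
  have le: "local_param klein (f P) \<eta>" by (rule upar_local_param[OF e])
  have ke: "karc \<eta>" and ime: "\<nexists>c. vderiv \<eta> = c *s \<eta> 0" using le by (auto simp: local_param_iff)
  obtain \<epsilon> where ep: "karc \<epsilon>" "\<forall>\<^sub>F t in nhds 0. inv_into klein f (proj (\<eta> t)) = proj (\<epsilon> t)"
    by (rule holomorphic_map_arc[OF hf(2) le])
  have lim: "filterlim s (nhds 0) (nhds 0)"
    by (rule analytic_filterlim_nhds[OF m(3,4)])
  have ds: "deriv s 0 \<noteq> 0"
  proof
    assume "deriv s 0 = 0"
    moreover have "\<forall>\<^sub>F t in nhds 0. proj (\<gamma> t) = proj (\<epsilon> (s t))"
      using d(3) m(5) eventually_compose_filterlim[OF ep(2) lim] analytic_eventually_nonzero[OF m(1,2)]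
        karc_eventually_klein[OF d(1)] karc_eventually_klein[of \<gamma>, OF l[unfolded local_param_iff, THEN conjunct2, THEN conjunct1]]
    proof eventually_elim
      case (elim t)
      have nz: "\<eta> (s t) \<noteq> 0" using elim(2,5) by auto
      have "proj (\<delta> t) = proj (\<eta> (s t))" unfolding elim(2) by (rule proj_scale[OF nz elim(4)])
      then have "proj (\<epsilon> (s t)) = inv_into klein f (f (proj (\<gamma> t)))" using elim(1,3) by simp
      then show ?case using Aut_inv(1)[OF f] elim(6) by simp
    qed
    ultimately show False using not_immersive_compose[OF l ep(1) m(3,4)] by blast
  qed
  have "vderiv \<delta> \<noteq> c *s \<delta> 0" for c
  proof
    assume c: "vderiv \<delta> = c *s \<delta> 0"
    have "\<forall>i. (\<lambda>t. \<eta> t $ i) analytic_on {0}" using ke by (simp add: karc_def)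
    from vderiv_product[OF m(1,3,4) this m(5)]
    have vd: "vderiv \<delta> = deriv \<mu> 0 *s \<eta> 0 + (\<mu> 0 * deriv s 0) *s vderiv \<eta>" .
    have d0: "\<delta> 0 = \<mu> 0 *s \<eta> 0" using eventually_nhds_x_imp_x[OF m(5)] m(4) by simp
    have "vderiv \<eta> $ i = ((c * \<mu> 0 - deriv \<mu> 0) / (\<mu> 0 * deriv s 0)) * \<eta> 0 $ i" for i
    proof -
      have "deriv \<mu> 0 * \<eta> 0 $ i + \<mu> 0 * deriv s 0 * vderiv \<eta> $ i = c * (\<mu> 0 * \<eta> 0 $ i)"
        using arg_cong[OF c[unfolded vd d0], of "\<lambda>v. v $ i"] by simp
      then show ?thesis using m(2) ds by (simp add: field_simps)
    qed
    then have "vderiv \<eta> = ((c * \<mu> 0 - deriv \<mu> 0) / (\<mu> 0 * deriv s 0)) *s \<eta> 0" by (simp add: vec_eq_iff)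
    then show False using ime by blast
  qed
  then have "local_param klein (f P) \<delta>" using d by (auto simp: local_param_iff)
  then show ?thesis using that d(3) by blast
qed

text \<open>The pullback of divisors along f, the map that \<open>class_act\<close> applies to the
  representatives of a class.\<close>

definition pull :: "(cp2 \<Rightarrow> cp2) \<Rightarrow> (cp2 \<Rightarrow>\<^sub>0 int) \<Rightarrow> (cp2 \<Rightarrow>\<^sub>0 int)" where
  "pull f D = frag_extend (\<lambda>P. frag_of (inv_into klein f P)) D"

lemma lookup_pull:
  assumes f: "f \<in> Aut" and D: "Poly_Mapping.keys D \<subseteq> klein" and P: "P \<in> klein"
  shows "Poly_Mapping.lookup (pull f D) P = Poly_Mapping.lookup D (f P)"
proof -
  have "Poly_Mapping.lookup (pull f D) P =
      (\<Sum>Q\<in>Poly_Mapping.keys D. Poly_Mapping.lookup D Q * (if Q = f P then 1 else 0))"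
    unfolding pull_def frag_extend_def lookup_sum
  proof (rule sum.cong[OF refl])
    fix Q assume "Q \<in> Poly_Mapping.keys D"
    then have "Q \<in> klein" using D by blast
    then have e: "P = inv_into klein f Q \<longleftrightarrow> Q = f P" using Aut_inv[OF f] P by metis
    show "Poly_Mapping.lookup (frag_cmul (Poly_Mapping.lookup D Q) (frag_of (inv_into klein f Q))) P =
      Poly_Mapping.lookup D Q * (if Q = f P then 1 else 0)"
      by (simp only: lookup_frag_cmul lookup_frag_of e)
  qed
  also have "\<dots> = (\<Sum>Q\<in>Poly_Mapping.keys D. if Q = f P then Poly_Mapping.lookup D Q else 0)"
    by (rule sum.cong) auto
  also have "\<dots> = Poly_Mapping.lookup D (f P)" by (simp add: sum.delta in_keys_iff)
  finally show ?thesis .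
qed

lemma keys_pull: assumes "f \<in> Aut" "Poly_Mapping.keys D \<subseteq> klein" shows "Poly_Mapping.keys (pull f D) \<subseteq> klein"
proof -
  have "Poly_Mapping.keys (pull f D) \<subseteq> (\<Union>x \<in> Poly_Mapping.keys D. Poly_Mapping.keys (frag_of (inv_into klein f x)))"
    unfolding pull_def by (rule keys_frag_extend)
  also have "\<dots> \<subseteq> klein" using Aut_inv(3)[OF assms(1)] assms(2) by (auto simp: keys_frag_of)
  finally show ?thesis .
qed

lemma pull_diff: "pull f (D - E) = pull f D - pull f E" by (simp add: pull_def frag_extend_diff)
lemma fun_pull:
  assumes f: "f \<in> Aut" and h: "fdiv h D" shows "fdiv (\<lambda>P. h (f P)) (pull f D)"
proof (rule fdivI)
  show "Poly_Mapping.keys (pull f D) \<subseteq> klein" by (rule keys_pull[OF f has_divisor_keys[OF h]])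
  fix P \<gamma> assume l: "local_param klein P \<gamma>"
  obtain \<delta> where d: "local_param klein (f P) \<delta>" "\<forall>\<^sub>F t in nhds 0. f (proj (\<gamma> t)) = proj (\<delta> t)"
    by (rule Aut_param[OF f l])
  show "ordeq (\<lambda>t. h (f (proj (\<gamma> t)))) (Poly_Mapping.lookup (pull f D) P)"
  proof (rule ordeq_cong)
    show "\<forall>\<^sub>F t in at 0. h (f (proj (\<gamma> t))) = h (proj (\<delta> t))"
      using eventually_at_of_nhds[OF d(2)] by eventually_elim simp
    show "ordeq (\<lambda>t. h (proj (\<delta> t))) (Poly_Mapping.lookup (pull f D) P)"
      using fdivD[OF h d(1)] lookup_pull[OF f has_divisor_keys[OF h] local_param_klein[OF l]] by simp
  qed
qed

lemma PD_pull: "f \<in> Aut \<Longrightarrow> D \<in> PD \<Longrightarrow> pull f D \<in> PD"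
  using fun_pull unfolding PD_iff by blast

lemma meromorphic_fun_pull:
  assumes f: "f \<in> Aut" and h: "meromorphic_fun klein h" shows "meromorphic_fun klein (\<lambda>P. h (f P))"
  unfolding meromorphic_fun_def
proof (intro ballI allI impI)
  fix P \<gamma> assume l: "local_param klein P \<gamma>"
  obtain \<delta> where d: "local_param klein (f P) \<delta>" "\<forall>\<^sub>F t in nhds 0. f (proj (\<gamma> t)) = proj (\<delta> t)"
    by (rule Aut_param[OF f l])
  have "\<forall>\<^sub>F t in at 0. h (f (proj (\<gamma> t))) = h (proj (\<delta> t))"
    using eventually_at_of_nhds[OF d(2)] by eventually_elim simp
  then show "(\<lambda>t. h (f (proj (\<gamma> t)))) meromorphic_on {0}"
    using meromorphic_on_cong[of "{0}" "\<lambda>t. h (f (proj (\<gamma> t)))" "\<lambda>t. h (proj (\<delta> t))" "{0}"] meromorphic_funD[OF h d(1)] by simp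
qed

lemma f0_mero: "meromorphic_fun klein f0"
  unfolding meromorphic_fun_def using ordeq_mero(1)[OF f0_ord] by blast

text \<open>The pullback of the differential \<open>f0\<close> d phi is again a differential, and
  its divisor is the pullback of \<open>Dz\<close>.\<close>

lemma pull_Dz: assumes f: "f \<in> Aut" shows "pull f Dz - Dz \<in> PD"
proof -
  have "has_divisor klein (form_expr (\<lambda>P. f0 (f P)) (\<lambda>P. phi (f P))) (pull f Dz)"
    unfolding has_divisor_iff
  proof (intro conjI ballI allI impI)
    show "Poly_Mapping.keys (pull f Dz) \<subseteq> klein" by (rule keys_pull[OF f keys_Dz])
    fix P \<gamma> assume l: "local_param klein P \<gamma>"
    obtain \<delta> where d: "local_param klein (f P) \<delta>" "\<forall>\<^sub>F t in nhds 0. f (proj (\<gamma> t)) = proj (\<delta> t)"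
      by (rule Aut_param[OF f l])
    show "ordeq (form_expr (\<lambda>P. f0 (f P)) (\<lambda>P. phi (f P)) \<gamma>) (Poly_Mapping.lookup (pull f Dz) P)"
    proof (rule ordeq_cong)
      show "\<forall>\<^sub>F t in at 0. form_expr (\<lambda>P. f0 (f P)) (\<lambda>P. phi (f P)) \<gamma> t =
          f0 (proj (\<delta> t)) * deriv (\<lambda>t. phi (proj (\<delta> t))) t"
        using eventually_at_nhds[OF eventually_at_of_nhds[OF d(2)]] eventually_at_of_nhds[OF d(2)]
      proof eventually_elim
        case (elim t)
        have "\<forall>\<^sub>F x in nhds t. phi (f (proj (\<gamma> x))) = phi (proj (\<delta> x))" using elim(1) by eventually_elim simp
        from deriv_cong_ev[OF this refl] show ?case using elim(2) by (simp add: form_expr_def)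
      qed
      show "ordeq (\<lambda>t. f0 (proj (\<delta> t)) * deriv (\<lambda>t. phi (proj (\<delta> t))) t) (Poly_Mapping.lookup (pull f Dz) P)"
        using f0_dphi_ord[OF d(1)] lookup_pull[OF f keys_Dz local_param_klein[OF l]] by (simp add: lookup_Dz)
    qed
  qed
  then have "pull f Dz \<in> canonical_class klein"
    unfolding canonical_class_def
    using meromorphic_fun_pull[OF f f0_mero] meromorphic_fun_pull[OF f meromorphic_fun_phi] by blast
  then show ?thesis unfolding canonical_class_eq mem_divisor_class .
qed

lemma analytic_zero_limit:
  assumes "w analytic_on {0 :: complex}" "\<forall>\<^sub>F t in at 0. w t = (0 :: complex)" shows "w 0 = 0"
proof -
  have "(w \<longlongrightarrow> w 0) (at 0)" using analytic_at_imp_isCont[OF assms(1)] by (simp only: isCont_def)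
  then have "((\<lambda>_. 0) \<longlongrightarrow> w 0) (at (0::complex))" using tendsto_cong[OF assms(2)] by simp
  then show ?thesis by (simp add: tendsto_const_iff)
qed

lemma invertible_of_lform:
  fixes M :: "complex^3^3"
  assumes "\<And>u. u \<noteq> 0 \<Longrightarrow> \<exists>v. lform u (M *v v) \<noteq> 0"
  shows "invertible M"
proof -
  have "u = 0" if u: "transpose M *v u = 0" for u
  proof (rule ccontr)
    assume "u \<noteq> 0"
    then obtain v where v: "lform u (M *v v) \<noteq> 0" using assms by blast
    have "lform u (M *v v) = lform (transpose M *v u) v"
      by (simp add: lform_def matrix_vector_mult_def sum_3 transpose_def algebra_simps)
    then show False using v u by (simp add: lform_def)
  qed
  then have "\<exists>B. B ** transpose M = mat 1" unfolding matrix_left_invertible_ker by blast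
  then obtain B where B: "B ** transpose M = mat 1" by blast
  then have "transpose (B ** transpose M) = (mat 1 :: complex^3^3)" by simp
  then have "M ** transpose B = mat 1" by (simp add: matrix_transpose_mul)
  then show ?thesis unfolding invertible_right_inverse by blast
qed

lemma lform_rows:
  "(vector [a, b, c] :: complex^3^3) *v v = vector [lform a v, lform b v, lform c v]"
  by (simp add: vec3_eq_iff matrix_vector_mult_def sum_3 lform_def)

text \<open>With s of divisor f^* \<open>Dz\<close> - \<open>Dz\<close>, the products of s with the
  pulled back functions x/z, y/z and 1 have poles bounded by \<open>Dz\<close>. They are thus linear
  forms over z, and f is given by the matrix of these three forms.\<close>

theorem Aut_linear: assumes f: "f \<in> Aut"
  shows "\<exists>M. invertible M \<and> (\<forall>P\<in>klein. f P = lin M P)"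
proof -
  obtain s where s: "fdiv s (pull f Dz - Dz)" using pull_Dz[OF f] unfolding PD_iff by blast
  have sec: "\<exists>a. \<forall>P \<gamma>. local_param klein P \<gamma> \<longrightarrow>
      (\<forall>\<^sub>F t in at 0. s (proj (\<gamma> t)) * cmono i j l (f (proj (\<gamma> t))) = lform a (\<gamma> t) / \<gamma> t $ 3)"
    if ijl: "i + j + l = 0" "i \<ge> 0" "j \<ge> 0" "l \<ge> -1" for i j l
  proof (rule canonical_section.linear_form)
    show "canonical_section (\<lambda>P. s P * cmono i j l (f P))"
    proof
      fix P \<gamma> assume lp: "local_param klein P \<gamma>"
      obtain \<delta> where d: "local_param klein (f P) \<delta>" "\<forall>\<^sub>F t in nhds 0. f (proj (\<gamma> t)) = proj (\<delta> t)"
        by (rule Aut_param[OF f lp])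
      have c: "ordge (\<lambda>t. cmono i j l (f (proj (\<gamma> t)))) (- oz (f P))"
      proof (rule ordge_cong)
        show "\<forall>\<^sub>F t in at 0. cmono i j l (f (proj (\<gamma> t))) = cmono i j l (proj (\<delta> t))"
          using eventually_at_of_nhds[OF d(2)] by eventually_elim simp
        have "ordge (\<lambda>t. cmono i j l (proj (\<delta> t))) (i * ox (f P) + j * oy (f P) + l * oz (f P))"
          using ordeq_ordge[OF cmono_ord[OF d(1) ijl(1)]] by (simp add: fun_expr_def[abs_def])
        moreover have "- oz (f P) \<le> i * ox (f P) + j * oy (f P) + l * oz (f P)"
        proof -
          have "0 \<le> i * ox (f P)" "0 \<le> j * oy (f P)" "(-1) * oz (f P) \<le> l * oz (f P)"
            using ijl by (auto simp: ox_def oy_def oz_def)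
          then show ?thesis by linarith
        qed
        ultimately show "ordge (\<lambda>t. cmono i j l (proj (\<delta> t))) (- oz (f P))" by (rule ordge_mono)
      qed
      have "Poly_Mapping.lookup (pull f Dz - Dz) P = oz (f P) - oz P"
        unfolding lookup_minus lookup_pull[OF f keys_Dz local_param_klein[OF lp]] lookup_Dz ..
      then have "ordge (\<lambda>t. s (proj (\<gamma> t))) (oz (f P) - oz P)"
        using ordeq_ordge[OF fdivD[OF s lp]] by simp
      from ordge_mult[OF this c] show "ordge (\<lambda>t. s (proj (\<gamma> t)) * cmono i j l (f (proj (\<gamma> t)))) (- oz P)" by simp
    qed
  qed
  obtain a where a: "\<forall>P \<gamma>. local_param klein P \<gamma> \<longrightarrow>
      (\<forall>\<^sub>F t in at 0. s (proj (\<gamma> t)) * cmono 1 0 (-1) (f (proj (\<gamma> t))) = lform a (\<gamma> t) / \<gamma> t $ 3)"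
    using sec[of 1 0 "-1"] by auto
  obtain b where b: "\<forall>P \<gamma>. local_param klein P \<gamma> \<longrightarrow>
      (\<forall>\<^sub>F t in at 0. s (proj (\<gamma> t)) * cmono 0 1 (-1) (f (proj (\<gamma> t))) = lform b (\<gamma> t) / \<gamma> t $ 3)"
    using sec[of 0 1 "-1"] by auto
  obtain c where c: "\<forall>P \<gamma>. local_param klein P \<gamma> \<longrightarrow>
      (\<forall>\<^sub>F t in at 0. s (proj (\<gamma> t)) * cmono 0 0 0 (f (proj (\<gamma> t))) = lform c (\<gamma> t) / \<gamma> t $ 3)"
    using sec[of 0 0 0] by auto
  define M where "M = (vector [a, b, c] :: complex^3^3)"
  have M: "\<forall>\<^sub>F t in at 0. \<exists>k. k \<noteq> 0 \<and> M *v \<gamma> t = k *s \<delta> t"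
    if lp: "local_param klein P \<gamma>" and d: "local_param klein (f P) \<delta>" "\<forall>\<^sub>F t in nhds 0. f (proj (\<gamma> t)) = proj (\<delta> t)"
    for P \<gamma> \<delta>
    using a[rule_format, OF lp] b[rule_format, OF lp] c[rule_format, OF lp] local_param_eventually[OF lp]
      local_param_eventually[OF d(1)] eventually_at_of_nhds[OF d(2)] ordeq_eventually_nonzero[OF fdivD[OF s lp]]
  proof eventually_elim
    case (elim t)
    have g3: "\<gamma> t $ 3 \<noteq> 0" and dn: "\<delta> t \<noteq> 0" "\<delta> t $ 3 \<noteq> 0" using elim(4,5) by auto
    have C: "cmono 1 0 (-1) (f (proj (\<gamma> t))) = \<delta> t $ 1 / \<delta> t $ 3" "cmono 0 1 (-1) (f (proj (\<gamma> t))) = \<delta> t $ 2 / \<delta> t $ 3"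
      "cmono 0 0 0 (f (proj (\<gamma> t))) = 1"
      unfolding elim(6) using dn(1) by (simp_all add: cmono_proj power_int_minus divide_inverse)
    have L: "lform a (\<gamma> t) = s (proj (\<gamma> t)) * (\<delta> t $ 1 / \<delta> t $ 3) * \<gamma> t $ 3"
      "lform b (\<gamma> t) = s (proj (\<gamma> t)) * (\<delta> t $ 2 / \<delta> t $ 3) * \<gamma> t $ 3"
      "lform c (\<gamma> t) = s (proj (\<gamma> t)) * 1 * \<gamma> t $ 3"
      unfolding elim(1-3)[unfolded C] using g3 by simp_all
    have "M *v \<gamma> t = (s (proj (\<gamma> t)) * \<gamma> t $ 3 / \<delta> t $ 3) *s \<delta> t"
      unfolding M_def lform_rows L using dn(2) by (simp add: vec3_eq_iff)
    then show ?case using elim(7) g3 dn(2) by (intro exI[of _ "s (proj (\<gamma> t)) * \<gamma> t $ 3 / \<delta> t $ 3"]) auto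
  qed
  \<comment> \<open>If M were singular, the image of an arc would lie on a line, against
    \<open>lform_eventually_nonzero\<close>.\<close>
  have inv: "invertible M"
  proof (rule invertible_of_lform)
    fix u :: "complex^3" assume u: "u \<noteq> 0"
    have lp: "local_param klein ptC parC" by (rule upar_local_param[OF parC_upar])
    obtain \<delta> where d: "local_param klein (f ptC) \<delta>" "\<forall>\<^sub>F t in nhds 0. f (proj (parC t)) = proj (\<delta> t)"
      by (rule Aut_param[OF f lp])
    have "\<forall>\<^sub>F t in at 0. lform u (M *v parC t) \<noteq> 0"
      using M[OF lp d] lform_eventually_nonzero[OF u d(1)] by eventually_elim (auto simp: lform_scale)
    then show "\<exists>v. lform u (M *v v) \<noteq> 0" using eventually_happens trivial_limit_at by blast
  qed
  moreover have "f P = lin M P" if P: "P \<in> klein" for P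
  proof -
    obtain \<gamma> where g: "upar P \<gamma>" by (rule upar_exists[OF P])
    have lp: "local_param klein P \<gamma>" by (rule upar_local_param[OF g])
    obtain \<delta> where d: "local_param klein (f P) \<delta>" "\<forall>\<^sub>F t in nhds 0. f (proj (\<gamma> t)) = proj (\<delta> t)"
      by (rule Aut_param[OF f lp])
    have an: "(\<lambda>t. (M *v \<gamma> t) $ i) analytic_on {0}" "(\<lambda>t. \<delta> t $ i) analytic_on {0}" for i
      using lp d(1) by (auto simp: local_param_iff karc_def intro!: analytic_lin)
    \<comment> \<open>Proportionality is known for small nonzero t only; written as vanishing of
      analytic cross products it extends to t = 0.\<close>
    have cr: "(M *v \<gamma> 0) $ i * \<delta> 0 $ j - (M *v \<gamma> 0) $ j * \<delta> 0 $ i = 0" for i j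
    proof (rule analytic_zero_limit[where w = "\<lambda>t. (M *v \<gamma> t) $ i * \<delta> t $ j - (M *v \<gamma> t) $ j * \<delta> t $ i"])
      show "(\<lambda>t. (M *v \<gamma> t) $ i * \<delta> t $ j - (M *v \<gamma> t) $ j * \<delta> t $ i) analytic_on {0}"
        by (intro analytic_intros an)
      show "\<forall>\<^sub>F t in at 0. (M *v \<gamma> t) $ i * \<delta> t $ j - (M *v \<gamma> t) $ j * \<delta> t $ i = 0"
        using M[OF lp d] by eventually_elim auto
    qed
    have g0: "\<gamma> 0 \<noteq> 0" "proj (\<gamma> 0) = P" "\<delta> 0 \<noteq> 0" "proj (\<delta> 0) = f P"
      using lp d(1) by (auto simp: local_param_iff karc_def)
    have "M *v \<gamma> 0 \<noteq> 0" using inv g0(1) by (simp add: invertible_nonzero)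
    then have "proj (M *v \<gamma> 0) = proj (\<delta> 0)"
      using cr[of 1 2] cr[of 2 3] cr[of 3 1] g0(3) by (simp add: proj_coord_eq)
    then show ?thesis using lin_proj[OF inv g0(1)] g0 by simp
  qed
  ultimately show ?thesis by blast
qed

subsection \<open>Linear automorphisms\<close>

lemma lin_restrict_Aut:
  assumes "F4sym M" shows "restrict (lin M) klein \<in> Aut"
proof -
  obtain N where N: "F4sym N" "M ** N = mat 1" "N ** M = mat 1" using F4sym_inverse[OF assms] .
  have NM: "lin N (lin M P) = P" "lin M (lin N P) = P" for P
    using N assms by (simp_all add: lin_mult[symmetric] F4sym_invertible lin_id)
  have b: "bij_betw (restrict (lin M) klein) klein klein"
    by (rule bij_betwI[where g = "lin N"]) (use NM lin_klein[OF assms] lin_klein[OF N(1)] in auto)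
  have i: "inv_into klein (restrict (lin M) klein) P = lin N P" if "P \<in> klein" for P
    by (rule inv_into_f_eq) (use b NM lin_klein[OF N(1) that] in \<open>auto simp: bij_betw_def\<close>)
  have h: "holomorphic_map klein g" if g: "\<And>P. P \<in> klein \<Longrightarrow> g P = lin K P" and K: "F4sym K" for g K
    unfolding holomorphic_map_def
  proof (intro conjI ballI allI impI)
    show "g ` klein \<subseteq> klein" using g lin_klein[OF K] by auto
    fix P \<gamma> assume "P \<in> klein" "local_param klein P \<gamma>"
    then obtain r where r: "r > 0" "holo_arc r \<gamma>" "\<forall>t\<in>ball 0 r. proj (\<gamma> t) \<in> klein"
      unfolding local_param_def by blast
    have inv: "invertible K" by (rule F4sym_invertible[OF K])
    have "holo_arc r (\<lambda>t. K *v \<gamma> t)"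
      unfolding holo_arc_def
    proof (intro conjI allI)
      show "(\<lambda>t. (K *v \<gamma> t) $ i) holomorphic_on ball 0 r" for i
        unfolding matrix_vector_mult_def using r(2) by (auto simp: holo_arc_def intro!: holomorphic_intros)
      show "\<forall>t\<in>ball 0 r. K *v \<gamma> t \<noteq> 0" using r(2) by (simp add: holo_arc_def invertible_nonzero[OF inv])
    qed
    moreover have "g (proj (\<gamma> t)) = proj (K *v \<gamma> t)" if "t \<in> ball 0 r" for t
    proof -
      have "\<gamma> t \<noteq> 0" using r(2) that by (simp add: holo_arc_def)
      then show ?thesis using lin_proj[OF inv] g r(3) that by simp
    qed
    ultimately show "\<exists>r>0. \<exists>\<delta>. holo_arc r \<delta> \<and> (\<forall>t\<in>ball 0 r. g (proj (\<gamma> t)) = proj (\<delta> t))"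
      using r(1) by blast
  qed
  have "holomorphic_map klein (restrict (lin M) klein)" by (rule h[OF _ assms]) simp
  moreover have "holomorphic_map klein (inv_into klein (restrict (lin M) klein))" by (rule h[OF i N(1)])
  ultimately show ?thesis using b by (simp add: Aut_iff Bij_def)
qed

section \<open>The symmetry of order two\<close>

lemma zeta_sum: "1 + zeta + zeta^2 + zeta^3 + zeta^4 + zeta^5 + zeta^6 = 0"
proof -
  have "zeta \<noteq> 1" using zeta_power_eq_1_iff[of 1] by simp
  moreover have "(zeta - 1) * (1 + zeta + zeta^2 + zeta^3 + zeta^4 + zeta^5 + zeta^6) = zeta^7 - 1"
    by Groebner_Basis.algebra
  ultimately show ?thesis by simp
qed

text \<open>The differences zeta^k - zeta^(-k) at the squares k = 1, 2, 4 modulo 7; their sum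
  \<open>w7\<close> is the quadratic Gauss sum.\<close>

definition "g1 = zeta - zeta^6"
definition "g2 = zeta^2 - zeta^5"
definition "g4 = zeta^4 - zeta^3"
definition "w7 = g1 + g2 + g4"

lemma g_relations: "g1*g2 + g2*g4 + g4*g1 = 0" "g1*g2*g4 = w7" "w7^2 = -7"
    "g1^2*g2 + g2^2*g4 + g4^2*g1 = - w7" "g1*g2^2 + g2*g4^2 + g4*g1^2 = - 2 * w7"
  unfolding w7_def g1_def g2_def g4_def using zeta_sum by Groebner_Basis.algebra+

lemma w7_nonzero: "w7 \<noteq> 0" using g_relations(3) by auto

text \<open>The combinations that occur as coefficients when the quartic is composed with
  \<open>sM\<close>. Their values cancel all monomials but those of the quartic, which get 7 + 3 *
  14 = 49.\<close>

lemma g_relations4: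
  "g1^3*g2 + g2^3*g4 + g4^3*g1 = 0"
  "g1^3*g4 + g2^3*g1 + g4^3*g2 = 7"
  "g1^4 + g2^4 + g4^4 = 21"
  "g1^2*g2^2 + g2^2*g4^2 + g4^2*g1^2 = 14"
  "g1^2*g2*g4 + g2^2*g4*g1 + g4^2*g1*g2 = -7"
  "g1^2 + g2^2 + g4^2 = -7"
  using zeta_sum unfolding g1_def g2_def g4_def by Groebner_Basis.algebra+

text \<open>Klein's involution multiplied by \<open>w7\<close>, so that its square is the scalar -7,
  which acts trivially on the plane.\<close>

definition sM :: "complex^3^3" where
  "sM = vector [vector [g1, g2, g4], vector [g2, g4, g1], vector [g4, g1, g2]]"

lemma sM_nth: "(sM *v v) $ 1 = g1 * v$1 + g2 * v$2 + g4 * v$3"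
  "(sM *v v) $ 2 = g2 * v$1 + g4 * v$2 + g1 * v$3" "(sM *v v) $ 3 = g4 * v$1 + g1 * v$2 + g2 * v$3"
  unfolding sM_def mat3_mult_vec by auto

lemma sM_sM: "sM *v (sM *v v) = (-7) *s v"
proof -
  have e: "g1*g1 + g2*g2 + g4*g4 = -7" "g1*g2 + g2*g4 + g4*g1 = 0"
    using g_relations4(6) g_relations(1) by (simp_all add: power2_eq_square)
  have "(sM *v (sM *v v)) $ 1 = (g1*g1 + g2*g2 + g4*g4) * v$1 + (g1*g2 + g2*g4 + g4*g1) * v$2 + (g1*g2 + g2*g4 + g4*g1) * v$3"
    "(sM *v (sM *v v)) $ 2 = (g1*g2 + g2*g4 + g4*g1) * v$1 + (g1*g1 + g2*g2 + g4*g4) * v$2 + (g1*g2 + g2*g4 + g4*g1) * v$3"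
    "(sM *v (sM *v v)) $ 3 = (g1*g2 + g2*g4 + g4*g1) * v$1 + (g1*g2 + g2*g4 + g4*g1) * v$2 + (g1*g1 + g2*g2 + g4*g4) * v$3"
    unfolding sM_nth by Groebner_Basis.algebra+
  then show ?thesis unfolding e by (simp add: vec3_eq_iff)
qed

lemma F4_sM: "F4 (sM *v v) = 49 * F4 v"
proof -
  have "F4 (sM *v v) =
    (g1^3*g2 + g2^3*g4 + g4^3*g1) * (v$1^4 + v$2^4 + v$3^4
      + 3 * (v$1^2 * v$2 * v$3 + v$1 * v$2^2 * v$3 + v$1 * v$2 * v$3^2))
    + (g1^3*g4 + g2^3*g1 + g4^3*g2 + 3 * (g1^2*g2^2 + g2^2*g4^2 + g4^2*g1^2)) * (v$1^3 * v$2 + v$2^3 * v$3 + v$3^3 * v$1)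
    + (g1^4 + g2^4 + g4^4 + 3 * (g1^2*g2*g4 + g2^2*g4*g1 + g4^2*g1*g2)) * (v$1^3 * v$3 + v$1 * v$2^3 + v$2 * v$3^3)
    + 3 * (g1^3*g4 + g2^3*g1 + g4^3*g2 + (g1^2*g2*g4 + g2^2*g4*g1 + g4^2*g1*g2)) * (v$1^2 * v$2^2 + v$2^2 * v$3^2 + v$3^2 * v$1^2)
    + (3 * (g1^2*g2^2 + g2^2*g4^2 + g4^2*g1^2) + 6 * (g1^2*g2*g4 + g2^2*g4*g1 + g4^2*g1*g2))
      * (v$1^2 * v$2 * v$3 + v$1 * v$2^2 * v$3 + v$1 * v$2 * v$3^2)"
    unfolding F4_def sM_nth by Groebner_Basis.algebra
  then show ?thesis unfolding g_relations4 F4_def by simp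
qed

lemma F4sym_sM: "F4sym sM"
proof -
  have "(sM *v v = 0) \<Longrightarrow> v = 0" for v using sM_sM[of v] by simp
  then have "\<exists>B. B ** sM = mat 1" unfolding matrix_left_invertible_ker by blast
  then have "invertible sM" unfolding invertible_left_inverse by blast
  then show ?thesis unfolding F4sym_def using F4_sM by (intro conjI exI[of _ 49]) auto
qed

definition xyz :: "complex^3 \<Rightarrow> complex" where "xyz v = v$1 * v$2 * v$3"

text \<open>The cubic \<open>contact\<close> touches the curve at the vertices of two inflection triangles,
  the coordinate triangle and its image under \<open>sM\<close>.\<close>

definition contact :: "complex^3 \<Rightarrow> complex" where
  "contact v = v$1^2 * v$2 + v$2^2 * v$3 + v$3^2 * v$1 + v$1 * v$2 * v$3"

text \<open>Write \<open>xyz (sM *v v)\<close> as w7 N. Then contact^2 + xyz N = F4 (xy + yz + zx)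
  identically in x, y, z, and the right side vanishes on the curve.\<close>

lemma contact_square: assumes "F4 v = 0" shows "w7 * contact v ^ 2 = - (xyz v * xyz (sM *v v))"
proof -
  let ?x = "v$1" and ?y = "v$2" and ?z = "v$3"
  have "g1^3 + g2^3 + g4^3 + 3 * w7 = - w7"
    using g_relations w7_def by Groebner_Basis.algebra
  note rel = g_relations(2,4,5) this
  have "xyz (sM *v v) = (g1*g2*g4) * (?x^3 + ?y^3 + ?z^3)
      + (g1^2*g2 + g2^2*g4 + g4^2*g1) * (?x^2*?y + ?y^2*?z + ?z^2*?x)
      + (g1*g2^2 + g2*g4^2 + g4*g1^2) * (?x*?y^2 + ?y*?z^2 + ?z*?x^2)
      + (g1^3 + g2^3 + g4^3 + 3 * (g1*g2*g4)) * (?x*?y*?z)"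
    unfolding xyz_def sM_nth by Groebner_Basis.algebra
  also have "\<dots> = w7 * (?x^3 + ?y^3 + ?z^3 - (?x^2*?y + ?y^2*?z + ?z^2*?x) - 2 * (?x*?y^2 + ?y*?z^2 + ?z*?x^2) - ?x*?y*?z)"
    unfolding rel by Groebner_Basis.algebra
  finally have N: "xyz (sM *v v) = w7 * (?x^3 + ?y^3 + ?z^3 - (?x^2*?y + ?y^2*?z + ?z^2*?x) - 2 * (?x*?y^2 + ?y*?z^2 + ?z*?x^2) - ?x*?y*?z)" .
  have "contact v ^ 2 + ?x*?y*?z * (?x^3 + ?y^3 + ?z^3 - (?x^2*?y + ?y^2*?z + ?z^2*?x) - 2 * (?x*?y^2 + ?y*?z^2 + ?z*?x^2) - ?x*?y*?z)
      = F4 v * (?x*?y + ?y*?z + ?z*?x)"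
    unfolding contact_def F4_def by Groebner_Basis.algebra
  then have c2: "contact v ^ 2 = - (?x*?y*?z * (?x^3 + ?y^3 + ?z^3 - (?x^2*?y + ?y^2*?z + ?z^2*?x) - 2 * (?x*?y^2 + ?y*?z^2 + ?z*?x^2) - ?x*?y*?z))"
    unfolding assms by (simp add: eq_neg_iff_add_eq_0)
  show ?thesis unfolding N xyz_def[of v] c2 by Groebner_Basis.algebra
qed

section \<open>The invariant theta characteristic\<close>

definition Dabc :: "cp2 \<Rightarrow>\<^sub>0 int" where
  "Dabc = frag_cmul 2 (frag_of ptA) + frag_cmul 2 (frag_of ptB) + frag_cmul 2 (frag_of ptC)"

lemma lookup_Dabc: "Poly_Mapping.lookup Dabc P = (if special P then 2 else 0)"
  by (auto simp: Dabc_def lookup_add special_def abc_distinct)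

lemma keys_Dabc: "Poly_Mapping.keys Dabc \<subseteq> klein"
  unfolding Dabc_def by (intro keys_add_subset) (auto simp: abc_in_klein)

definition Th :: "cp2 \<Rightarrow>\<^sub>0 int" where "Th = Dabc - Dz"

lemma keys_Th: "Poly_Mapping.keys Th \<subseteq> klein"
  unfolding Th_def by (intro keys_diff_subset keys_Dabc keys_Dz)

text \<open>The form xyz vanishes to order 4 at each vertex, so xyz / z^3 = xy / z^2 has divisor 2
  \<open>Dabc\<close> - 3 \<open>Dz\<close>.\<close>

lemma Th_spin: "Th + Th - Dz \<in> PD"
proof -
  have "fdiv (cmono 1 1 (-2)) (Th + Th - Dz)"
  proof (rule fdivI)
    show "Poly_Mapping.keys (Th + Th - Dz) \<subseteq> klein"
      by (intro keys_diff_subset keys_add_subset keys_Th keys_Dz)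
    fix P \<gamma> assume l: "local_param klein P \<gamma>"
    have "Poly_Mapping.lookup (Th + Th - Dz) P = 1 * ox P + 1 * oy P + (-2) * oz P"
      by (auto simp: Th_def lookup_add lookup_minus lookup_Dabc lookup_Dz special_def ox_def oy_def oz_def abc_distinct)
    then show "ordeq (\<lambda>t. cmono 1 1 (-2) (proj (\<gamma> t))) (Poly_Mapping.lookup (Th + Th - Dz) P)"
      using cmono_ord[OF l, of 1 1 "-2"] by (simp add: fun_expr_def[abs_def])
  qed
  then show ?thesis unfolding PD_iff by blast
qed

lemma xyz_ord: assumes "local_param klein P \<gamma>"
  shows "ordeq (\<lambda>t. xyz (\<gamma> t)) (if special P then 4 else 0)"
proof -
  note c = coord_ord[OF local_param_klein[OF assms] assms]
  have "ox P + oy P + oz P = (if special P then 4 else 0)"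
    by (auto simp: special_def ox_def oy_def oz_def abc_distinct)
  then show ?thesis using ordeq_mult[OF ordeq_mult[OF c(1,2)] c(3)] by (simp add: xyz_def)
qed

definition sA :: "cp2 \<Rightarrow> cp2" where "sA = restrict (lin sM) klein"

lemma sA_Aut: "sA \<in> Aut" unfolding sA_def by (rule lin_restrict_Aut[OF F4sym_sM])

text \<open>By \<open>contact_square\<close> the square of contact / xyz is a constant times the
  image of xyz over xyz, a function with twice the required divisor.\<close>

lemma Dabc_sA: "pull sA Dabc - Dabc \<in> PD"
proof -
  define h where "h = ratf contact xyz"
  have "fdiv h (pull sA Dabc - Dabc)"
  proof (rule fdivI)
    show "Poly_Mapping.keys (pull sA Dabc - Dabc) \<subseteq> klein"
      by (intro keys_diff_subset keys_pull sA_Aut keys_Dabc)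
    fix P \<gamma> assume l: "local_param klein P \<gamma>"
    have P: "P \<in> klein" by (rule local_param_klein[OF l])
    define Q where "Q = lin sM P"
    have ls: "local_param klein Q (\<lambda>t. sM *v \<gamma> t)" unfolding Q_def by (rule local_param_lin[OF F4sym_sM l])
    have e: "\<forall>\<^sub>F t in at 0. h (proj (\<gamma> t)) = contact (\<gamma> t) / xyz (\<gamma> t)"
      using local_param_eventually[OF l]
      by eventually_elim (simp add: h_def ratf_proj[where n = 3] contact_def xyz_def power2_eq_square power3_eq_cube algebra_simps)
    have an: "(\<lambda>t. contact (\<gamma> t)) analytic_on {0}"
      using l unfolding contact_def local_param_iff karc_def by (auto intro!: analytic_intros)
    \<comment> \<open>Meromorphy of h itself has to be known before its order can be taken as half
      of that of its square.\<close>
    have m: "(\<lambda>t. h (proj (\<gamma> t))) meromorphic_on {0}"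
      by (rule ordge_mero[OF ordge_cong[OF e ordge_divide[OF ordge_analytic[OF an] xyz_ord[OF l]]]])
    have "ordeq (\<lambda>t. h (proj (\<gamma> t)) ^ 2) (2 * ((if special Q then 2 else 0) - (if special P then 2 else 0)))"
    proof (rule ordeq_cong)
      show "\<forall>\<^sub>F t in at 0. h (proj (\<gamma> t)) ^ 2 = (- inverse w7) * (xyz (sM *v \<gamma> t) / xyz (\<gamma> t))"
        using e local_param_eventually[OF l] ordeq_eventually_nonzero[OF xyz_ord[OF l]]
      proof eventually_elim
        case (elim t)
        have F: "F4 (\<gamma> t) = 0" using elim(2) by blast
        have "contact (\<gamma> t) ^ 2 = - inverse w7 * (xyz (\<gamma> t) * xyz (sM *v \<gamma> t))"
        proof -
          have "contact (\<gamma> t) ^ 2 = inverse w7 * (w7 * contact (\<gamma> t) ^ 2)" using w7_nonzero by simp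
          then show ?thesis unfolding contact_square[OF F] by simp
        qed
        then show ?case unfolding elim(1) power_divide using elim(3) by (simp add: power2_eq_square)
      qed
      have "ordeq (\<lambda>t. (- inverse w7) * (xyz (sM *v \<gamma> t) / xyz (\<gamma> t)))
          (0 + ((if special Q then 4 else 0) - (if special P then 4 else 0)))"
        by (rule ordeq_mult[OF ordeq_const ordeq_divide[OF xyz_ord[OF ls] xyz_ord[OF l]]]) (simp add: w7_nonzero)
      moreover have "0 + ((if special Q then 4 else 0) - (if special P then 4 else 0)) =
          2 * ((if special Q then 2 else 0) - (if special P then 2 else 0 :: int))" by simp
      ultimately show "ordeq (\<lambda>t. (- inverse w7) * (xyz (sM *v \<gamma> t) / xyz (\<gamma> t)))
          (2 * ((if special Q then 2 else 0) - (if special P then 2 else 0)))" by simp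
    qed
    from ordeq_of_square[OF m this]
    have "ordeq (\<lambda>t. h (proj (\<gamma> t))) ((if special Q then 2 else 0) - (if special P then 2 else 0))" .
    moreover have "Poly_Mapping.lookup (pull sA Dabc - Dabc) P = (if special Q then 2 else 0) - (if special P then 2 else 0)"
    proof -
      have "sA P = Q" using P by (simp add: sA_def Q_def)
      then show ?thesis unfolding lookup_minus lookup_pull[OF sA_Aut keys_Dabc P] lookup_Dabc by simp
    qed
    ultimately show "ordeq (\<lambda>t. h (proj (\<gamma> t))) (Poly_Mapping.lookup (pull sA Dabc - Dabc) P)" by simp
  qed
  then show ?thesis unfolding PD_iff by blast
qed

lemma Th_sA: "pull sA Th - Th \<in> PD"
proof -
  have "pull sA Th - Th = (pull sA Dabc - Dabc) - (pull sA Dz - Dz)" unfolding Th_def pull_diff by simp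
  then show ?thesis using PD_diff[OF Dabc_sA pull_Dz[OF sA_Aut]] by simp
qed

definition gA :: "nat \<Rightarrow> cp2 \<Rightarrow> cp2" where "gA i = restrict (gact i) klein"

lemma gA_Aut: "gA i \<in> Aut" unfolding gA_def gact_def by (rule lin_restrict_Aut[OF F4sym_gM])

text \<open>The order 7 symmetry fixes the vertices, hence the divisor \<open>Th\<close> itself and
  not merely its class.\<close>

lemma Th_gA: "pull (gA i) Th - Th \<in> PD"
proof -
  have "special (gact i P) = special P" "oz (gact i P) = oz P" for P by (auto simp: special_def oz_def gact_abc)
  then have "Poly_Mapping.lookup (pull (gA i) Th) P = Poly_Mapping.lookup Th P" if "P \<in> klein" for P
  proof -
    have "gA i P = gact i P" using that by (simp add: gA_def)
    with \<open>\<And>P. special (gact i P) = special P\<close> \<open>\<And>P. oz (gact i P) = oz P\<close> show ?thesis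
      unfolding lookup_pull[OF gA_Aut keys_Th that] by (simp add: Th_def lookup_minus lookup_Dabc lookup_Dz)
  qed
  moreover have "Poly_Mapping.lookup D P = 0" if "P \<notin> klein" "Poly_Mapping.keys D \<subseteq> klein" for P and D :: "cp2 \<Rightarrow>\<^sub>0 int"
    using that by (auto simp: in_keys_iff)
  ultimately have "pull (gA i) Th = Th"
    by (intro poly_mapping_eqI) (metis keys_Th keys_pull gA_Aut)
  then show ?thesis by (simp add: PD_zero)
qed

subsection \<open>Uniqueness\<close>

text \<open>Read off from the expansions - 1 / (1 + t^7), - 1 - 1 / t^7 and t^7 of phi at the
  vertices and l + t elsewhere.\<close>

lemma phi_minus_ord: assumes "local_param klein P \<gamma>"
  shows "ordeq (\<lambda>t. phi (proj (\<gamma> t)) - l) (if P = ptB then -7 else if P = ptA then (if l = -1 then 7 else 0)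
    else if P = ptC then (if l = 0 then 7 else 0) else if phi P = l then 1 else 0)" (is "ordeq _ ?n")
proof -
  have P: "P \<in> klein" by (rule local_param_klein[OF assms])
  have "\<exists>\<eta>. upar P \<eta> \<and> ordeq (\<lambda>t. phi (proj (\<eta> t)) - l) ?n"
  proof -
    consider "P = ptA" | "P = ptB" | "P = ptC" | "P \<noteq> ptA" "P \<noteq> ptB" "P \<noteq> ptC" by blast
    then show ?thesis
    proof cases
      case 1
      have i: "ordeq (\<lambda>t. inverse (1 + t^7)) 0" by (intro ordeq_analytic analytic_intros) auto
      have nz: "\<forall>\<^sub>F t in at 0. 1 + t^7 \<noteq> (0::complex)" using parC_near' by eventually_elim simp
      have "ordeq (\<lambda>t. phi (proj (parA t)) - l) (if l = -1 then 7 else 0)"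
      proof (cases "l = -1")
        case True
        have e: "\<forall>\<^sub>F t in at 0. phi (proj (parA t)) - l = t^7 * inverse (1 + t^7)"
          using phi_parA nz by eventually_elim (simp add: True field_simps)
        from ordeq_cong[OF e ordeq_mult[OF ordeq_power[OF ordeq_ident] i]] True show ?thesis by simp
      next
        case False
        have e: "\<forall>\<^sub>F t in at 0. phi (proj (parA t)) - l = - inverse (1 + t^7) - l"
          using phi_parA by eventually_elim simp
        have o: "ordeq (\<lambda>t. - inverse (1 + t^7) - l) 0"
          using False by (intro ordeq_analytic analytic_intros) (auto simp: algebra_simps minus_equation_iff)
        from ordeq_cong[OF e o] False show ?thesis by simp
      qed
      then show ?thesis using parA_upar 1 by (auto simp: abc_distinct)
    next
      case 2
      have "\<forall>\<^sub>F t in at 0. phi (proj (parB t)) - l = inverse (t^7) * ((- 1 - l) * t^7 - 1)"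
        using phi_parB eventually_at_nonzero
      proof eventually_elim
        case (elim t)
        have "inverse (t^7) * ((- 1 - l) * t^7 - 1) = (- 1 - l) * (inverse (t^7) * t^7) - inverse (t^7)"
          by (simp only: right_diff_distrib mult_1_left mult_1_right mult_ac)
        also have "\<dots> = - 1 - inverse (t^7) - l" using elim(2) by simp
        finally show ?case unfolding elim(1) by (rule sym)
      qed
      moreover have "ordeq (\<lambda>t. (- 1 - l) * t^7 - 1) 0" by (intro ordeq_analytic analytic_intros) auto
      from ordeq_mult[OF ordeq_inverse[OF ordeq_power[OF ordeq_ident, of 7]] this]
      have "ordeq (\<lambda>t. inverse (t^7) * ((- 1 - l) * t^7 - 1)) (-7)" by simp
      ultimately have "ordeq (\<lambda>t. phi (proj (parB t)) - l) (-7)" by (rule ordeq_cong)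
      then show ?thesis using parB_upar 2 by auto
    next
      case 3
      have e: "\<forall>\<^sub>F t in at 0. phi (proj (parC t)) - l = t^7 - l" using phi_parC by eventually_elim simp
      have "ordeq (\<lambda>t. t^7 - l) (if l = 0 then 7 else 0)"
        using ordeq_power[OF ordeq_ident, of 7] by (auto intro!: ordeq_analytic analytic_intros)
      from ordeq_cong[OF e this] show ?thesis using parC_upar 3 by (auto simp: abc_distinct)
    next
      case 4
      obtain y where y: "phi P \<noteq> 0" "1 + phi P \<noteq> 0" "y^7 = phi P * (1 + phi P)^2" "upar P (par (phi P) y)"
        by (rule upar_generic[OF P 4])
      have e: "\<forall>\<^sub>F t in at 0. phi (proj (par (phi P) y t)) - l = t + (phi P - l)"
        using eventually_at_of_nhds[OF par_near[OF y(1-3)]] by eventually_elim simp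
      have "ordeq (\<lambda>t. t + (phi P - l)) (if phi P = l then 1 else 0)"
        using ordeq_ident by (auto intro!: ordeq_analytic analytic_intros)
      from ordeq_cong[OF e this] show ?thesis using y(4) 4 by auto
    qed
  qed
  then obtain \<eta> where "upar P \<eta>" "ordeq (\<lambda>t. phi (proj (\<eta> t)) - l) ?n" by blast
  then show ?thesis using fun_expr_upar(1)[OF _ assms, of \<eta> "\<lambda>P. phi P - l" ?n] by (simp only: fun_expr_def[abs_def])
qed

section \<open>Orbits and traces of the order seven symmetry\<close>

lemma gact_fixed: "gact i ptA = ptA" "gact i ptB = ptB" "gact i ptC = ptC"
  by (simp_all add: gact_abc)

text \<open>Off the vertices y / z is nonzero, and \<open>gact i\<close> multiplies it by
  zeta^i.\<close>

lemma gact_free: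
  assumes "P \<in> klein" "\<not> special P" "gact i P = gact j P" "i < 7" "j < 7" shows "i = j"
proof -
  define v where "v = rep P"
  have v: "v \<noteq> 0" "P = proj v" using rep[of P] by (simp_all add: v_def)
  have "F4 v = 0" using assms(1) by (simp add: v_def klein_iff_rep)
  then have nz: "v$2 \<noteq> 0" "v$3 \<noteq> 0" using klein_coord_zero[OF v(1)] v(2) assms(2) by (auto simp: special_def)
  have "proj (gM i *v v) = proj (gM j *v v)" using assms(3) by (simp add: v(2) gact_proj[OF v(1)])
  then have "zeta ^ (2*i) * v$2 * (zeta ^ j * v$3) = zeta ^ i * v$3 * (zeta ^ (2*j) * v$2)"
    using v(1) by (subst (asm) proj_coord_eq) (simp_all add: gM_nonzero gM_nth)
  then have "(zeta ^ (2*i) * zeta ^ j) * (v$2 * v$3) = (zeta ^ i * zeta ^ (2*j)) * (v$2 * v$3)"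
    by (simp only: mult_ac)
  then have "zeta ^ (2*i) * zeta ^ j = zeta ^ i * zeta ^ (2*j)" using nz by simp
  then have "zeta ^ i * zeta ^ i * zeta ^ j = zeta ^ i * (zeta ^ j * zeta ^ j)" by (simp only: mult_2 power_add)
  then have e: "zeta ^ i = zeta ^ j" by simp
  have *: "a = b" if "zeta ^ a = zeta ^ b" "a \<le> b" "b < 7" for a b
  proof -
    have "zeta ^ b = zeta ^ a * zeta ^ (b - a)" using that(2) power_add[of zeta a "b - a"] by simp
    then have "zeta ^ (b - a) = 1" using that(1) by simp
    then have "7 dvd b - a" by (simp only: zeta_power_eq_1_iff)
    then show ?thesis using that by (auto dest: dvd_imp_le)
  qed
  show ?thesis using *[of i j] *[of j i] e assms(4,5) by (cases "i \<le> j") auto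
qed

definition gtrace :: "(cp2 \<Rightarrow>\<^sub>0 int) \<Rightarrow> (cp2 \<Rightarrow>\<^sub>0 int)" where
  "gtrace D = (\<Sum>i<7. pull (gA i) D)"

lemma gtrace_diff: "gtrace (D - E) = gtrace D - gtrace E"
  by (simp add: gtrace_def pull_diff sum_subtractf)

lemma keys_gtrace: "Poly_Mapping.keys D \<subseteq> klein \<Longrightarrow> Poly_Mapping.keys (gtrace D) \<subseteq> klein"
  unfolding gtrace_def using keys_sum[of "\<lambda>i. pull (gA i) D" "{..<7}"] keys_pull[OF gA_Aut] by blast

lemma lookup_gtrace_frag:
  assumes "P \<in> klein" "Q \<in> klein"
  shows "Poly_Mapping.lookup (gtrace (frag_of P)) Q = (\<Sum>i<7. if gact i Q = P then 1 else 0)"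
proof -
  have "Poly_Mapping.keys (frag_of P) \<subseteq> klein" using assms(1) by (simp add: keys_frag_of)
  from lookup_pull[OF gA_Aut this assms(2)] show ?thesis
    unfolding gtrace_def lookup_sum using assms(2) by (intro sum.cong) (auto simp: gA_def)
qed

text \<open>The orbit sum of P is the fibre of phi through P, counted with ramification, so the
  function phi - l exhibits the equivalence. For \<open>ptB\<close>, the pole of phi, both sides are
  equal as divisors.\<close>

lemma gtrace_point:
  assumes P: "P \<in> klein" shows "gtrace (frag_of P) - frag_cmul 7 (frag_of ptB) \<in> PD"
proof -
  \<comment> \<open>At \<open>ptA\<close> the quotient defining phi is 0 / 0, which evaluates to 0;
    its true value -1 is put in by hand.\<close>
  define l where "l = (if P = ptA then -1 else phi P)"
  have phiC: "phi ptC = 0" unfolding ptC_def pt_def by (subst phi_proj) (auto simp: vec100_nonzero)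
  have kP: "Poly_Mapping.keys (frag_of P) \<subseteq> klein" using P by (simp add: keys_frag_of)
  show ?thesis
  proof (cases "P = ptB")
    case True
    have "gtrace (frag_of P) = frag_cmul 7 (frag_of ptB)"
    proof (rule poly_mapping_eqI)
      fix Q
      show "Poly_Mapping.lookup (gtrace (frag_of P)) Q = Poly_Mapping.lookup (frag_cmul 7 (frag_of ptB)) Q"
      proof (cases "Q \<in> klein")
        case Q: True
        show ?thesis using lookup_gtrace_frag[OF P Q] by (simp add: True gact_abc)
      next
        case False
        then have "Poly_Mapping.lookup (gtrace (frag_of P)) Q = 0" using keys_gtrace[OF kP] by (auto simp: in_keys_iff)
        moreover have "Q \<noteq> ptB" using False abc_in_klein by auto
        ultimately show ?thesis by simp
      qed
    qed
    then show ?thesis by (simp add: PD_zero)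
  next
    case B: False
    have "fdiv (\<lambda>Q. phi Q - l) (gtrace (frag_of P) - frag_cmul 7 (frag_of ptB))"
    proof (rule fdivI)
      show "Poly_Mapping.keys (gtrace (frag_of P) - frag_cmul 7 (frag_of ptB)) \<subseteq> klein"
        by (intro keys_diff_subset keys_gtrace kP) (auto simp: abc_in_klein)
      fix Q \<gamma> assume g: "local_param klein Q \<gamma>"
      have Q: "Q \<in> klein" by (rule local_param_klein[OF g])
      have L: "Poly_Mapping.lookup (gtrace (frag_of P) - frag_cmul 7 (frag_of ptB)) Q =
          (\<Sum>i<7. if gact i Q = P then 1 else 0) - (if Q = ptB then 7 else 0)"
        unfolding lookup_minus lookup_gtrace_frag[OF P Q] by simp
      have generic: "l \<noteq> 0 \<and> l \<noteq> -1" if "\<not> special P"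
      proof -
        have n: "P \<noteq> ptA" "P \<noteq> ptB" "P \<noteq> ptC" using that by (auto simp: special_def)
        have "phi P \<noteq> 0" "1 + phi P \<noteq> 0" using klein_generic[OF P n] by blast+
        then show ?thesis using n(1) by (auto simp: l_def add_eq_0_iff)
      qed
      have l0: "l = 0 \<longleftrightarrow> P = ptC" and l1: "l = -1 \<longleftrightarrow> P = ptA"
      proof -
        consider "P = ptA" | "P = ptC" "P \<noteq> ptA" | "\<not> special P" "P \<noteq> ptA" "P \<noteq> ptC" using B by (auto simp: special_def)
        then have "(l = 0 \<longleftrightarrow> P = ptC) \<and> (l = -1 \<longleftrightarrow> P = ptA)"
        proof cases
          case 1 then show ?thesis by (simp add: l_def abc_distinct)
        next
          case 2 then show ?thesis by (simp add: l_def phiC)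
        next
          case 3 then show ?thesis using generic by simp
        qed
        then show "l = 0 \<longleftrightarrow> P = ptC" "l = -1 \<longleftrightarrow> P = ptA" by blast+
      qed
      have "(\<Sum>i<7. if gact i Q = P then 1 else 0) - (if Q = ptB then 7 else 0) =
        (if Q = ptB then -7 else if Q = ptA then (if l = -1 then 7 else 0)
         else if Q = ptC then (if l = 0 then 7 else 0) else if phi Q = l then 1 else (0::int))"
      proof -
        consider "Q = ptB" | "Q = ptA" | "Q = ptC" | "\<not> special Q" by (auto simp: special_def)
        then show ?thesis
        proof cases
          case 1
          have "gact i Q \<noteq> P" for i using B unfolding 1 gact_fixed by simp
          then show ?thesis using 1 by simp
        next
          case 2
          have "gact i Q = P \<longleftrightarrow> P = ptA" for i unfolding 2 gact_fixed by auto
          then show ?thesis using 2 l1 by (simp add: abc_distinct)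
        next
          case 3
          have "gact i Q = P \<longleftrightarrow> P = ptC" for i unfolding 3 gact_fixed by auto
          then show ?thesis using 3 l0 by (simp add: abc_distinct)
        next
          case 4
          then have n: "Q \<noteq> ptA" "Q \<noteq> ptB" "Q \<noteq> ptC" by (auto simp: special_def)
          have q: "phi Q \<noteq> 0" "1 + phi Q \<noteq> 0" using klein_generic[OF Q n] by blast+
          have "(\<Sum>i<7. if gact i Q = P then 1 else 0) = (if phi Q = l then 1 else (0::int))"
          proof (cases "phi Q = l")
            case True
            have P': "P \<noteq> ptA" "P \<noteq> ptC" 
            proof -
              have "l \<noteq> 0" "l \<noteq> -1" using True q by auto
              then show "P \<noteq> ptA" "P \<noteq> ptC" using l0 l1 by blast+
            qed
            then have "phi Q = phi P" using True by (simp add: l_def)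
            then obtain i where i: "i < 7" "P = gact i Q" using phi_fibre[OF Q n P P'(1) B P'(2)] by blast
            have "gact j Q = P \<longleftrightarrow> j = i" if "j < 7" for j
              using gact_free[OF Q 4, of j i] i that by auto
            then have "(\<Sum>i<7. if gact i Q = P then 1 else 0) = (\<Sum>j<7. if j = i then 1 else (0::int))"
              by (intro sum.cong) auto
            also have "\<dots> = 1" using i(1) by simp
            finally show ?thesis using True by simp
          next
            case False
            have "gact i Q \<noteq> P" for i
            proof
              assume e: "gact i Q = P"
              then have "P \<noteq> ptA" using n(1) gact_abc(1) by blast
              then have "l = phi P" by (simp add: l_def)
              then show False using False phi_gact[of i Q] e by simp
            qed
            then show ?thesis using False by simp
          qed
          then show ?thesis using n by simp
        qed
      qed
      then show "ordeq (\<lambda>t. phi (proj (\<gamma> t)) - l) (Poly_Mapping.lookup (gtrace (frag_of P) - frag_cmul 7 (frag_of ptB)) Q)"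
        unfolding L using phi_minus_ord[OF g, of l] by simp
    qed
    then show ?thesis unfolding PD_iff by blast
  qed
qed

lemma gtrace_multiple:
  "Poly_Mapping.keys D \<subseteq> klein \<Longrightarrow> \<exists>n. gtrace D - frag_cmul n (frag_of ptB) \<in> PD"
proof (induction D rule: frag_induction[where S = klein])
  case zero
  show ?case by (intro exI[of _ 0]) (simp add: gtrace_def pull_def PD_zero)
next
  case (one P)
  show ?case using gtrace_point[OF one] by blast
next
  case (diff D E)
  then obtain m n where "gtrace D - frag_cmul m (frag_of ptB) \<in> PD" "gtrace E - frag_cmul n (frag_of ptB) \<in> PD" by blast
  from PD_diff[OF this] have "gtrace (D - E) - frag_cmul (m - n) (frag_of ptB) \<in> PD"
    by (simp add: gtrace_diff frag_cmul_diff_distrib algebra_simps)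
  then show ?case by blast
qed

text \<open>A function with divisor \<open>n ptB\<close> has an invariant norm without poles, which is constant.\<close>

lemma point_not_torsion: assumes "frag_cmul n (frag_of ptB) \<in> PD" shows "n = 0"
proof -
  have pos: "m \<le> 0" if m: "frag_cmul m (frag_of ptB) \<in> PD" for m
  proof (rule ccontr)
    assume "\<not> m \<le> 0"
    then have m0: "m > 0" by simp
    obtain h where h: "fdiv h (frag_cmul m (frag_of ptB))" using m unfolding PD_iff by blast
    have ho: "ordeq (\<lambda>t. h (gact i (proj (\<gamma> t)))) (if P = ptB then m else 0)" if l: "local_param klein P \<gamma>" for P \<gamma> i
    proof (rule ordeq_cong)
      have l': "local_param klein (gact i P) (\<lambda>t. gM i *v \<gamma> t)"
        unfolding gact_def by (rule local_param_lin[OF F4sym_gM l])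
      have "Poly_Mapping.lookup (frag_cmul m (frag_of ptB)) (gact i P) = (if P = ptB then m else 0)"
        using gact_abc(2)[of i P] by auto
      then show "ordeq (\<lambda>t. h (proj (gM i *v \<gamma> t))) (if P = ptB then m else 0)"
        using fdivD[OF h l'] by (simp only:)
      show "\<forall>\<^sub>F t in at 0. h (gact i (proj (\<gamma> t))) = h (proj (gM i *v \<gamma> t))"
        using local_param_eventually[OF l] by eventually_elim (simp add: gact_proj)
    qed
    define N where "N P = (\<Prod>i<7. h (gact i P))" for P
    have prodo: "ordeq (\<lambda>t. \<Prod>i<k. h (gact i (proj (\<gamma> t)))) (int k * (if P = ptB then m else 0))"
      if l: "local_param klein P \<gamma>" for P \<gamma> k
    proof (induction k)
      case (Suc k)
      from ordeq_mult[OF this ho[OF l, of k]] show ?case by (simp add: algebra_simps)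
    qed (simp add: ordeq_const)
    have No: "ordeq (\<lambda>t. N (proj (\<gamma> t))) (if P = ptB then 7 * m else 0)" if l: "local_param klein P \<gamma>" for P \<gamma>
      using prodo[OF l, of 7] by (cases "P = ptB") (simp_all add: N_def)
    have N1: "N (gact 1 P) = N P" for P
    proof -
      have s: "h (gact i (gact 1 P)) = h (gact (Suc i) P)" for i using gact_add[of i 1 P] by simp
      have "gact 7 P = gact 0 P" using gact_7[of 1 P] by simp
      then have "(\<Prod>i<7. h (gact (Suc i) P)) = (\<Prod>i<7. h (gact i P))"
        by (simp add: lessThan_nat_numeral lessThan_Suc eval_nat_numeral mult_ac)
      then show ?thesis unfolding N_def s .
    qed
    interpret invariant_function N
    proof
      show "N (gact i P) = N P" for i P
      proof (induction i)
        case (Suc n)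
        have "N (gact (Suc n) P) = N (gact 1 (gact n P))" using gact_add[of 1 n P] by (simp only: plus_1_eq_Suc)
        then show ?case unfolding N1 Suc .
      qed simp
      show "ordge (\<lambda>t. N (proj (\<gamma> t))) (if special P then - 6 else 0)" if l: "local_param klein P \<gamma>" for P \<gamma>
        by (rule ordge_mono[OF ordeq_ordge[OF No[OF l]]]) (use m0 in \<open>auto simp: special_def\<close>)
    qed
    obtain \<kappa> where c: "\<forall>P \<gamma>. local_param klein P \<gamma> \<longrightarrow> (\<forall>\<^sub>F t in at 0. N (proj (\<gamma> t)) = \<kappa>)" using const ..
    have lB: "local_param klein ptB parB" by (rule upar_local_param[OF parB_upar])
    note e = c[rule_format, OF lB] and o = No[OF lB]
    have "((\<lambda>t. N (proj (parB t))) \<longlongrightarrow> 0) (at 0)"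
      by (rule ordge_tendsto_0[OF ordeq_ordge[OF o]]) (use m0 in simp)
    then have "((\<lambda>_. \<kappa>) \<longlongrightarrow> 0) (at (0::complex))" using tendsto_cong[OF e] by simp
    then have k0: "\<kappa> = 0" by (simp add: tendsto_const_iff)
    have "\<forall>\<^sub>F t in at (0::complex). False"
      using e ordeq_eventually_nonzero[OF o] by eventually_elim (simp add: k0)
    then show False by simp
  qed
  have "frag_cmul (- n) (frag_of ptB) \<in> PD" using PD_minus[OF assms] by simp
  from pos[OF this] pos[OF assms] show ?thesis by simp
qed

lemma invariant_two_torsion:
  assumes D: "Poly_Mapping.keys D \<subseteq> klein" "D + D \<in> PD" and inv: "\<And>i. pull (gA i) D - D \<in> PD"
  shows "D \<in> PD"
proof -
  obtain n where n: "gtrace D - frag_cmul n (frag_of ptB) \<in> PD" using gtrace_multiple[OF D(1)] by blast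
  have "(\<Sum>i<7::nat. pull (gA i) D - D) \<in> PD" by (rule PD_sum) (rule inv)
  moreover have "(\<Sum>i<7::nat. pull (gA i) D - D) = gtrace D - frag_cmul 7 D"
    by (rule poly_mapping_eqI) (simp add: gtrace_def lookup_minus lookup_sum sum_subtractf)
  ultimately have t: "gtrace D - frag_cmul 7 D \<in> PD" by simp
  have D2: "frag_cmul 2 D \<in> PD" using D(2) frag_cmul_distrib[of 1 1 D] by simp
  have "(gtrace D - frag_cmul n (frag_of ptB)) - (gtrace D - frag_cmul 7 D) = frag_cmul 7 D - frag_cmul n (frag_of ptB)"
    by (rule poly_mapping_eqI) (simp add: lookup_minus)
  then have s: "frag_cmul 7 D - frag_cmul n (frag_of ptB) \<in> PD" using PD_diff[OF n t] by (simp only:)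
  have a: "frag_cmul 2 (frag_cmul 7 D - frag_cmul n (frag_of ptB)) \<in> PD" by (rule PD_cmul[OF s])
  have b: "frag_cmul 7 (frag_cmul 2 D) \<in> PD" by (rule PD_cmul[OF D2])
  have "frag_cmul 7 (frag_cmul 2 D) - frag_cmul 2 (frag_cmul 7 D - frag_cmul n (frag_of ptB)) = frag_cmul (2 * n) (frag_of ptB)"
    by (rule poly_mapping_eqI) (simp add: lookup_minus)
  \<comment> \<open>14 D is principal and 7 D is equivalent to n times \<open>ptB\<close>; hence 2 n
    times \<open>ptB\<close> is principal, which forces n = 0.\<close>
  then have "frag_cmul (2 * n) (frag_of ptB) \<in> PD" using PD_diff[OF b a] by simp
  then have "n = 0" using point_not_torsion[of "2 * n"] by simp
  then have c: "frag_cmul 7 D \<in> PD" using s by simp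
  have d: "frag_cmul 3 (frag_cmul 2 D) \<in> PD" by (rule PD_cmul[OF D2])
  have "frag_cmul 7 D - frag_cmul 3 (frag_cmul 2 D) = D"
    by (rule poly_mapping_eqI) (simp add: lookup_minus)
  then show ?thesis using PD_diff[OF c d] by (simp only:)
qed

section \<open>The automorphism group\<close>

lemma holomorphic_mapI:
  assumes "\<And>P. P \<in> klein \<Longrightarrow> f P \<in> klein"
    "\<And>P \<gamma>. local_param klein P \<gamma> \<Longrightarrow> \<exists>\<delta>. karc \<delta> \<and> (\<forall>\<^sub>F t in nhds 0. f (proj (\<gamma> t)) = proj (\<delta> t))"
  shows "holomorphic_map klein f"
  unfolding holomorphic_map_def
proof (intro conjI ballI allI impI)
  show "f ` klein \<subseteq> klein" using assms(1) by blast
  fix P \<gamma> assume "local_param klein P \<gamma>"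
  then obtain \<delta> where d: "karc \<delta>" "\<forall>\<^sub>F t in nhds 0. f (proj (\<gamma> t)) = proj (\<delta> t)" using assms(2) by blast
  obtain r where r: "r > 0" "holo_arc r \<delta>" using d(1) unfolding karc_iff_holo_arc by blast
  obtain e where e: "e > 0" "\<And>t. dist t 0 < e \<Longrightarrow> f (proj (\<gamma> t)) = proj (\<delta> t)"
    using d(2) unfolding eventually_nhds_metric by blast
  have "holo_arc (min r e) \<delta>"
    using r(2) unfolding holo_arc_def by (auto intro: holomorphic_on_subset)
  moreover have "f (proj (\<gamma> t)) = proj (\<delta> t)" if "t \<in> ball 0 (min r e)" for t
    using e(2)[of t] that by (simp add: dist_commute)
  ultimately show "\<exists>r>0. \<exists>\<delta>. holo_arc r \<delta> \<and> (\<forall>t\<in>ball 0 r. f (proj (\<gamma> t)) = proj (\<delta> t))"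
    using r(1) e(1) by (intro exI[of _ "min r e"]) auto
qed

lemma holomorphic_map_cong:
  assumes "holomorphic_map klein f" "\<And>P. P \<in> klein \<Longrightarrow> g P = f P" shows "holomorphic_map klein g"
proof (rule holomorphic_mapI)
  show "g P \<in> klein" if "P \<in> klein" for P using assms that unfolding holomorphic_map_def by auto
  fix P \<gamma> assume l: "local_param klein P \<gamma>"
  obtain \<delta> where d: "karc \<delta>" "\<forall>\<^sub>F t in nhds 0. f (proj (\<gamma> t)) = proj (\<delta> t)"
    by (rule holomorphic_map_arc[OF assms(1) l])
  have k: "karc \<gamma>" using l by (simp add: local_param_iff)
  have "\<forall>\<^sub>F t in nhds 0. g (proj (\<gamma> t)) = proj (\<delta> t)"
    using d(2) karc_eventually_klein[OF k] by eventually_elim (simp add: assms(2))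
  then show "\<exists>\<delta>. karc \<delta> \<and> (\<forall>\<^sub>F t in nhds 0. g (proj (\<gamma> t)) = proj (\<delta> t))" using d(1) by blast
qed

lemma Aut_extensional: "f \<in> Aut \<Longrightarrow> f \<in> extensional klein" by (simp add: Aut_iff Bij_def)

lemma Aut_inj: "f \<in> Aut \<Longrightarrow> P \<in> klein \<Longrightarrow> Q \<in> klein \<Longrightarrow> f P = f Q \<Longrightarrow> P = Q"
  using Aut_inv(1) by metis

lemma Aut_eqI: "f \<in> Aut \<Longrightarrow> g \<in> Aut \<Longrightarrow> (\<And>P. P \<in> klein \<Longrightarrow> f P = g P) \<Longrightarrow> f = g"
  using extensionalityI[OF Aut_extensional Aut_extensional] by blast

lemma holomorphic_map_comp:
  assumes f: "holomorphic_map klein f" and g: "g \<in> Aut" shows "holomorphic_map klein (\<lambda>P. f (g P))"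
proof (rule holomorphic_mapI)
  show "f (g P) \<in> klein" if "P \<in> klein" for P using f Aut_klein[OF g that] unfolding holomorphic_map_def by blast
  fix P \<gamma> assume l: "local_param klein P \<gamma>"
  obtain \<delta> where d: "local_param klein (g P) \<delta>" "\<forall>\<^sub>F t in nhds 0. g (proj (\<gamma> t)) = proj (\<delta> t)"
    by (rule Aut_param[OF g l])
  obtain \<epsilon> where e: "karc \<epsilon>" "\<forall>\<^sub>F t in nhds 0. f (proj (\<delta> t)) = proj (\<epsilon> t)"
    by (rule holomorphic_map_arc[OF f d(1)])
  have "\<forall>\<^sub>F t in nhds 0. f (g (proj (\<gamma> t))) = proj (\<epsilon> t)" using d(2) e(2) by eventually_elim simp
  then show "\<exists>\<delta>. karc \<delta> \<and> (\<forall>\<^sub>F t in nhds 0. f (g (proj (\<gamma> t))) = proj (\<delta> t))" using e(1) by blast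
qed

text \<open>\<open>inv_into\<close> is restricted because elements of the automorphism group are
  extensional outside the curve.\<close>

definition ainv :: "(cp2 \<Rightarrow> cp2) \<Rightarrow> cp2 \<Rightarrow> cp2" where "ainv f = restrict (inv_into klein f) klein"

lemma ainv_Aut: assumes f: "f \<in> Aut" shows "ainv f \<in> Aut"
proof -
  have B: "ainv f \<in> Bij klein" unfolding ainv_def by (rule restrict_inv_into_Bij) (use f in \<open>simp add: Aut_iff\<close>)
  have "inv_into klein (ainv f) P = f P" if "P \<in> klein" for P
    by (rule inv_into_f_eq) (use B f that Aut_klein[OF f that] Aut_inv[OF f] in \<open>auto simp: ainv_def Bij_def bij_betw_def\<close>)
  then have "holomorphic_map klein (inv_into klein (ainv f))"
    using f holomorphic_map_cong[of f] by (simp add: Aut_iff)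
  moreover have "holomorphic_map klein (ainv f)"
    by (rule holomorphic_map_cong[of "inv_into klein f"]) (use f in \<open>auto simp: Aut_iff ainv_def\<close>)
  ultimately show ?thesis using B by (simp add: Aut_iff)
qed

lemma ainv_apply: "f \<in> Aut \<Longrightarrow> P \<in> klein \<Longrightarrow> ainv f (f P) = P" "f \<in> Aut \<Longrightarrow> P \<in> klein \<Longrightarrow> f (ainv f P) = P"
  using Aut_inv Aut_klein by (auto simp: ainv_def)

lemma compose_Aut: assumes f: "f \<in> Aut" and g: "g \<in> Aut" shows "compose klein f g \<in> Aut"
proof -
  have B: "compose klein f g \<in> Bij klein" using f g by (intro compose_Bij) (auto simp: Aut_iff)
  have "holomorphic_map klein (compose klein f g)"
    by (rule holomorphic_map_cong[OF holomorphic_map_comp[of f g]]) (use f g in \<open>auto simp: Aut_iff compose_def\<close>)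
  moreover have "holomorphic_map klein (inv_into klein (compose klein f g))"
  proof (rule holomorphic_map_cong[OF holomorphic_map_comp[of "ainv g" "ainv f"]])
    show "holomorphic_map klein (ainv g)" "ainv f \<in> Aut" using ainv_Aut f g by (auto simp: Aut_iff)
    fix P assume P: "P \<in> klein"
    have m: "ainv f P \<in> klein" "ainv g (ainv f P) \<in> klein" using Aut_klein ainv_Aut f g P by blast+
    have "compose klein f g (ainv g (ainv f P)) = P"
      by (simp add: compose_def m ainv_apply(2)[OF g m(1)] ainv_apply(2)[OF f P])
    moreover have "inj_on (compose klein f g) klein" using B by (simp add: Bij_def bij_betw_def)
    ultimately show "inv_into klein (compose klein f g) P = ainv g (ainv f P)" using m(2) by (intro inv_into_f_eq)
  qed
  ultimately show ?thesis using B by (simp add: Aut_iff)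
qed

section \<open>The group structure and functoriality of the pullback\<close>

lemma gA_0: "gA 0 = (\<lambda>P\<in>klein. P)"
  by (simp add: gA_def restrict_def fun_eq_iff gact_0)

lemma id_Aut: "(\<lambda>P\<in>klein. P) \<in> Aut"
  unfolding gA_0[symmetric] by (rule gA_Aut)

lemma aut_mult: "f \<in> Aut \<Longrightarrow> g \<in> Aut \<Longrightarrow> f \<otimes>\<^bsub>aut_group klein\<^esub> g = compose klein f g"
  by (simp add: aut_group_def BijGroup_def Aut_iff)

lemma aut_one: "\<one>\<^bsub>aut_group klein\<^esub> = (\<lambda>P\<in>klein. P)"
  by (simp add: aut_group_def BijGroup_def)

lemma aut_carrier: "carrier (aut_group klein) = Aut" by (simp add: Aut_def)

lemma group_aut: "group (aut_group klein)"
proof -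
  have "subgroup Aut (BijGroup klein)"
  proof
    show "Aut \<subseteq> carrier (BijGroup klein)" by (auto simp: Aut_iff BijGroup_def)
    show "x \<otimes>\<^bsub>BijGroup klein\<^esub> y \<in> Aut" if "x \<in> Aut" "y \<in> Aut" for x y
      using compose_Aut[OF that] that by (simp add: BijGroup_def Aut_iff)
    show "\<one>\<^bsub>BijGroup klein\<^esub> \<in> Aut" using id_Aut by (simp add: BijGroup_def)
    show "inv\<^bsub>BijGroup klein\<^esub> x \<in> Aut" if "x \<in> Aut" for x
      using ainv_Aut[OF that] that inv_BijGroup[of x klein] by (simp add: Aut_iff ainv_def)
  qed
  then show ?thesis using group.subgroup_imp_group[OF group_BijGroup]
    unfolding aut_group_def by (simp add: Aut_iff[symmetric])
qed

lemma pull_compose: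
  assumes f: "f \<in> Aut" and g: "g \<in> Aut" and D: "Poly_Mapping.keys D \<subseteq> klein"
  shows "pull (compose klein f g) D = pull g (pull f D)"
proof (rule poly_mapping_eqI)
  fix P
  show "Poly_Mapping.lookup (pull (compose klein f g) D) P = Poly_Mapping.lookup (pull g (pull f D)) P"
  proof (cases "P \<in> klein")
    case True
    show ?thesis
      unfolding lookup_pull[OF compose_Aut[OF f g] D True] lookup_pull[OF g keys_pull[OF f D] True]
          lookup_pull[OF f D Aut_klein[OF g True]] by (simp add: compose_def True)
  next
    case False
    have "P \<notin> Poly_Mapping.keys (pull (compose klein f g) D)" "P \<notin> Poly_Mapping.keys (pull g (pull f D))"
      using False keys_pull[OF compose_Aut[OF f g] D] keys_pull[OF g keys_pull[OF f D]] by blast+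
    then show ?thesis unfolding in_keys_iff by simp
  qed
qed

section \<open>Flexes\<close>

text \<open>Contact of order at least three with some line: a condition that linear maps preserve,
  so automorphisms permute these points.\<close>

definition flex :: "cp2 \<Rightarrow> bool" where
  "flex P \<longleftrightarrow> (\<exists>\<gamma> u. local_param klein P \<gamma> \<and> u \<noteq> 0 \<and> ordge (\<lambda>t. lform u (\<gamma> t)) 3)"

lemma lform_ord_transfer:
  assumes "upar P \<eta>" "local_param klein P \<gamma>" "u \<noteq> 0" "ordge (\<lambda>t. lform u (\<gamma> t)) n"
  shows "ordge (\<lambda>t. lform u (\<eta> t)) n"
proof -
  have le: "local_param klein P \<eta>" by (rule upar_local_param[OF assms(1)])
  have m: "(\<lambda>t. lform u (\<eta> t)) meromorphic_on {0}" by (rule analytic_on_imp_meromorphic_on[OF lform_analytic[OF le]])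
  have nz: "\<exists>\<^sub>F t in at 0. lform u (\<eta> t) \<noteq> 0"
    using lform_eventually_nonzero[OF assms(3) le] by (simp add: eventually_frequently)
  define k where "k = zorder (\<lambda>t. lform u (\<eta> t)) 0"
  have k: "ordeq (\<lambda>t. lform u (\<eta> t)) k" unfolding k_def by (rule mero_ordeq[OF m nz])
  then have "ordeq (line_expr u \<eta>) k" by (simp add: line_expr_eq[abs_def])
  from line_expr_upar[OF assms(1,2) this] have "ordeq (\<lambda>t. lform u (\<gamma> t)) k" by (simp add: line_expr_eq[abs_def])
  then have "n \<le> k" using assms(4) by (rule ordeq_ordge_le)
  then show ?thesis using ordge_mono[OF ordeq_ordge[OF k]] by simp
qed

text \<open>The lift of the image arc and M applied to the original lift differ by an analytic
  factor, so the contact order with the transported line does not drop.\<close>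

lemma lform_image:
  assumes f: "f \<in> Aut" and M: "invertible M" "\<And>P. P \<in> klein \<Longrightarrow> f P = lin M P"
    and l: "local_param klein P \<gamma>" and o: "ordge (\<lambda>t. lform u (\<gamma> t)) n"
    and u': "\<And>v. lform u' (M *v v) = lform u v"
  obtains \<delta> where "local_param klein (f P) \<delta>" "ordge (\<lambda>t. lform u' (\<delta> t)) n"
proof -
  obtain \<delta> where d: "local_param klein (f P) \<delta>" "\<forall>\<^sub>F t in nhds 0. f (proj (\<gamma> t)) = proj (\<delta> t)"
    by (rule Aut_param[OF f l])
  have kg: "karc \<gamma>" and kd: "karc \<delta>" using l d(1) by (auto simp: local_param_iff)
  have e: "\<forall>\<^sub>F t in nhds 0. proj (M *v \<gamma> t) = proj (\<delta> t) \<and> M *v \<gamma> t \<noteq> 0 \<and> \<delta> t \<noteq> 0"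
    using d(2) karc_eventually_klein[OF kg] karc_eventually_klein[OF kd]
  proof eventually_elim
    case (elim t)
    then show ?case using M(2)[of "proj (\<gamma> t)"] lin_proj[OF M(1), of "\<gamma> t"] by (simp add: invertible_nonzero[OF M(1)])
  qed
  obtain i where i: "(M *v \<gamma> 0) $ i \<noteq> 0"
    using eventually_nhds_x_imp_x[OF e] by (auto simp: vec_eq_iff)
  have ga: "(\<lambda>t. (M *v \<gamma> t) $ i) analytic_on {0}" using kg by (intro analytic_lin) (simp add: karc_def)
  define k where "k t = \<delta> t $ i / (M *v \<gamma> t) $ i" for t
  have k: "k analytic_on {0}" unfolding k_def using kd ga i by (auto simp: karc_def intro!: analytic_intros)
  have eq: "\<forall>\<^sub>F t in nhds 0. lform u' (\<delta> t) = k t * lform u (\<gamma> t)"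
    using e analytic_eventually_nonzero[OF ga i]
  proof eventually_elim
    case (elim t)
    obtain c where c: "\<delta> t = c *s (M *v \<gamma> t)" using proj_eq_iff[of "M *v \<gamma> t" "\<delta> t"] elim(1) by auto
    then have "c = k t" using elim(2) by (simp add: k_def)
    then show ?case using c u'[of "\<gamma> t"] by (simp add: lform_scale)
  qed
  have "ordge (\<lambda>t. lform u' (\<delta> t)) n"
    using ordge_cong[OF eventually_at_of_nhds[OF eq]] ordge_mult[OF ordge_analytic[OF k] o] by simp
  then show ?thesis using that d(1) by blast
qed

lemma dual_form:
  fixes M :: "complex^3^3"
  assumes "invertible M" "u \<noteq> 0"
  obtains u' where "u' \<noteq> 0" "\<And>v. lform u' (M *v v) = lform u v"
proof -
  obtain N where N: "M ** N = mat 1" "N ** M = mat 1" using assms(1) by (auto simp: invertible_def)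
  have t: "lform (transpose N *v u) v = lform u (N *v v)" for v
    by (simp add: lform_def matrix_vector_mult_def sum_3 transpose_def algebra_simps)
  have e: "lform (transpose N *v u) (M *v v) = lform u v" for v
    unfolding t by (simp add: matrix_vector_mul_assoc N)
  have "transpose N *v u \<noteq> 0"
  proof
    assume "transpose N *v u = 0"
    then have z: "lform u v = 0" for v using e[of v] by (simp add: lform_def)
    have "u = 0" using z[of "vector [1,0,0]"] z[of "vector [0,1,0]"] z[of "vector [0,0,1]"]
      by (simp add: lform_def vec3_eq_iff)
    then show False using assms(2) by simp
  qed
  then show ?thesis using that e by blast
qed

lemma flex_image: assumes f: "f \<in> Aut" and P: "flex P" shows "flex (f P)"
proof -
  obtain \<gamma> u where g: "local_param klein P \<gamma>" "u \<noteq> 0" "ordge (\<lambda>t. lform u (\<gamma> t)) 3" using P unfolding flex_def by blast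
  obtain M where M: "invertible M" "\<And>P. P \<in> klein \<Longrightarrow> f P = lin M P" using Aut_linear[OF f] by blast
  obtain u' where u': "u' \<noteq> 0" "\<And>v. lform u' (M *v v) = lform u v" by (rule dual_form[OF M(1) g(2)]) blast
  obtain \<delta> where "local_param klein (f P) \<delta>" "ordge (\<lambda>t. lform u' (\<delta> t)) 3"
    by (rule lform_image[OF f M g(1,3) u'(2)])
  then show ?thesis unfolding flex_def using u'(1) by blast
qed

lemma parA_line: "ordge (\<lambda>t. lform (vector [0,1,0]) (parA t)) 3"
  using ordeq_ordge[OF parC_ord(1)] by (simp add: lform_def parAB_nth)

lemma flex_ptA: "flex ptA"
  unfolding flex_def using upar_local_param[OF parA_upar] parA_line vec100_nonzero(2) by blast

text \<open>The tangent y = 0 at \<open>ptA\<close> is the only line with contact of order three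
  there, so a linear automorphism fixing \<open>ptA\<close> preserves it. Its only other point on
  the curve is \<open>ptC\<close>.\<close>

lemma Aut_fix_A_C: assumes f: "f \<in> Aut" and A: "f ptA = ptA" shows "f ptC = ptC"
proof -
  obtain M where M: "invertible M" "\<And>P. P \<in> klein \<Longrightarrow> f P = lin M P" using Aut_linear[OF f] by blast
  obtain u where u: "u \<noteq> 0" "\<And>v. lform u (M *v v) = lform (vector [0,1,0]) v"
    by (rule dual_form[OF M(1) vec100_nonzero(2)]) blast
  obtain \<delta> where d: "local_param klein (f ptA) \<delta>" "ordge (\<lambda>t. lform u (\<delta> t)) 3"
    by (rule lform_image[OF f M upar_local_param[OF parA_upar] parA_line u(2)])
  have o: "ordge (\<lambda>t. lform u (parA t)) 3"
    by (rule lform_ord_transfer[OF parA_upar _ u(1) d(2)]) (use d(1) A in simp)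
  have p: "lform u (parA t) = u$1 + u$2 * parC t $ 1 + u$3 * parC t $ 2" for t
    by (simp add: lform_def parAB_nth parC_nth(3))
  have "(\<lambda>t. lform u (parA t)) analytic_on {0}" by (rule lform_analytic[OF upar_local_param[OF parA_upar]])
  then have "((\<lambda>t. lform u (parA t)) \<longlongrightarrow> lform u (parA 0)) (at 0)"
    using analytic_at_imp_isCont by (simp only: isCont_def)
  moreover have "((\<lambda>t. lform u (parA t)) \<longlongrightarrow> 0) (at 0)" by (rule ordge_tendsto_0[OF o]) simp
  ultimately have "lform u (parA 0) = 0" by (rule tendsto_unique[OF at_neq_bot])
  then have u1: "u$1 = 0" by (simp add: p parC_0)
  have u3: "u$3 = 0"
  proof (rule ccontr)
    assume "u$3 \<noteq> 0"
    then have "ordeq (\<lambda>t. u$3 * parC t $ 2) (0 + 1)" by (intro ordeq_mult ordeq_const parC_ord)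
    moreover have "ordge (\<lambda>t. lform u (parA t) + (- u$2) * parC t $ 1) 3"
      by (intro ordge_add o ordge_cmult ordeq_ordge parC_ord)
    then have "ordge (\<lambda>t. u$3 * parC t $ 2) 3" by (simp add: p u1)
    ultimately have "3 \<le> (0 + 1 :: int)" by (rule ordeq_ordge_le)
    then show False by simp
  qed
  have u2: "u$2 \<noteq> 0" using u(1) u1 u3 by (auto simp: vec3_eq_iff)
  define v where "v = M *v (vector [0,0,1] :: complex^3)"
  have v: "v \<noteq> 0" "f ptC = proj v"
    using M lin_proj[OF M(1) vec100_nonzero(3)] abc_in_klein vec100_nonzero(3)
    by (auto simp: v_def ptC_def pt_def invertible_nonzero)
  have "lform u v = 0" unfolding v_def u(2) by (simp add: lform_def)
  then have "v$2 = 0" using u1 u2 u3 by (simp add: lform_def)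
  moreover have "F4 v = 0" using Aut_klein[OF f abc_in_klein(3)] v by (simp add: proj_in_klein_iff)
  ultimately have "f ptC = ptA \<or> f ptC = ptC" using klein_coord_zero(2)[OF v(1)] v(2) by simp
  then show ?thesis using Aut_inj[OF f abc_in_klein(1,3)] A abc_distinct by metis
qed

section \<open>Second derivatives at a flex\<close>

lemma eventually_deriv_zero:
  assumes "\<forall>\<^sub>F t in nhds a. f t = (0::complex)" "\<forall>\<^sub>F t in nhds a. (f has_field_derivative f' t) (at t)"
  shows "\<forall>\<^sub>F t in nhds a. f' t = 0"
  using assms(1)[THEN eventually_eventually[THEN iffD2]] assms(2)
proof eventually_elim
  case (elim t)
  have "((\<lambda>_. 0) has_field_derivative f' t) (at t)"
    using DERIV_cong_ev[OF refl elim(1) refl] elim(2) by simp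
  then show ?case using DERIV_unique DERIV_const by blast
qed

lemma analytic_eventually_deriv:
  assumes "f analytic_on {0 :: complex}"
  shows "\<forall>\<^sub>F t in nhds 0. (f has_field_derivative deriv f t) (at t)"
proof -
  obtain S where S: "open S" "0 \<in> S" "f holomorphic_on S" using assms by (auto simp: analytic_at)
  show ?thesis using eventually_nhds_in_open[OF S(1,2)]
    by eventually_elim (rule holomorphic_derivI[OF S(3,1)])
qed

lemma ordge_3_derivs:
  assumes W: "W analytic_on {0}" and o: "ordge W 3"
  shows "W 0 = 0" "deriv W 0 = 0" "deriv (deriv W) 0 = 0"
proof -
  obtain u where u: "u analytic_on {0}" "\<forall>\<^sub>F t in at 0. W t = u t * t powi 3" using o unfolding ordge_def by blast
  have an: "(\<lambda>t. W t - u t * t^3) analytic_on {0}" using W u(1) by (intro analytic_intros)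
  have ev: "\<forall>\<^sub>F t in at 0. W t - u t * t^3 = 0" using u(2) by eventually_elim simp
  have z0: "W 0 - u 0 * 0^3 = 0" by (rule analytic_zero_limit[OF an ev])
  have z: "\<forall>\<^sub>F t in nhds 0. W t - u t * t^3 = 0"
    using ev z0 unfolding eventually_at_filter by (auto elim!: eventually_mono)
  note u1 = analytic_deriv[OF u(1)] and W1 = analytic_deriv[OF W]
  have d1: "\<forall>\<^sub>F t in nhds 0. deriv W t - (deriv u t * t^3 + 3 * t^2 * u t) = 0"
    by (rule eventually_deriv_zero[OF z])
      (use analytic_eventually_deriv[OF W] analytic_eventually_deriv[OF u(1)] in eventually_elim,
        auto intro!: derivative_eq_intros)
  have d2: "\<forall>\<^sub>F t in nhds 0. deriv (deriv W) t
      - (deriv (deriv u) t * t^3 + 6 * t^2 * deriv u t + 6 * t * u t) = 0"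
    by (rule eventually_deriv_zero[OF d1])
      (use analytic_eventually_deriv[OF W1] analytic_eventually_deriv[OF u(1)] analytic_eventually_deriv[OF u1]
        in eventually_elim, auto intro!: derivative_eq_intros simp: algebra_simps power2_eq_square power3_eq_cube)
  show "W 0 = 0" using z0 by simp
  show "deriv W 0 = 0" using eventually_nhds_x_imp_x[OF d1] by simp
  show "deriv (deriv W) 0 = 0" using eventually_nhds_x_imp_x[OF d2] by simp
qed

text \<open>
  Condition \<open>h\<close> says that the tangent direction \<open>(p, q)\<close> is a zero of the second
  derivative of the affine equation, as it is at a flex.
\<close>

lemma hessian_phi:
  fixes x y p q l :: complex
  assumes l: "l \<noteq> 0" "1 + l \<noteq> 0" "x^2 * y = l" and c: "x^3*y + y^3 + x = 0"
    and t: "2*x*p*y + x^2*q = 1" "(3*x^2*y + 1)*p + (x^3 + 3*y^2)*q = 0"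
    and h: "x*y*p^2 + x^2*p*q + y*q^2 = 0"
  shows "l^3 + 8*l^2 + 5*l - 1 = 0"
proof -
  define a b where "a = x^3 + 3*y^2" and "b = 3*l + 1"
  have e: "b * p + a * q = 0" using t(2) unfolding a_def b_def l(3)[symmetric] by (simp add: mult.assoc)
  have pq: "p \<noteq> 0 \<or> q \<noteq> 0" using t(1) by auto
  \<comment> \<open>The direction (p, q) is proportional to (a, - b), so the quadratic condition can
    be evaluated at (a, - b).\<close>
  have H: "x*y*a^2 - x^2*a*b + y*b^2 = 0"
  proof -
    have "p^2 * (x*y*a^2 - x^2*a*b + y*b^2) = 0" using e h by Groebner_Basis.algebra
    moreover have "q^2 * (x*y*a^2 - x^2*a*b + y*b^2) = 0" using e h by Groebner_Basis.algebra
    ultimately have "p = 0 \<or> x*y*a^2 - x^2*a*b + y*b^2 = 0" "q = 0 \<or> x*y*a^2 - x^2*a*b + y*b^2 = 0"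
      by (simp_all only: mult_eq_0_iff power_eq_0_iff) auto
    then show ?thesis using pq by auto
  qed
  have x: "x \<noteq> 0" using l(1,3) by auto
  have y3: "y^3 = - (x * (1 + l))" using c x l(3) by Groebner_Basis.algebra
  have x7: "x^7 * (1 + l) = - (l^3)"
  proof -
    have "l^3 = x^6 * y^3" unfolding l(3)[symmetric] by (simp add: power_mult_distrib power_mult[symmetric])
    moreover have "x^7 * (1 + l) = x^6 * (x * (1 + l))" by (simp add: eval_nat_numeral)
    ultimately show ?thesis unfolding y3 by simp
  qed
  \<comment> \<open>After multiplication by x^2 every term is a polynomial in l and x^7, and x^7 = -
    l^3 / (1 + l).\<close>
  have "x^2 * (x*y*a^2 - x^2*a*b + y*b^2) =
      (x^2*y)*x^7 + 6*(x^2*y)^3 + 9*x^3*y^2*y^3 - b*x^7 - 3*(x^2*y)^2*b + (x^2*y)*b^2"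
    unfolding a_def by (simp add: algebra_simps eval_nat_numeral)
  also have "\<dots> = l*x^7 + 6*l^3 - 9*(x^2*y)^2*(1 + l) - b*x^7 - 3*l^2*b + l*b^2"
    unfolding y3 l(3) by (simp add: eval_nat_numeral l(3)[symmetric])
  also have "\<dots> = l*x^7 + 6*l^3 - 9*l^2*(1 + l) - b*x^7 - 3*l^2*b + l*b^2"
    unfolding l(3) ..
  finally have E: "l*x^7 + 6*l^3 - 9*l^2*(1 + l) - b*x^7 - 3*l^2*b + l*b^2 = 0" using H by simp
  have "(1 + l) * (l*w + 6*l^3 - 9*l^2*(1 + l) - b*w - 3*l^2*b + l*b^2) =
      (l - b) * (w * (1 + l)) + (1 + l) * (6*l^3 - 9*l^2*(1 + l) - 3*l^2*b + l*b^2)" for w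
    by (simp add: algebra_simps)
  from this[of "x^7"] have "0 = (l - b) * (- (l^3)) + (1 + l) * (6*l^3 - 9*l^2*(1 + l) - 3*l^2*b + l*b^2)"
    unfolding E x7 by simp
  also have "\<dots> = - (l * (l^3 + 8*l^2 + 5*l - 1))"
    unfolding b_def by (simp add: algebra_simps power2_eq_square power3_eq_cube)
  finally have "l * (l^3 + 8*l^2 + 5*l - 1) = 0" by simp
  then show ?thesis using l(1) by simp
qed

text \<open>A flex line gives u1 x' + u2 y' = 0 and u1 x'' + u2 y'' = 0, so (x'', y'') is parallel
  to (x', y'), which is tangent to the curve. The second derivative of the curve equation then
  reduces to its quadratic part in x', y', and \<open>hessian_phi\<close> applies.\<close>

lemma flex_phi:
  assumes P: "P \<in> klein" "P \<noteq> ptA" "P \<noteq> ptB" "P \<noteq> ptC" and F: "flex P"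
  shows "phi P ^ 3 + 8 * phi P ^ 2 + 5 * phi P - 1 = 0"
proof -
  obtain y0 where y0: "phi P \<noteq> 0" "1 + phi P \<noteq> 0" "y0^7 = phi P * (1 + phi P)^2"
    "P = proj (vector [- (y0^3) / (1 + phi P), y0, 1])"
    by (rule klein_generic[OF P])
  define l where "l = phi P"
  note y = y0(1-3)[folded l_def]
  have up: "upar P (par l y0)" using par_upar[OF y] y0(4) unfolding l_def by simp
  define xc yc where "xc = (\<lambda>t. par l y0 t $ 1)" and "yc = (\<lambda>t. par l y0 t $ 2)"
  have p3: "par l y0 t $ 3 = 1" for t by (simp add: par_def Let_def)
  have xc: "xc analytic_on {0}" and yc: "yc analytic_on {0}"
    unfolding xc_def yc_def using par_analytic[OF y] by auto
  note X1 = analytic_deriv[OF xc] and Y1 = analytic_deriv[OF yc]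
  note dX = analytic_eventually_deriv[OF xc] and dY = analytic_eventually_deriv[OF yc]
    and dX1 = analytic_eventually_deriv[OF X1] and dY1 = analytic_eventually_deriv[OF Y1]
  have a: "\<forall>\<^sub>F t in nhds 0. xc t ^ 2 * yc t - (l + t) = 0"
    using par_near[OF y] by eventually_elim (simp add: xc_def yc_def)
  have b: "\<forall>\<^sub>F t in nhds 0. xc t ^ 3 * yc t + yc t ^ 3 + xc t = 0"
    using par_near[OF y] by eventually_elim (simp add: xc_def yc_def F4_def p3)
  have a1: "\<forall>\<^sub>F t in nhds 0. 2 * xc t * deriv xc t * yc t + xc t ^ 2 * deriv yc t - 1 = 0"
    by (rule eventually_deriv_zero[OF a])
      (use dX dY in eventually_elim, auto intro!: derivative_eq_intros simp: algebra_simps power2_eq_square)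
  have b1: "\<forall>\<^sub>F t in nhds 0. (3 * xc t ^ 2 * yc t + 1) * deriv xc t + (xc t ^ 3 + 3 * yc t ^ 2) * deriv yc t = 0"
    by (rule eventually_deriv_zero[OF b])
      (use dX dY in eventually_elim, auto intro!: derivative_eq_intros simp: algebra_simps power2_eq_square power3_eq_cube)
  have b2: "\<forall>\<^sub>F t in nhds 0. (3 * xc t ^ 2 * yc t + 1) * deriv (deriv xc) t + (xc t ^ 3 + 3 * yc t ^ 2) * deriv (deriv yc) t
      + 6 * (xc t * yc t * deriv xc t ^ 2 + xc t ^ 2 * deriv xc t * deriv yc t + yc t * deriv yc t ^ 2) = 0"
    by (rule eventually_deriv_zero[OF b1])
      (use dX dY dX1 dY1 in eventually_elim, auto intro!: derivative_eq_intros simp: algebra_simps power2_eq_square power3_eq_cube)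
  obtain \<gamma> u where g: "local_param klein P \<gamma>" "u \<noteq> 0" "ordge (\<lambda>t. lform u (\<gamma> t)) 3" using F unfolding flex_def by blast
  have W: "ordge (\<lambda>t. lform u (par l y0 t)) 3" by (rule lform_ord_transfer[OF up g])
  have We: "(\<lambda>t. lform u (par l y0 t)) = (\<lambda>t. u$1 * xc t + u$2 * yc t + u$3)"
    by (simp add: lform_def xc_def yc_def p3)
  have Wa: "(\<lambda>t. lform u (par l y0 t)) analytic_on {0}"
    unfolding We using xc yc by (intro analytic_intros)
  have z: "\<forall>\<^sub>F t in nhds 0. lform u (par l y0 t) - (u$1 * xc t + u$2 * yc t + u$3) = 0"
    by (simp add: fun_cong[OF We])
  have z1: "\<forall>\<^sub>F t in nhds 0. deriv (\<lambda>t. lform u (par l y0 t)) t - (u$1 * deriv xc t + u$2 * deriv yc t) = 0"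
    by (rule eventually_deriv_zero[OF z])
      (use dX dY analytic_eventually_deriv[OF Wa] in eventually_elim, auto intro!: derivative_eq_intros)
  have z2: "\<forall>\<^sub>F t in nhds 0. deriv (deriv (\<lambda>t. lform u (par l y0 t))) t
      - (u$1 * deriv (deriv xc) t + u$2 * deriv (deriv yc) t) = 0"
    by (rule eventually_deriv_zero[OF z1])
      (use dX1 dY1 analytic_eventually_deriv[OF analytic_deriv[OF Wa]] in eventually_elim, auto intro!: derivative_eq_intros)
  note W0 = ordge_3_derivs[OF Wa W]
  define x y p q p' q' where "x = xc 0" and "y = yc 0" and "p = deriv xc 0" and "q = deriv yc 0"
    and "p' = deriv (deriv xc) 0" and "q' = deriv (deriv yc) 0"
  note defs = x_def y_def p_def q_def p'_def q'_def
  have e: "\<And>a b. a - b = 0 \<Longrightarrow> a = 0 \<Longrightarrow> b = (0::complex)" by simp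
  have L: "u$1 * x + u$2 * y + u$3 = 0" "u$1 * p + u$2 * q = 0" "u$1 * p' + u$2 * q' = 0"
    unfolding defs by (rule e[OF eventually_nhds_x_imp_x[OF z] W0(1)] e[OF eventually_nhds_x_imp_x[OF z1] W0(2)]
        e[OF eventually_nhds_x_imp_x[OF z2] W0(3)])+
  have A: "x^2 * y = l" "2*x*p*y + x^2*q = 1"
    using eventually_nhds_x_imp_x[OF a] eventually_nhds_x_imp_x[OF a1] unfolding defs by auto
  have B: "x^3*y + y^3 + x = 0" "(3*x^2*y + 1)*p + (x^3 + 3*y^2)*q = 0"
    "(3*x^2*y + 1)*p' + (x^3 + 3*y^2)*q' + 6 * (x*y*p^2 + x^2*p*q + y*q^2) = 0"
    using eventually_nhds_x_imp_x[OF b] eventually_nhds_x_imp_x[OF b1] eventually_nhds_x_imp_x[OF b2] unfolding defs by auto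
  have u: "u$1 \<noteq> 0 \<or> u$2 \<noteq> 0" using L(1) g(2) by (auto simp: vec3_eq_iff)
  have pq: "p \<noteq> 0 \<or> q \<noteq> 0" using A(2) by auto
  have det: "p * q' - q * p' = 0"
  proof -
    have "u$1 * (p * q' - q * p') = 0" "u$2 * (p * q' - q * p') = 0" using L(2,3) by Groebner_Basis.algebra+
    then show ?thesis using u by auto
  qed
  have h: "x*y*p^2 + x^2*p*q + y*q^2 = 0"
  proof -
    have "p * (6 * (x*y*p^2 + x^2*p*q + y*q^2)) = 0" "q * (6 * (x*y*p^2 + x^2*p*q + y*q^2)) = 0"
      using B(2,3) det by Groebner_Basis.algebra+
    then show ?thesis using pq by (simp only: mult_eq_0_iff) auto
  qed
  show ?thesis using hessian_phi[OF y0(1,2)[folded l_def] A(1) B(1) A(2) B(2) h] unfolding l_def .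
qed

text \<open>The involution on the whole plane; \<open>sA\<close> is its restriction to the curve as
  a group element.\<close>

definition sg :: "cp2 \<Rightarrow> cp2" where "sg = lin sM"

lemma sg_abc: "sg ptA = proj (vector [g1, g2, g4])" "sg ptB = proj (vector [g2, g4, g1])"
  "sg ptC = proj (vector [g4, g1, g2])"
  unfolding sg_def ptA_def ptB_def ptC_def pt_def
  by (subst lin_proj; (intro F4sym_invertible F4sym_sM vec100_nonzero)?;
      (intro arg_cong[of _ _ proj])?; simp add: vec3_eq_iff sM_nth)+

lemma g_nonzero: "g1 \<noteq> 0" "g2 \<noteq> 0" "g4 \<noteq> 0"
  using g_relations(2) w7_nonzero by auto

lemma g_vec_nonzero: "vector [g1, g2, g4] \<noteq> (0 :: complex^3)" "vector [g2, g4, g1] \<noteq> (0 :: complex^3)"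
  "vector [g4, g1, g2] \<noteq> (0 :: complex^3)"
  using g_nonzero by (auto simp: vec3_eq_iff)

lemma sg_klein: "P \<in> klein \<Longrightarrow> sg P \<in> klein"
  unfolding sg_def by (rule lin_klein[OF F4sym_sM])

lemma sg_abc_generic: "Q \<in> {ptA, ptB, ptC} \<Longrightarrow> sg Q \<noteq> ptA \<and> sg Q \<noteq> ptB \<and> sg Q \<noteq> ptC"
  by (elim insertE emptyE; simp add: sg_abc proj_eq_abc g_vec_nonzero g_nonzero)

text \<open>The three values are conjugate under zeta -> zeta^2; they are the roots of the cubic in
  \<open>flex_phi\<close>, which is how \<open>flex_cases\<close> uses them.\<close>

lemma phi_sg:
  "phi (sg ptA) = (zeta + zeta^6) + 3 * (zeta^2 + zeta^5) + 4 * (zeta^4 + zeta^3)"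
  "phi (sg ptB) = 4 * (zeta + zeta^6) + (zeta^2 + zeta^5) + 3 * (zeta^4 + zeta^3)"
  "phi (sg ptC) = 3 * (zeta + zeta^6) + 4 * (zeta^2 + zeta^5) + (zeta^4 + zeta^3)"
proof -
  have e: "g1^2*g2 = ((zeta + zeta^6) + 3 * (zeta^2 + zeta^5) + 4 * (zeta^4 + zeta^3)) * g4^3"
    "g2^2*g4 = (4 * (zeta + zeta^6) + (zeta^2 + zeta^5) + 3 * (zeta^4 + zeta^3)) * g1^3"
    "g4^2*g1 = (3 * (zeta + zeta^6) + 4 * (zeta^2 + zeta^5) + (zeta^4 + zeta^3)) * g2^3"
    unfolding g1_def g2_def g4_def using zeta_sum by Groebner_Basis.algebra+
  show "phi (sg ptA) = (zeta + zeta^6) + 3 * (zeta^2 + zeta^5) + 4 * (zeta^4 + zeta^3)"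
    "phi (sg ptB) = 4 * (zeta + zeta^6) + (zeta^2 + zeta^5) + 3 * (zeta^4 + zeta^3)"
    "phi (sg ptC) = 3 * (zeta + zeta^6) + 4 * (zeta^2 + zeta^5) + (zeta^4 + zeta^3)"
    unfolding sg_abc phi_proj[OF g_vec_nonzero(1)] phi_proj[OF g_vec_nonzero(2)] phi_proj[OF g_vec_nonzero(3)]
    using e g_nonzero by (simp_all add: field_simps)
qed

text \<open>A flex off the vertices has the phi value of the \<open>sg\<close> image of a vertex,
  since these give all roots of the cubic; by \<open>phi_fibre\<close> it lies in the orbit of that
  image. This bounds the flexes by 3 + 3 * 7.\<close>

lemma flex_cases:
  assumes P: "P \<in> klein" and F: "flex P"
  shows "P \<in> {ptA, ptB, ptC} \<or> (\<exists>i<7. \<exists>Q\<in>{ptA, ptB, ptC}. P = gact i (sg Q))"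
proof (cases "P \<in> {ptA, ptB, ptC}")
  case False
  then have n: "P \<noteq> ptA" "P \<noteq> ptB" "P \<noteq> ptC" by auto
  define l where "l = phi P"
  have c: "l^3 + 8*l^2 + 5*l - 1 = 0" unfolding l_def by (rule flex_phi[OF P n F])
  have "(l - phi (sg ptA)) * (l - phi (sg ptB)) * (l - phi (sg ptC)) = 0"
    using c zeta_sum unfolding phi_sg by Groebner_Basis.algebra
  then have "\<exists>Q\<in>{ptA, ptB, ptC}. phi (sg Q) = phi P" unfolding l_def by simp metis
  then obtain Q where Q: "Q \<in> {ptA, ptB, ptC}" "phi (sg Q) = phi P" by blast
  have "Q \<in> klein" using Q(1) abc_in_klein by auto
  note g = sg_klein[OF this] sg_abc_generic[OF Q(1), THEN conjunct1]
    sg_abc_generic[OF Q(1), THEN conjunct2, THEN conjunct1] sg_abc_generic[OF Q(1), THEN conjunct2, THEN conjunct2]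
  have "\<exists>i<7. P = gact i (sg Q)" by (rule phi_fibre[OF g P n Q(2)])
  then show ?thesis using Q(1) by blast
qed simp

section \<open>Stabilizers of flexes\<close>

definition cA :: "cp2 \<Rightarrow> cp2" where "cA = restrict (lin cycM) klein"

lemma cA_Aut: "cA \<in> Aut" unfolding cA_def by (rule lin_restrict_Aut[OF F4sym_cycM])

lemma cA_apply: "cA ptA = ptC" "cA ptB = ptA" "cA ptC = ptB"
  by (simp_all add: cA_def lin_cycM abc_in_klein)

text \<open>By the previous result h fixes \<open>ptC\<close>, so its conjugate by \<open>cA\<close>
  fixes \<open>ptA\<close> and hence \<open>ptC\<close>; undoing the conjugation, h fixes
  \<open>ptB\<close>.\<close>

lemma Aut_fix_A_B: assumes h: "h \<in> Aut" and A: "h ptA = ptA" shows "h ptB = ptB"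
proof -
  have C: "h ptC = ptC" by (rule Aut_fix_A_C[OF h A])
  define f where "f = compose klein (ainv cA) (compose klein h cA)"
  have f: "f \<in> Aut" unfolding f_def by (intro compose_Aut ainv_Aut cA_Aut h)
  have i: "ainv cA ptC = ptA" using ainv_apply(1)[OF cA_Aut abc_in_klein(1)] by (simp add: cA_apply)
  have "f ptA = ptA" by (simp add: f_def compose_def abc_in_klein cA_apply C i)
  then have "f ptC = ptC" by (rule Aut_fix_A_C[OF f])
  then have "ainv cA (h ptB) = ptC" by (simp add: f_def compose_def abc_in_klein cA_apply)
  then have "cA (ainv cA (h ptB)) = ptB" by (simp add: cA_apply)
  then show ?thesis using ainv_apply(2)[OF cA_Aut Aut_klein[OF h abc_in_klein(2)]] by simp
qed

lemma Aut_fix_A_diag: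
  assumes h: "h \<in> Aut" and A: "h ptA = ptA"
  shows "\<exists>p q r. p \<noteq> 0 \<and> q \<noteq> 0 \<and> r \<noteq> 0 \<and>
    (\<forall>v. v \<noteq> 0 \<longrightarrow> F4 v = 0 \<longrightarrow> h (proj v) = proj (vector [p * v$1, q * v$2, r * v$3]))"
proof -
  obtain M where M: "invertible M" "\<And>P. P \<in> klein \<Longrightarrow> h P = lin M P" using Aut_linear[OF h] by blast
  define e1 e2 e3 :: "complex^3" where e: "e1 = vector [1,0,0]" "e2 = vector [0,1,0]" "e3 = vector [0,0,1]"
  have n: "e1 \<noteq> 0" "e2 \<noteq> 0" "e3 \<noteq> 0" unfolding e by (rule vec100_nonzero)+
  have m: "M *v e1 \<noteq> 0" "M *v e2 \<noteq> 0" "M *v e3 \<noteq> 0" using n by (simp_all add: invertible_nonzero[OF M(1)])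
  have "proj (M *v e1) = ptA" "proj (M *v e2) = ptB" "proj (M *v e3) = ptC"
    using A Aut_fix_A_B[OF h A] Aut_fix_A_C[OF h A] M(2)[OF abc_in_klein(1)] M(2)[OF abc_in_klein(2)]
      M(2)[OF abc_in_klein(3)] lin_proj[OF M(1) n(1)] lin_proj[OF M(1) n(2)] lin_proj[OF M(1) n(3)]
    unfolding e ptA_def ptB_def ptC_def pt_def by simp_all
  then have z: "(M *v e1)$2 = 0" "(M *v e1)$3 = 0" "(M *v e2)$1 = 0" "(M *v e2)$3 = 0" "(M *v e3)$1 = 0" "(M *v e3)$2 = 0"
    using proj_eq_abc(1)[OF m(1)] proj_eq_abc(2)[OF m(2)] proj_eq_abc(3)[OF m(3)] by auto
  define p q r where "p = (M *v e1)$1" and "q = (M *v e2)$2" and "r = (M *v e3)$3"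
  have pqr: "p \<noteq> 0" "q \<noteq> 0" "r \<noteq> 0" using m z by (auto simp: p_def q_def r_def vec3_eq_iff)
  have Mv: "M *v v = vector [p * v$1, q * v$2, r * v$3]" for v
    using z unfolding p_def q_def r_def e by (simp add: vec3_eq_iff matrix_vector_mult_def sum_3)
  have H: "h (proj v) = proj (vector [p * v$1, q * v$2, r * v$3])" if v: "v \<noteq> 0" "F4 v = 0" for v
    using M(2)[of "proj v"] lin_proj[OF M(1) v(1)] v by (simp add: proj_in_klein_iff Mv)
  show ?thesis by (intro exI[of _ p] exI[of _ q] exI[of _ r] conjI pqr allI impI H)
qed

text \<open>A diagonal matrix fixing the point \<open>sg ptA\<close>, whose coordinates are all
  nonzero, is scalar.\<close>

lemma Aut_eq_id:
  assumes h: "h \<in> Aut" and A: "h ptA = ptA" and S: "h (sg ptA) = sg ptA" and P: "P \<in> klein"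
  shows "h P = P"
proof -
  obtain p q r where d': "p \<noteq> 0 \<and> q \<noteq> 0 \<and> r \<noteq> 0 \<and>
    (\<forall>v. v \<noteq> 0 \<longrightarrow> F4 v = 0 \<longrightarrow> h (proj v) = proj (vector [p * v$1, q * v$2, r * v$3]))"
    using Aut_fix_A_diag[OF h A] by (elim exE)
  note d = d'[THEN conjunct1] d'[THEN conjunct2, THEN conjunct1] d'[THEN conjunct2, THEN conjunct2, THEN conjunct1]
    d'[THEN conjunct2, THEN conjunct2, THEN conjunct2, rule_format]
  have k: "F4 (vector [g1, g2, g4]) = 0"
    using sg_klein[OF abc_in_klein(1)] unfolding sg_abc proj_in_klein_iff[OF g_vec_nonzero(1)] .
  have "vector [p * g1, q * g2, r * g4] \<noteq> (0 :: complex^3)" using d g_nonzero by (simp add: vec3_eq_iff)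
  moreover have "proj (vector [p * g1, q * g2, r * g4]) = proj (vector [g1, g2, g4])"
    using S d(4)[OF g_vec_nonzero(1) k] unfolding sg_abc by simp
  ultimately have "p * g1 * g2 = q * g2 * g1" "q * g2 * g4 = r * g4 * g2"
    using proj_coord_eq[OF _ g_vec_nonzero(1)] by auto
  then have "p = q" "q = r" using g_nonzero by auto
  have "rep P \<noteq> 0" "F4 (rep P) = 0" using rep(1) P klein_iff_rep by auto
  from d(4)[OF this] have "h P = proj (vector [p * rep P$1, q * rep P$2, r * rep P$3])" by (simp add: rep(2))
  also have "vector [p * rep P$1, q * rep P$2, r * rep P$3] = p *s rep P"
    using \<open>p = q\<close> \<open>q = r\<close> by (simp add: vec3_eq_iff)
  finally have "h P = proj (p *s rep P)" .
  then show ?thesis using proj_scale[OF rep(1) d(1)] rep(2) by simp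
qed

lemma Aut_fix_A: assumes h: "h \<in> Aut" and A: "h ptA = ptA" shows "\<exists>k<7. h = gA k"
proof -
  obtain p q r where d': "p \<noteq> 0 \<and> q \<noteq> 0 \<and> r \<noteq> 0 \<and>
    (\<forall>v. v \<noteq> 0 \<longrightarrow> F4 v = 0 \<longrightarrow> h (proj v) = proj (vector [p * v$1, q * v$2, r * v$3]))"
    using Aut_fix_A_diag[OF h A] by (elim exE)
  note d = d'[THEN conjunct1] d'[THEN conjunct2, THEN conjunct1] d'[THEN conjunct2, THEN conjunct2, THEN conjunct1]
    d'[THEN conjunct2, THEN conjunct2, THEN conjunct2, rule_format]
  \<comment> \<open>On the curve x^3 y = l x and y^3 = - (1 + l) x when z = 1, so the equation of
    the image point, divided by x, is linear in l.\<close>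
  have eq: "p^3*q * l - q^3*r * (1 + l) + r^3*p = 0" if l: "l \<noteq> 0" "1 + l \<noteq> 0" for l
  proof -
    define y where "y = root7 (l * (1 + l)^2)"
    have y: "y^7 = l * (1 + l)^2" using l by (simp add: y_def root7_pow)
    define v :: "complex^3" where "v = vector [- (y^3) / (1 + l), y, 1]"
    note k = klein_of_phi[OF y l(2), folded v_def]
    have v: "v$3 = 1" "v$1^2 * v$2 = l" using k(3) by (simp_all add: v_def)
    define w :: "complex^3" where "w = vector [p * v$1, q * v$2, r * v$3]"
    have w: "w \<noteq> 0" using d v by (simp add: w_def vec3_eq_iff)
    have "proj w \<in> klein" using Aut_klein[OF h, of "proj v"] d(4)[OF k(2,1)] k proj_in_klein_iff[OF k(2)] by (simp add: w_def)
    then have "F4 w = 0" using proj_in_klein_iff[OF w] by simp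
    then have e: "(p * v$1)^3 * (q * v$2) + (q * v$2)^3 * r + r^3 * (p * v$1) = 0" by (simp add: F4_def w_def v)
    have F: "v$1^3 * v$2 + v$2^3 + v$1 = 0" using k(1) by (simp add: F4_def v)
    have x: "v$1 \<noteq> 0" using v(2) l(1) by auto
    have "v$1 * (p^3*q * l - q^3*r * (1 + l) + r^3*p) = 0"
      using e F v(2) by Groebner_Basis.algebra
    then show ?thesis using x by simp
  qed
  \<comment> \<open>Two values of l suffice to separate the coefficients of a linear
    expression.\<close>
  have e1: "p^3*q = q^3*r" "q^3*r = r^3*p" using eq[of 1] eq[of 2] by Groebner_Basis.algebra+
  have "r * (p * r^2) = r * q^3" using e1(2) by Groebner_Basis.algebra
  then have p: "p * r^2 = q^3" using d(3) by simp
  have "(p * r^2)^3 * q = q^3 * r^7" using e1(1) by Groebner_Basis.algebra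
  then have E: "q^3 * q^7 = q^3 * r^7" unfolding p by (simp add: eval_nat_numeral mult_ac)
  have q3: "q^3 \<noteq> 0" using d(2) by simp
  have "q^7 = r^7" by (rule iffD1[OF mult_left_cancel[OF q3] E])
  then have "(q / r)^7 = 1" using d(3) by (simp add: power_divide)
  then obtain k where k: "k < 7" "q / r = zeta ^ k" using root_of_unity_7[of "q / r"] by blast
  have q: "q = r * zeta ^ k" using k(2) d(3) by (simp add: field_simps)
  have z3: "(zeta ^ k) ^ 3 = zeta ^ (3 * k)" by (simp only: power_mult[symmetric] mult.commute)
  have p': "p = r * zeta ^ (3 * k)"
  proof -
    have "p * r^2 = r * zeta ^ (3 * k) * r^2"
      unfolding p unfolding q power_mult_distrib z3 by (simp add: power2_eq_square power3_eq_cube)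
    then show ?thesis using d(3) by simp
  qed
  have "h = gA k"
  proof (rule Aut_eqI[OF h gA_Aut])
    fix P assume P: "P \<in> klein"
    have n: "rep P \<noteq> 0" "F4 (rep P) = 0" using rep(1) P klein_iff_rep by auto
    have hz: "zeta ^ k \<noteq> 0" by (simp add: zeta_def)
    have "gM k *v rep P = (zeta ^ k / r) *s vector [p * rep P$1, q * rep P$2, r * rep P$3]"
      using d(3) unfolding p' q by (simp add: vec3_eq_iff gM_nth power_add[symmetric] mult_2)
    moreover have "vector [p * rep P$1, q * rep P$2, r * rep P$3] \<noteq> (0::complex^3)"
      using n(1) d by (auto simp: vec3_eq_iff)
    ultimately have "gact k (proj (rep P)) = proj (vector [p * rep P$1, q * rep P$2, r * rep P$3])"
      unfolding gact_proj[OF n(1)] using proj_scale[of _ "zeta ^ k / r"] d(3) hz by simp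
    then show "h P = gA k P" using d(4)[OF n] P by (simp add: rep(2) gA_def)
  qed
  then show ?thesis using k(1) by blast
qed

text \<open>These two points are the flexes of the unit vectors, so an automorphism is determined by
  the matrix through which it acts.\<close>

lemma Aut_unique:
  assumes f: "f \<in> Aut" and g: "g \<in> Aut" and e: "f ptA = g ptA" "f (sg ptA) = g (sg ptA)"
  shows "f = g"
proof -
  define h where "h = compose klein (ainv g) f"
  have h: "h \<in> Aut" unfolding h_def by (intro compose_Aut ainv_Aut f g)
  have s: "sg ptA \<in> klein" by (rule sg_klein[OF abc_in_klein(1)])
  have "h ptA = ptA" "h (sg ptA) = sg ptA"
    using e ainv_apply(1)[OF g] abc_in_klein(1) s by (simp_all add: h_def compose_def)
  then have i: "h P = P" if "P \<in> klein" for P using Aut_eq_id[OF h] that by blast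
  show ?thesis
  proof (rule Aut_eqI[OF f g])
    fix P assume P: "P \<in> klein"
    have "ainv g (f P) = P" using i[OF P] P by (simp add: h_def compose_def)
    then show "f P = g P" using ainv_apply(2)[OF g Aut_klein[OF f P]] by simp
  qed
qed

section \<open>Flexes as vectors modulo seven\<close>

text \<open>Turns statements about residues modulo 7 into finitely many evaluations by the
  simplifier.\<close>

lemma all_mod7: "(\<forall>x::7. P x) \<longleftrightarrow> P 0 \<and> P 1 \<and> P 2 \<and> P 3 \<and> P 4 \<and> P 5 \<and> P 6"
proof safe
  fix x :: 7 assume a: "P 0" "P 1" "P 2" "P 3" "P 4" "P 5" "P 6"
  show "P x"
  proof (cases x)
    case (of_int z)
    then have "z \<in> {0,1,2,3,4,5,6}" by auto
    then show ?thesis using a of_int(1) by auto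
  qed
qed auto

definition idx :: "7 \<Rightarrow> nat" where
  "idx x = (if x = 0 then 0 else if x = 1 then 1 else if x = 2 then 2 else if x = 3 then 3
     else if x = 4 then 4 else if x = 5 then 5 else 6)"

lemma idx_less: "idx x < 7" by (simp add: idx_def)

lemma idx_add: "(idx x + idx y) mod 7 = idx (x + y)"
proof -
  have "\<forall>x y. (idx x + idx y) mod 7 = idx (x + y)" unfolding all_mod7 by (simp add: idx_def)
  then show ?thesis by blast
qed

lemma idx_of_nat: assumes "i < 7" shows "idx (of_nat i) = i"
proof -
  have "i \<in> {0,1,2,3,4,5,6}" using assms by auto
  then show ?thesis by (auto simp: idx_def)
qed

text \<open>Fermat's theorem x^6 = 1; the fifth power serves as the inverse throughout.\<close>

lemma inverse_mod7: "x \<noteq> 0 \<Longrightarrow> x * x ^ 5 = (1 :: 7)"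
proof -
  have "\<forall>x::7. x \<noteq> 0 \<longrightarrow> x * x ^ 5 = 1" unfolding all_mod7 by simp
  then show "x \<noteq> 0 \<Longrightarrow> x * x ^ 5 = (1 :: 7)" by blast
qed

lemma mult_mod7_eq_0: "x * y = 0 \<longleftrightarrow> x = 0 \<or> y = (0 :: 7)"
proof
  assume e: "x * y = 0"
  show "x = 0 \<or> y = 0"
  proof (rule disjCI)
    assume "y \<noteq> 0"
    then have "x = x * (y * y ^ 5)" using inverse_mod7[of y] by simp
    also have "\<dots> = (x * y) * y ^ 5" by (simp only: mult.assoc)
    finally show "x = 0" using e by simp
  qed
qed auto

lemma gact_mod: "gact (i mod 7) P = gact i P"
  using gact_add[of "i mod 7" "7 * (i div 7)" P] by (simp add: gact_7)

definition gz :: "7 \<Rightarrow> cp2 \<Rightarrow> cp2" where "gz x = gact (idx x)"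

lemma gz_add: "gz (x + y) P = gz x (gz y P)"
  unfolding gz_def idx_add[symmetric] gact_mod gact_add ..

lemma gz_0: "gz 0 P = P" by (simp add: gz_def idx_def gact_0)

lemma gz_1: "gz 1 P = gact 1 P" by (simp add: gz_def idx_def)

lemma gz_abc: "gz x ptA = ptA" "gz x ptB = ptB" "gz x ptC = ptC"
  unfolding gz_def using gact_abc by blast+

lemma sg_sg: "sg (sg P) = P"
proof -
  obtain v where v: "v \<noteq> 0" "P = proj v" by (rule proj_cases)
  have M: "invertible sM" by (rule F4sym_invertible[OF F4sym_sM])
  have "sg (sg P) = proj (sM *v (sM *v v))"
    unfolding sg_def v(2) using lin_proj[OF M v(1)] lin_proj[OF M, of "sM *v v"] v(1) by (simp add: invertible_nonzero[OF M])
  also have "\<dots> = P" unfolding sM_sM v(2) by (rule proj_scale[OF v(1)]) simp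
  finally show ?thesis .
qed

text \<open>Labels the vertices by nonzero residues up to sign: 1, 6 for \<open>ptA\<close>, 2, 5
  for \<open>ptC\<close>, 3, 4 for \<open>ptB\<close>. The value at 0 is a default.\<close>

definition pt3 :: "7 \<Rightarrow> cp2" where
  "pt3 x = (if x = 1 \<or> x = 6 then ptA else if x = 2 \<or> x = 5 then ptC else ptB)"

lemma pt3_abc: "pt3 x \<in> {ptA, ptB, ptC}" by (simp add: pt3_def)

lemma pt3_klein: "pt3 x \<in> klein" using pt3_abc[of x] abc_in_klein by auto

lemma pt3_minus: "pt3 (- x) = pt3 x"
proof -
  have "\<forall>x. pt3 (- x) = pt3 x" unfolding all_mod7 by (simp add: pt3_def)
  then show ?thesis by blast
qed

lemma gz_pt3: "gz x (pt3 y) = pt3 y" using pt3_abc[of y] gz_abc by auto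

text \<open>
  The flex attached to a nonzero vector; vectors are identified up to sign. The diagonal
  symmetry and the involution act on these flexes as the matrices \<open>matT\<close> and \<open>matS\<close> below.
\<close>

definition pfl :: "7 ^ 2 \<Rightarrow> cp2" where
  "pfl v = (if v$2 = 0 then pt3 (v$1) else gz (v$1 * v$2 ^ 5) (sg (pt3 (v$2))))"

lemma pfl_klein: "pfl v \<in> klein"
  unfolding pfl_def gz_def by (auto intro!: gact_klein sg_klein pt3_klein)

lemma zeta_mod: "zeta ^ (n mod 7) = zeta ^ n"
proof -
  have "zeta ^ n = zeta ^ (n mod 7 + 7 * (n div 7))" by simp
  also have "\<dots> = zeta ^ (n mod 7)" unfolding power_add power_mult by simp
  finally show ?thesis ..
qed

text \<open>Equality of points is spelled out as three cross products, with exponents of zeta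
  reduced modulo 7 so that the resulting polynomial identities stay small.\<close>

lemma sg_gact_sg:
  fixes a b c d e f :: complex and i k :: nat
  defines "p \<equiv> zeta ^ (4 * i mod 7) * a" and "q \<equiv> zeta ^ (2 * i mod 7) * b" and "r \<equiv> zeta ^ (i mod 7) * c"
    and "u \<equiv> zeta ^ (4 * k mod 7) * d" and "v \<equiv> zeta ^ (2 * k mod 7) * e" and "w \<equiv> zeta ^ (k mod 7) * f"
  assumes n: "vector [a, b, c] \<noteq> (0 :: complex^3)" "vector [d, e, f] \<noteq> (0 :: complex^3)"
    and e: "(g1 * p + g2 * q + g4 * r) * v = (g2 * p + g4 * q + g1 * r) * u"
      "(g2 * p + g4 * q + g1 * r) * w = (g4 * p + g1 * q + g2 * r) * v"
      "(g4 * p + g1 * q + g2 * r) * u = (g1 * p + g2 * q + g4 * r) * w"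
  shows "sg (gact i (proj (vector [a, b, c]))) = gact k (proj (vector [d, e, f]))"
proof -
  have M: "invertible sM" by (rule F4sym_invertible[OF F4sym_sM])
  have n': "gM i *v vector [a, b, c] \<noteq> 0" "gM k *v vector [d, e, f] \<noteq> 0" using n by (simp_all add: gM_nonzero)
  have n'': "sM *v (gM i *v vector [a, b, c]) \<noteq> 0" using n'(1) by (simp add: invertible_nonzero[OF M])
  show ?thesis
    unfolding gact_proj[OF n(1)] gact_proj[OF n(2)] sg_def lin_proj[OF M n'(1)] proj_coord_eq[OF n'' n'(2)]
    unfolding sM_nth gM_nth vector_3 using e unfolding p_def q_def r_def u_def v_def w_def zeta_mod by blast
qed

text \<open>On vectors this sends (m j, j) to (- j, m j), whose ratio is - 1 / m = 6 m^5. The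
  eighteen cases are polynomial identities in zeta modulo \<open>zeta_sum\<close>.\<close>

lemma sg_gz_sg:
  assumes "m \<noteq> 0" "j \<noteq> 0"
  shows "sg (gz m (sg (pt3 j))) = gz (6 * m ^ 5) (sg (pt3 (m * j)))"
proof -
  note s = sg_gact_sg[OF g_vec_nonzero(1,1)] sg_gact_sg[OF g_vec_nonzero(1,2)] sg_gact_sg[OF g_vec_nonzero(1,3)]
    sg_gact_sg[OF g_vec_nonzero(2,1)] sg_gact_sg[OF g_vec_nonzero(2,2)] sg_gact_sg[OF g_vec_nonzero(2,3)]
    sg_gact_sg[OF g_vec_nonzero(3,1)] sg_gact_sg[OF g_vec_nonzero(3,2)] sg_gact_sg[OF g_vec_nonzero(3,3)]
  have e: "sg (gact 1 (sg ptA)) = gact 6 (sg ptA)"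
    "sg (gact 1 (sg ptC)) = gact 6 (sg ptC)"
    "sg (gact 1 (sg ptB)) = gact 6 (sg ptB)"
    "sg (gact 2 (sg ptA)) = gact 3 (sg ptC)"
    "sg (gact 2 (sg ptC)) = gact 3 (sg ptB)"
    "sg (gact 2 (sg ptB)) = gact 3 (sg ptA)"
    "sg (gact 3 (sg ptA)) = gact 2 (sg ptB)"
    "sg (gact 3 (sg ptC)) = gact 2 (sg ptA)"
    "sg (gact 3 (sg ptB)) = gact 2 (sg ptC)"
    "sg (gact 4 (sg ptA)) = gact 5 (sg ptB)"
    "sg (gact 4 (sg ptC)) = gact 5 (sg ptA)"
    "sg (gact 4 (sg ptB)) = gact 5 (sg ptC)"
    "sg (gact 5 (sg ptA)) = gact 4 (sg ptC)"
    "sg (gact 5 (sg ptC)) = gact 4 (sg ptB)"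
    "sg (gact 5 (sg ptB)) = gact 4 (sg ptA)"
    "sg (gact 6 (sg ptA)) = gact 1 (sg ptA)"
    "sg (gact 6 (sg ptC)) = gact 1 (sg ptC)"
    "sg (gact 6 (sg ptB)) = gact 1 (sg ptB)"
    unfolding sg_abc by (rule s; simp; unfold g1_def g2_def g4_def; insert zeta_sum; Groebner_Basis.algebra)+
  have "\<forall>m j. m \<noteq> 0 \<longrightarrow> j \<noteq> 0 \<longrightarrow> sg (gz m (sg (pt3 j))) = gz (6 * m ^ 5) (sg (pt3 (m * j)))"
    unfolding all_mod7 by (simp add: gz_def idx_def pt3_def e del: One_nat_def)
  then show ?thesis using assms by blast
qed

definition matT :: "7 ^ 2 ^ 2" where "matT = vector [vector [1, 1], vector [0, 1]]"
definition matS :: "7 ^ 2 ^ 2" where "matS = vector [vector [0, -1], vector [1, 0]]"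

lemma mat2_nth: "(A *v v) $ 1 = A$1$1 * v$1 + A$1$2 * v$2" "(A *v v) $ 2 = A$2$1 * v$1 + A$2$2 * v$2"
  for A :: "7 ^ 2 ^ 2"
  by (simp_all add: matrix_vector_mult_def sum_2)

lemma mat2_mult_nth: "(A ** B) $ i $ j = A$i$1 * B$1$j + A$i$2 * B$2$j" for A B :: "7 ^ 2 ^ 2"
  by (simp add: matrix_matrix_mult_def sum_2)

lemma mat2_eq_iff: "A = B \<longleftrightarrow> A$1$1 = B$1$1 \<and> A$1$2 = B$1$2 \<and> A$2$1 = B$2$1 \<and> A$2$2 = B$2$2"
  for A B :: "7 ^ 2 ^ 2"
  by (auto simp: vec_eq_iff forall_2)

lemma vec2_eq_iff: "v = w \<longleftrightarrow> v$1 = w$1 \<and> v$2 = w$2" for v w :: "7 ^ 2"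
  by (auto simp: vec_eq_iff forall_2)

lemma pfl_matT: "pfl (matT *v v) = gact 1 (pfl v)"
proof (cases "v$2 = 0")
  case True
  then show ?thesis using gz_pt3[of 1 "v$1"] by (simp add: pfl_def mat2_nth matT_def gz_1)
next
  case False
  have "(v$1 + v$2) * v$2 ^ 5 = 1 + v$1 * v$2 ^ 5" using inverse_mod7[OF False] by (simp add: algebra_simps)
  then show ?thesis using False gz_add[of 1 "v$1 * v$2 ^ 5"] by (simp add: pfl_def mat2_nth matT_def gz_1)
qed

lemma pfl_matS: assumes "v \<noteq> 0" shows "pfl (matS *v v) = sg (pfl v)"
proof -
  have n: "(matS *v v) $ 1 = - (v$2)" "(matS *v v) $ 2 = v$1" by (simp_all add: mat2_nth matS_def)
  consider "v$2 = 0" "v$1 \<noteq> 0" | "v$2 \<noteq> 0" "v$1 = 0" | "v$2 \<noteq> 0" "v$1 \<noteq> 0" using assms by (auto simp: vec2_eq_iff)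
  then show ?thesis
  proof cases
    case 1
    then show ?thesis by (simp add: pfl_def n gz_0)
  next
    case 2
    then show ?thesis by (simp add: pfl_def n gz_0 sg_sg pt3_minus)
  next
    case 3
    define m where "m = v$1 * v$2 ^ 5"
    have "v$1 = v$1 * (v$2 * v$2 ^ 5)" using inverse_mod7[OF 3(1)] by simp
    also have "\<dots> = m * v$2" by (simp only: m_def mult_ac)
    finally have "v$1 = m * v$2" .
    have "v$2 ^ 5 \<noteq> 0" using inverse_mod7[OF 3(1)] by auto
    then have m: "m \<noteq> 0" using 3 by (simp add: m_def mult_mod7_eq_0)
    have "\<forall>x y::7. x \<noteq> 0 \<longrightarrow> y \<noteq> 0 \<longrightarrow> 6 * (x * y ^ 5) ^ 5 = - y * x ^ 5" unfolding all_mod7 by simp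
    then have k: "6 * m ^ 5 = - (v$2) * v$1 ^ 5" unfolding m_def using 3 by blast
    show ?thesis using sg_gz_sg[OF m 3(1)] 3 unfolding k \<open>v$1 = m * v$2\<close>[symmetric]
      by (simp add: pfl_def n m_def[symmetric])
  qed
qed

text \<open>Invariance of the class of \<open>Th\<close> is carried along so that it spreads from
  generators to the whole group by \<open>acts_as_mult\<close>.\<close>

definition acts_as :: "(cp2 \<Rightarrow> cp2) \<Rightarrow> 7 ^ 2 ^ 2 \<Rightarrow> bool" where
  "acts_as f A \<longleftrightarrow> f \<in> Aut \<and> det A = 1 \<and> (\<forall>v. v \<noteq> 0 \<longrightarrow> f (pfl v) = pfl (A *v v)) \<and> pull f Th - Th \<in> PD"

lemma acts_asD: "acts_as f A \<Longrightarrow> f \<in> Aut" "acts_as f A \<Longrightarrow> det A = 1"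
  "acts_as f A \<Longrightarrow> v \<noteq> 0 \<Longrightarrow> f (pfl v) = pfl (A *v v)" "acts_as f A \<Longrightarrow> pull f Th - Th \<in> PD"
  unfolding acts_as_def by blast+

lemma det_matTS: "det matT = 1" "det matS = 1" by (simp_all add: det_2 matT_def matS_def)

lemma acts_as_T: "acts_as (gA 1) matT"
  unfolding acts_as_def
  by (intro conjI gA_Aut Th_gA det_matTS allI impI) (simp add: pfl_matT gA_def pfl_klein del: One_nat_def)

lemma acts_as_S: "acts_as sA matS"
  unfolding acts_as_def
  by (intro conjI sA_Aut Th_sA det_matTS allI impI) (simp add: pfl_matS sA_def pfl_klein sg_def[symmetric])

lemma adjugate2:
  assumes "det (A :: 7 ^ 2 ^ 2) = 1"
  shows "vector [vector [A$2$2, - (A$1$2)], vector [- (A$2$1), A$1$1]] ** A = mat 1"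
    "det (vector [vector [A$2$2, - (A$1$2)], vector [- (A$2$1), A$1$1]] :: 7 ^ 2 ^ 2) = 1"
  using assms by (simp_all add: mat2_eq_iff mat2_mult_nth det_2 mat_def algebra_simps)

lemma det1_nonzero: assumes "det (A :: 7 ^ 2 ^ 2) = 1" "v \<noteq> 0" shows "A *v v \<noteq> 0"
proof
  assume z: "A *v v = 0"
  have "v = (vector [vector [A$2$2, - (A$1$2)], vector [- (A$2$1), A$1$1]] ** A) *v v"
    unfolding adjugate2(1)[OF assms(1)] by simp
  also have "\<dots> = 0" unfolding matrix_vector_mul_assoc[symmetric] z by simp
  finally show False using assms(2) by simp
qed

lemma acts_as_mult:
  assumes f: "acts_as f A" and g: "acts_as g B" shows "acts_as (compose klein f g) (A ** B)"
  unfolding acts_as_def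
proof (intro conjI allI impI)
  note F = acts_asD(1)[OF f] and G = acts_asD(1)[OF g]
  show "compose klein f g \<in> Aut" by (rule compose_Aut[OF F G])
  show "det (A ** B) = 1" using acts_asD(2)[OF f] acts_asD(2)[OF g] by (simp add: det_mul)
  show "compose klein f g (pfl v) = pfl ((A ** B) *v v)" if v: "v \<noteq> 0" for v
    using acts_asD(3)[OF f det1_nonzero[OF acts_asD(2)[OF g] v]] acts_asD(3)[OF g v]
    by (simp add: compose_def pfl_klein matrix_vector_mul_assoc)
  have E: "pull (compose klein f g) Th - Th = pull g (pull f Th - Th) + (pull g Th - Th)"
    unfolding pull_compose[OF F G keys_Th] pull_diff by simp
  show "pull (compose klein f g) Th - Th \<in> PD"
    unfolding E by (rule PD_add[OF PD_pull[OF G acts_asD(4)[OF f]] acts_asD(4)[OF g]])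
qed

section \<open>The special linear group\<close>

definition acting :: "(7 ^ 2 ^ 2) set" where "acting = {A. \<exists>f. acts_as f A}"

lemma acting_mult: "A \<in> acting \<Longrightarrow> B \<in> acting \<Longrightarrow> A ** B \<in> acting"
  unfolding acting_def by (auto intro: acts_as_mult)

definition upper :: "7 \<Rightarrow> 7 ^ 2 ^ 2" where "upper x = vector [vector [1, x], vector [0, 1]]"

lemma acts_as_upper: "i < 7 \<Longrightarrow> acts_as (gA i) (upper (of_nat i))"
proof (induction i)
  case 0
  have "upper 0 = mat 1" by (simp add: upper_def mat2_eq_iff mat_def)
  moreover have "acts_as (gA 0) (mat 1)"
    unfolding acts_as_def by (intro conjI gA_Aut Th_gA allI impI) (simp_all add: gA_def gact_0 pfl_klein)
  ultimately show ?case by simp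
next
  case (Suc i)
  have c: "compose klein (gA 1) (gA i) = gA (1 + i)"
    by (simp add: compose_def gA_def gact_klein restrict_def fun_eq_iff gact_add del: One_nat_def plus_1_eq_Suc)
  have m: "matT ** upper (of_nat i) = upper (of_nat (1 + i))"
    by (simp add: matT_def upper_def mat2_eq_iff mat2_mult_nth)
  have "acts_as (gA i) (upper (of_nat i))" by (rule Suc.IH) (use Suc.prems in simp)
  from acts_as_mult[OF acts_as_T this] show ?case unfolding c m plus_1_eq_Suc .
qed

lemma of_nat_idx: "of_nat (idx x) = x"
proof -
  have "\<forall>x. of_nat (idx x) = x" unfolding all_mod7 by (simp add: idx_def)
  then show ?thesis by blast
qed

lemma upper_acting: "upper x \<in> acting"
  unfolding acting_def using acts_as_upper[OF idx_less, of x] unfolding of_nat_idx by blast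

lemma matS_acting: "matS \<in> acting" unfolding acting_def using acts_as_S by blast

text \<open>With lower left entry c nonzero, A is upper times lower times upper unipotent, with x =
  (a - 1) / c and y = (d - 1) / c for the diagonal entries a and d. The lower factor is the
  conjugate of \<open>upper (- c)\<close> by \<open>matS\<close>, whose inverse is its cube.\<close>

lemma SL27_acting_aux: assumes d: "det A = 1" and c: "A$2$1 \<noteq> 0" shows "A \<in> acting"
proof -
  define x y where "x = (A$1$1 - 1) * A$2$1 ^ 5" and "y = (A$2$2 - 1) * A$2$1 ^ 5"
  have i: "A$2$1 * A$2$1 ^ 5 = 1" by (rule inverse_mod7[OF c])
  have "x * A$2$1 = (A$1$1 - 1) * (A$2$1 * A$2$1 ^ 5)" "A$2$1 * y = (A$2$2 - 1) * (A$2$1 * A$2$1 ^ 5)"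
    by (simp_all only: x_def y_def mult_ac)
  then have xc: "x * A$2$1 = A$1$1 - 1" and yc: "A$2$1 * y = A$2$2 - 1" unfolding i by simp_all
  have "A$1$2 = (A$1$2 * A$2$1) * A$2$1 ^ 5" using i by (simp add: mult.assoc)
  also have "A$1$2 * A$2$1 = (A$1$1 * A$2$2 - 1)" using d by (simp add: det_2 algebra_simps)
  also have "(A$1$1 * A$2$2 - 1) * A$2$1 ^ 5 = A$1$1 * y + x" by (simp add: x_def y_def algebra_simps)
  finally have b: "A$1$2 = A$1$1 * y + x" .
  have "A = upper x ** (matS ** (upper (- (A$2$1)) ** (matS ** (matS ** matS)))) ** upper y"
    using xc yc b by (simp add: mat2_eq_iff mat2_mult_nth upper_def matS_def algebra_simps)
  then show ?thesis using upper_acting matS_acting acting_mult by metis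
qed

text \<open>If the lower left entry is 0, multiplication by \<open>matS\<close> moves the nonzero
  upper left entry there; the fourth power of \<open>matS\<close> is 1.\<close>

lemma SL27_acting: assumes d: "det A = 1" shows "A \<in> acting"
proof (cases "A$2$1 = 0")
  case True
  then have "A$1$1 \<noteq> 0" using d by (auto simp: det_2)
  moreover have "det (matS ** A) = 1" using d by (simp add: det_mul det_2[of matS]) (simp add: matS_def)
  ultimately have "matS ** A \<in> acting" by (intro SL27_acting_aux) (simp_all add: mat2_mult_nth matS_def)
  moreover have "A = matS ** (matS ** (matS ** (matS ** A)))"
    by (simp add: mat2_eq_iff mat2_mult_nth matS_def)
  ultimately show ?thesis using matS_acting acting_mult by metis
qed (rule SL27_acting_aux[OF d])

lemma pfl_unit: "pfl (vector [1, 0]) = ptA" "pfl (vector [0, 1]) = sg ptA"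
  by (simp_all add: pfl_def pt3_def gz_0)

lemma unit_nonzero: "vector [1, 0] \<noteq> (0 :: 7 ^ 2)" "vector [0, 1] \<noteq> (0 :: 7 ^ 2)"
  by (simp_all add: vec2_eq_iff)

lemma acts_as_unique: "acts_as f A \<Longrightarrow> acts_as g A \<Longrightarrow> f = g"
  using acts_asD(3)[of f A "vector [1, 0]"] acts_asD(3)[of g A "vector [1, 0]"]
    acts_asD(3)[of f A "vector [0, 1]"] acts_asD(3)[of g A "vector [0, 1]"] acts_asD(1)
  by (intro Aut_unique) (auto simp: pfl_unit unit_nonzero)

definition rho :: "7 ^ 2 ^ 2 \<Rightarrow> cp2 \<Rightarrow> cp2" where "rho A = (THE f. acts_as f A)"

lemma rho_acts: assumes "det A = 1" shows "acts_as (rho A) A"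
proof -
  obtain f where f: "acts_as f A" using SL27_acting[OF assms] unfolding acting_def by blast
  then have "rho A = f" unfolding rho_def using acts_as_unique by (intro the_equality) blast+
  then show ?thesis using f by simp
qed

lemma rho_eq: "acts_as f A \<Longrightarrow> rho A = f"
  using acts_as_unique rho_acts acts_asD(2) by blast

lemma flex_pfl: assumes "P \<in> klein" "flex P" shows "\<exists>v. v \<noteq> 0 \<and> P = pfl v"
proof -
  have three: "\<exists>j. j \<noteq> 0 \<and> pt3 j = Q" if "Q \<in> {ptA, ptB, ptC}" for Q
  proof -
    have p: "(1::7) \<noteq> 0 \<and> pt3 1 = ptA" "(2::7) \<noteq> 0 \<and> pt3 2 = ptC" "(3::7) \<noteq> 0 \<and> pt3 3 = ptB" by (simp_all add: pt3_def)
    from that show ?thesis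
    proof (elim insertE emptyE)
      assume "Q = ptA" show ?thesis unfolding \<open>Q = ptA\<close> using p(1) by (rule exI)
    next
      assume "Q = ptB" show ?thesis unfolding \<open>Q = ptB\<close> using p(3) by (rule exI)
    next
      assume "Q = ptC" show ?thesis unfolding \<open>Q = ptC\<close> using p(2) by (rule exI)
    qed
  qed
  from flex_cases[OF assms] show ?thesis
  proof
    assume "P \<in> {ptA, ptB, ptC}"
    from three[OF this] obtain j where "j \<noteq> 0" "pt3 j = P" by blast
    then show ?thesis by (intro exI[of _ "vector [j, 0]"]) (simp add: pfl_def vec2_eq_iff)
  next
    assume "\<exists>i<7. \<exists>Q\<in>{ptA, ptB, ptC}. P = gact i (sg Q)"
    then obtain i Q where i: "i < 7" "Q \<in> {ptA, ptB, ptC}" "P = gact i (sg Q)" by blast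
    from three[OF i(2)] obtain j where j: "j \<noteq> 0" "pt3 j = Q" by blast
    have "of_nat i * j * j ^ 5 = of_nat i" using inverse_mod7[OF j(1)] by (simp add: mult.assoc)
    then show ?thesis using i j
      by (intro exI[of _ "vector [of_nat i * j, j]"]) (simp add: pfl_def vec2_eq_iff gz_def idx_of_nat)
  qed
qed

text \<open>The image of \<open>ptA\<close> is a flex and so belongs to some vector w. Composing
  with the inverse of the automorphism of a matrix of first column w and determinant 1 gives an
  automorphism fixing \<open>ptA\<close>, which is a power of the order 7 symmetry.\<close>

lemma Aut_acts_as: assumes f: "f \<in> Aut" shows "\<exists>A. acts_as f A"
proof -
  obtain w where w: "w \<noteq> 0" "f ptA = pfl w"
    using flex_pfl[OF Aut_klein[OF f abc_in_klein(1)] flex_image[OF f flex_ptA]] by blast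
  have "\<exists>B. det B = 1 \<and> B *v vector [1, 0] = w"
  proof (cases "w$1 = 0")
    case True
    then have "w$2 \<noteq> 0" using w(1) by (simp add: vec2_eq_iff)
    then show ?thesis using True inverse_mod7[of "w$2"]
      by (intro exI[of _ "vector [vector [0, - (w$2 ^ 5)], vector [w$2, 0]]"])
        (simp add: det_2 vec2_eq_iff mat2_nth mult.commute)
  next
    case False
    then show ?thesis using inverse_mod7[of "w$1"]
      by (intro exI[of _ "vector [vector [w$1, 0], vector [w$2, w$1 ^ 5]]"])
        (simp add: det_2 vec2_eq_iff mat2_nth)
  qed
  then obtain B where B: "det B = 1" "B *v vector [1, 0] = w" by blast
  note r = rho_acts[OF B(1)]
  have R: "rho B \<in> Aut" "rho B ptA = f ptA"
    using acts_asD(1)[OF r] acts_asD(3)[OF r unit_nonzero(1)] by (simp_all add: B(2) w(2) pfl_unit)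
  define h where "h = compose klein (ainv (rho B)) f"
  have h: "h \<in> Aut" unfolding h_def by (intro compose_Aut ainv_Aut R f)
  have "h ptA = ptA" using ainv_apply(1)[OF R(1) abc_in_klein(1)] R(2) by (simp add: h_def compose_def abc_in_klein)
  then obtain k where k: "k < 7" "h = gA k" using Aut_fix_A[OF h] by blast
  have "compose klein (rho B) h = f"
  proof (rule Aut_eqI[OF compose_Aut[OF R(1) h] f])
    fix P assume P: "P \<in> klein"
    show "compose klein (rho B) h P = f P"
      using P ainv_apply(2)[OF R(1) Aut_klein[OF f P]] by (simp add: h_def compose_def)
  qed
  then show ?thesis using acts_as_mult[OF r acts_as_upper[OF k(1)]] k(2) by auto
qed

text \<open>Fixing the flex of the first unit vector forces a first column (1, 0) up to sign. Fixing
  that of the second then makes the upper right entry vanish, because the order 7 symmetry acts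
  freely off the vertices.\<close>

lemma acts_as_id_iff: "acts_as (\<lambda>P\<in>klein. P) A \<longleftrightarrow> A \<in> {mat 1, - mat 1}"
proof
  assume a: "acts_as (\<lambda>P\<in>klein. P) A"
  have e: "pfl (A *v v) = pfl v" if "v \<noteq> 0" for v using acts_asD(3)[OF a that] pfl_klein[of v] by simp
  note d = acts_asD(2)[OF a, unfolded det_2]
  have e1: "pfl (A *v vector [1, 0]) = ptA" using e[OF unit_nonzero(1)] by (simp add: pfl_unit)
  have c: "A$2$1 = 0"
  proof (rule ccontr)
    assume c: "A$2$1 \<noteq> 0"
    then have "gz (A$1$1 * A$2$1 ^ 5) (sg (pt3 (A$2$1))) = ptA" using e1 by (simp add: pfl_def mat2_nth)
    then show False using sg_abc_generic[OF pt3_abc[of "A$2$1"]] gact_abc(1) unfolding gz_def by blast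
  qed
  have "pt3 (A$1$1) = ptA" using e1 c by (simp add: pfl_def mat2_nth)
  then have a1: "A$1$1 = 1 \<or> A$1$1 = 6" using abc_distinct by (auto simp: pt3_def split: if_splits)
  have s: "\<forall>x y::7. (x = 1 \<or> x = 6) \<longrightarrow> x * y = 1 \<longrightarrow> y = x" unfolding all_mod7 by simp
  have "A$1$1 * A$2$2 = 1" using d c by simp
  with s a1 have d2: "A$2$2 = A$1$1" by blast
  have n: "A$2$2 \<noteq> 0" "pt3 (A$2$2) = ptA" using a1 d2 by (auto simp: pt3_def)
  have "pfl (A *v vector [0, 1]) = gz (A$1$2 * A$2$2 ^ 5) (sg (pt3 (A$2$2)))"
    using n(1) by (simp add: pfl_def mat2_nth)
  then have "gz (A$1$2 * A$2$2 ^ 5) (sg ptA) = sg ptA"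
    using e[OF unit_nonzero(2)] unfolding n(2) pfl_unit(2) by (rule trans[OF sym])
  moreover have "\<not> special (sg ptA)" using sg_abc_generic[of ptA] by (simp add: special_def)
  ultimately have "idx (A$1$2 * A$2$2 ^ 5) = 0"
    using gact_free[OF sg_klein[OF abc_in_klein(1)], of "idx (A$1$2 * A$2$2 ^ 5)" 0] idx_less by (simp add: gz_def gact_0)
  then have "A$1$2 * A$2$2 ^ 5 = 0" by (simp add: idx_def split: if_splits)
  moreover have "A$2$2 ^ 5 \<noteq> 0" using inverse_mod7[OF n(1)] by auto
  ultimately have b: "A$1$2 = 0" by (simp add: mult_mod7_eq_0)
  have "(6::7) = - 1" by simp
  then show "A \<in> {mat 1, - mat 1}" using a1 b c d2 by (auto simp: mat2_eq_iff mat_def)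
next
  have m: "pfl (- v) = pfl v" for v
  proof -
    have "\<forall>x y::7. - x * (- y) ^ 5 = x * y ^ 5" unfolding all_mod7 by simp
    then show ?thesis unfolding pfl_def by (simp add: pt3_minus del: mult_minus_left)
  qed
  have T: "pull (\<lambda>P\<in>klein. P) Th - Th \<in> PD"
    unfolding gA_0[symmetric] by (rule Th_gA)
  assume "A \<in> {mat 1, - mat 1}"
  moreover have "(- mat 1 :: 7^2^2) *v v = - v" for v by (simp add: vec2_eq_iff mat2_nth mat_def)
  moreover have "det (mat 1 :: 7^2^2) = 1" "det (- mat 1 :: 7^2^2) = 1" by (simp_all add: det_2 mat_def)
  ultimately show "acts_as (\<lambda>P\<in>klein. P) A" unfolding acts_as_def using id_Aut T by (auto simp: pfl_klein m)
qed

section \<open>The isomorphism with PSL(2,7)\<close>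

lemma group_SL27: "group SL27"
proof (rule groupI)
  show "\<exists>B\<in>carrier SL27. B \<otimes>\<^bsub>SL27\<^esub> A = \<one>\<^bsub>SL27\<^esub>" if "A \<in> carrier SL27" for A
    using adjugate2[of A] that by (auto simp: SL27_def)
qed (auto simp: SL27_def det_mul matrix_mul_assoc)

theorem aut_iso_PSL27: "aut_group klein \<cong> PSL27"
proof -
  interpret group_hom SL27 "aut_group klein" rho
  proof (intro group_hom.intro group_SL27 group_aut group_hom_axioms.intro homI)
    show "rho A \<in> carrier (aut_group klein)" if "A \<in> carrier SL27" for A
      using acts_asD(1)[OF rho_acts] that by (simp add: SL27_def aut_carrier)
    show "rho (A \<otimes>\<^bsub>SL27\<^esub> B) = rho A \<otimes>\<^bsub>aut_group klein\<^esub> rho B"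
      if "A \<in> carrier SL27" "B \<in> carrier SL27" for A B
    proof -
      have A: "acts_as (rho A) A" and B: "acts_as (rho B) B" using that rho_acts by (auto simp: SL27_def)
      show ?thesis unfolding aut_mult[OF acts_asD(1)[OF A] acts_asD(1)[OF B]]
        using rho_eq[OF acts_as_mult[OF A B]] by (simp add: SL27_def)
    qed
  qed
  have s: "rho ` carrier SL27 = carrier (aut_group klein)"
  proof (intro equalityI subsetI)
    fix f assume "f \<in> carrier (aut_group klein)"
    then obtain A where A: "acts_as f A" using Aut_acts_as by (auto simp: aut_carrier)
    then show "f \<in> rho ` carrier SL27" using rho_eq[OF A] acts_asD(2)[OF A] by (auto simp: SL27_def)
  qed (use hom_closed in blast)
  have k: "kernel SL27 (aut_group klein) rho = {mat 1, - mat 1}"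
  proof (intro equalityI subsetI)
    fix A assume "A \<in> kernel SL27 (aut_group klein) rho"
    then have "det A = 1" "rho A = (\<lambda>P\<in>klein. P)" by (auto simp: kernel_def SL27_def aut_one)
    then have "acts_as (\<lambda>P\<in>klein. P) A" using rho_acts[of A] by simp
    then show "A \<in> {mat 1, - mat 1}" by (simp only: acts_as_id_iff)
  next
    fix A :: "7^2^2" assume "A \<in> {mat 1, - mat 1}"
    then have "acts_as (\<lambda>P\<in>klein. P) A" by (simp only: acts_as_id_iff)
    then show "A \<in> kernel SL27 (aut_group klein) rho"
      using rho_eq acts_asD(2) by (auto simp: kernel_def SL27_def aut_one)
  qed
  have i: "PSL27 \<cong> aut_group klein" unfolding PSL27_def k[symmetric] by (rule FactGroup_iso[OF s])
  have "group PSL27" unfolding PSL27_def k[symmetric] by (rule normal.factorgroup_is_group[OF normal_kernel])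
  then show ?thesis using group.iso_sym i by blast
qed

section \<open>The invariant spin structure\<close>

lemma Th_invariant: "f \<in> Aut \<Longrightarrow> pull f Th - Th \<in> PD"
  using Aut_acts_as acts_asD(4) by blast

lemma class_act_eq: "class_act klein f S = pull f ` S"
  unfolding class_act_def pull_def[abs_def] ..

lemma pull_ainv:
  assumes f: "f \<in> Aut" and D: "Poly_Mapping.keys D \<subseteq> klein" shows "pull f (pull (ainv f) D) = D"
proof -
  have "compose klein (ainv f) f = gA 0"
    unfolding gA_0 by (rule Aut_eqI[OF compose_Aut[OF ainv_Aut[OF f] f] id_Aut]) (simp add: compose_def ainv_apply[OF f])
  then have "pull f (pull (ainv f) D) = pull (gA 0) D" using pull_compose[OF ainv_Aut[OF f] f D] by simp
  also have "\<dots> = D"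
  proof (rule poly_mapping_eqI)
    fix P
    show "Poly_Mapping.lookup (pull (gA 0) D) P = Poly_Mapping.lookup D P"
    proof (cases "P \<in> klein")
      case True
      then show ?thesis unfolding lookup_pull[OF gA_Aut D True] by (simp add: gA_0)
    next
      case False
      then have "P \<notin> Poly_Mapping.keys (pull (gA 0) D)" "P \<notin> Poly_Mapping.keys D"
        using keys_pull[OF gA_Aut D, of 0] D by blast+
      then show ?thesis unfolding in_keys_iff by simp
    qed
  qed
  finally show ?thesis .
qed

text \<open>As the action takes images of sets, equality also requires every representative to be
  hit; the pullback along \<open>ainv f\<close> supplies its preimage.\<close>

lemma class_act_Th:
  assumes f: "f \<in> Aut" shows "class_act klein f (divisor_class klein Th) = divisor_class klein Th"
proof -
  have m: "pull g E \<in> divisor_class klein Th" if g: "g \<in> Aut" and E: "E \<in> divisor_class klein Th" for g E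
  proof -
    have "pull g (E - Th) + (pull g Th - Th) \<in> PD"
      using PD_add[OF PD_pull[OF g] Th_invariant[OF g]] E by (simp add: mem_divisor_class)
    moreover have "pull g (E - Th) + (pull g Th - Th) = pull g E - Th" by (simp add: pull_diff)
    ultimately show ?thesis by (simp add: mem_divisor_class)
  qed
  have "E \<in> pull f ` divisor_class klein Th" if E: "E \<in> divisor_class klein Th" for E
  proof -
    have "Poly_Mapping.keys (E - Th) \<subseteq> klein" using E PD_keys by (simp add: mem_divisor_class)
    from keys_add_subset[OF this keys_Th] have "Poly_Mapping.keys E \<subseteq> klein" by simp
    from pull_ainv[OF f this] show ?thesis using m[OF ainv_Aut[OF f] E] by (metis imageI)
  qed
  then show ?thesis using m[OF f] unfolding class_act_eq by blast
qed

text \<open>The difference of two spin structures is 2-torsion, and here it is fixed by the order 7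
  symmetry, so \<open>invariant_two_torsion\<close> makes it trivial.\<close>

lemma invariant_spin_unique:
  assumes S: "S \<in> spin_structures klein" and inv: "\<And>i. class_act klein (gA i) S = S"
  shows "S = divisor_class klein Th"
proof -
  obtain E where E: "S = divisor_class klein E" "Poly_Mapping.keys E \<subseteq> klein"
    using S by (auto simp: spin_structures_def carrier_class_group)
  have EE: "E + E - Dz \<in> PD"
    using S by (simp add: spin_structures_def E(1) class_group_mult[OF E(2,2)] canonical_class_eq divisor_class_eq_iff)
  define D where "D = E - Th"
  have "D \<in> PD"
  proof (rule invariant_two_torsion)
    show "Poly_Mapping.keys D \<subseteq> klein" unfolding D_def by (rule keys_diff_subset[OF E(2) keys_Th])
    have "D + D = (E + E - Dz) - (Th + Th - Dz)" by (simp add: D_def)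
    then show "D + D \<in> PD" using PD_diff[OF EE Th_spin] by simp
    fix i
    have "E \<in> S" by (simp add: E(1) mem_divisor_class PD_zero)
    then have "pull (gA i) E \<in> S" using inv[of i] unfolding class_act_eq by blast
    then have "pull (gA i) E - E \<in> PD" by (simp add: E(1) mem_divisor_class)
    moreover have "pull (gA i) D - D = (pull (gA i) E - E) - (pull (gA i) Th - Th)" by (simp add: D_def pull_diff)
    ultimately show "pull (gA i) D - D \<in> PD" using PD_diff[OF _ Th_gA] by simp
  qed
  then show ?thesis unfolding E(1) divisor_class_eq_iff D_def .
qed

lemma Th_spin_structure: "divisor_class klein Th \<in> spin_structures klein"
  using Th_spin keys_Th unfolding spin_structures_def carrier_class_group
  by (auto simp: class_group_mult canonical_class_eq divisor_class_eq_iff PD_zero intro!: exI[of _ Th])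

lemma Th_class:
  "divisor_class klein Dabc \<otimes>\<^bsub>class_group klein\<^esub> inv\<^bsub>class_group klein\<^esub> canonical_class klein
    = divisor_class klein Th"
proof -
  have "Poly_Mapping.keys (- Dz) \<subseteq> klein" using keys_Dz by simp
  then show ?thesis
    by (simp add: canonical_class_eq class_group_inv[OF keys_Dz] class_group_mult[OF keys_Dabc] Th_def)
qed

theorem theorem1p4:
  fixes a b c :: cp2
  defines "a \<equiv> pt 1 0 0" and "b \<equiv> pt 0 1 0" and "c \<equiv> pt 0 0 1"
  shows "{a, b, c} \<subseteq> klein
    \<and> (\<forall>u. u \<noteq> 0 \<longrightarrow> (\<exists>D. has_divisor klein (line_expr u) D \<and>
                            divisor_class klein D = canonical_class klein))
    \<and> aut_group klein \<cong> PSL27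
    \<and> {S \<in> spin_structures klein. \<forall>f\<in>carrier (aut_group klein). class_act klein f S = S}
      = {divisor_class klein (frag_cmul 2 (frag_of a) + frag_cmul 2 (frag_of b)
                                + frag_cmul 2 (frag_of c))
           \<otimes>\<^bsub>class_group klein\<^esub> inv\<^bsub>class_group klein\<^esub> canonical_class klein}"
proof (intro conjI allI impI)
  have abc: "a = ptA" "b = ptB" "c = ptC" by (simp_all add: a_def b_def c_def ptA_def ptB_def ptC_def)
  show "{a, b, c} \<subseteq> klein" using abc_in_klein by (simp add: abc)
  show "\<exists>D. has_divisor klein (line_expr u) D \<and> divisor_class klein D = canonical_class klein"
    if u: "u \<noteq> 0" for u
  proof -
    obtain D where "has_divisor klein (line_expr u) D" "D - Dz \<in> PD" by (rule line_divisor[OF u])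
    then show ?thesis unfolding canonical_class_eq divisor_class_eq_iff by blast
  qed
  show "aut_group klein \<cong> PSL27" by (rule aut_iso_PSL27)
  show "{S \<in> spin_structures klein. \<forall>f\<in>carrier (aut_group klein). class_act klein f S = S}
      = {divisor_class klein (frag_cmul 2 (frag_of a) + frag_cmul 2 (frag_of b) + frag_cmul 2 (frag_of c))
           \<otimes>\<^bsub>class_group klein\<^esub> inv\<^bsub>class_group klein\<^esub> canonical_class klein}"
    unfolding abc Dabc_def[symmetric] Th_class aut_carrier
  proof (intro equalityI subsetI)
    fix S assume "S \<in> {S \<in> spin_structures klein. \<forall>f\<in>Aut. class_act klein f S = S}"
    then have "S \<in> spin_structures klein" "class_act klein (gA i) S = S" for i using gA_Aut by auto
    then show "S \<in> {divisor_class klein Th}" using invariant_spin_unique by simp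
  qed (use Th_spin_structure class_act_Th in auto)
qed

end
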